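(* Let $0<p,q<\infty$ with $p\neq q$. If $0<p<2$ or $0<q\le 1$, then there is no linear isomorphic embedding $T:\ell_{p,q}\to L_{p,q}(0,1)$.
   Context: Functions and sequences are scalar-valued. For a measurable function $f$ on a measure space $(\Omega,\mu)$, $d_f(\lambda)=\mu\{|f|>\lambda\}$ and $f^*(t)=\inf\{\lambda>0:d_f(\lambda)\le t\}$, $t>0$, is its decreasing rearrangement. For $0<p,q<\infty$, $L_{p,q}(\Omega)$ is the space of (classes of) measurable $f$ with $\|f\|_{p,q}=\left(\int_0^\infty [t^{1/p}f^*(t)]^q\,\frac{dt}{t}\right)^{1/q}<\infty$; $(0,1)$ carries Lebesgue measure. The sequence space $\ell_{p,q}$ consists of scalar sequences $a=(a_k)_{k\ge1}$ with $\|a\|_{\ell_{p,q}}=\left(\sum_{k=1}^\infty (a_k^* )^q[k^{q/p}-(k-1)^{q/p}]\right)^{1/q}<\infty$, where $(a_k^* )$ is the decreasing rearrangement of $(|a_k|)$. These are quasi-norms. A linear isomorphic embedding $T:X\to Y$ of quasi-Banach spaces is a linear map for which there is $C\ge1$ with $C^{-1}\|x\|_X\le\|Tx\|_Y\le C\|x\|_X$ for all $x\in X$. *)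

theory Defs
  imports "HOL-Analysis.Analysis"
begin

(* Real powers on [0,\<infinity>], meant for exponents r > 0, so that 0 and \<infinity> are fixed. *)
definition epowr :: "ennreal \<Rightarrow> real \<Rightarrow> ennreal" (infixr "epowr" 80)
  where "x epowr r = (if x = top then top else ennreal (enn2real x powr r))"

definition distribution_fun :: "'a measure \<Rightarrow> ('a \<Rightarrow> 'k::real_normed_field) \<Rightarrow> real \<Rightarrow> ennreal"
  where "distribution_fun M f l = emeasure M {x \<in> space M. norm (f x) > l}"

(* Valued in [0,\<infinity>], so that the infimum of the empty set is \<infinity>. *)
definition rearrangement :: "'a measure \<Rightarrow> ('a \<Rightarrow> 'k::real_normed_field) \<Rightarrow> real \<Rightarrow> ennreal"
  where "rearrangement M f t = Inf (ennreal ` {l. l > 0 \<and> distribution_fun M f l \<le> ennreal t})"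

definition lorentz_norm :: "'a measure \<Rightarrow> real \<Rightarrow> real \<Rightarrow> ('a \<Rightarrow> 'k::real_normed_field) \<Rightarrow> ennreal"
  where "lorentz_norm M p q f =
    (\<integral>\<^sup>+ t \<in> {0<..}. (ennreal (t powr (1/p)) * rearrangement M f t) epowr q / ennreal t \<partial>lborel)
      epowr (1/q)"

(* Functions rather than classes: elements are identified when they agree almost everywhere. *)
definition lorentz_space :: "'a measure \<Rightarrow> real \<Rightarrow> real \<Rightarrow> ('a \<Rightarrow> 'k::real_normed_field) set"
  where "lorentz_space M p q = {f \<in> borel_measurable M. lorentz_norm M p q f < top}"

(* Sequences are indexed from 0, i.e. a k is the (k+1)-st term. The (k+1)-st term of the decreasing
   rearrangement is inf {l > 0. card {j. norm (a j) > l} \<le> k}, that is, the rearrangement with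
   respect to counting measure evaluated on [k, k+1). *)
definition seq_rearrangement :: "(nat \<Rightarrow> 'k::real_normed_field) \<Rightarrow> nat \<Rightarrow> ennreal"
  where "seq_rearrangement a k = rearrangement (count_space UNIV) a (real k)"

definition lorentz_seq_norm :: "real \<Rightarrow> real \<Rightarrow> (nat \<Rightarrow> 'k::real_normed_field) \<Rightarrow> ennreal"
  where "lorentz_seq_norm p q a =
    (\<Sum>k. seq_rearrangement a k epowr q
            * ennreal (real (Suc k) powr (q/p) - real k powr (q/p))) epowr (1/q)"

definition lorentz_seq_space :: "real \<Rightarrow> real \<Rightarrow> (nat \<Rightarrow> 'k::real_normed_field) set"
  where "lorentz_seq_space p q = {a. lorentz_seq_norm p q a < top}"

(* A map into classes of functions is given by a choice of representatives, so linearity is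
   required almost everywhere only. Values of T outside the sequence space are irrelevant. *)
definition lorentz_iso_embedding ::
    "real \<Rightarrow> real \<Rightarrow> 'a measure \<Rightarrow> ((nat \<Rightarrow> 'k::real_normed_field) \<Rightarrow> 'a \<Rightarrow> 'k) \<Rightarrow> bool"
  where "lorentz_iso_embedding p q M T \<longleftrightarrow>
    (\<forall>a \<in> lorentz_seq_space p q. T a \<in> lorentz_space M p q) \<and>
    (\<forall>a \<in> lorentz_seq_space p q. \<forall>b \<in> lorentz_seq_space p q.
       AE x in M. T (\<lambda>k. a k + b k) x = T a x + T b x) \<and>
    (\<forall>c. \<forall>a \<in> lorentz_seq_space p q. AE x in M. T (\<lambda>k. c * a k) x = c * T a x) \<and>
    (\<exists>C::real. C \<ge> 1 \<and> (\<forall>a \<in> lorentz_seq_space p q.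
       lorentz_seq_norm p q a / ennreal C \<le> lorentz_norm M p q (T a) \<and>
       lorentz_norm M p q (T a) \<le> ennreal C * lorentz_seq_norm p q a))"

end

theory Submission
  imports Defs "HOL-Library.Diagonal_Subsequence" "HOL-Probability.Probability_Measure"
begin

text \<open>
  On a probability space, \<open>norm f ^ q\<close> is up to constants and a bounded summand the sum over \<open>i\<close> of
  \<open>2 ^ (i q) (lev f i) ^ a\<close>, where \<open>lev f i\<close> is the measure of \<open>{norm f > 2 ^ i}\<close> and \<open>a = q / p\<close>.
  Let \<open>f k\<close> be the image of the \<open>k\<close>-th unit vector and average over random signs.

  If \<open>p < 2\<close>, orthogonality below level \<open>i\<close> and the union bound above it bound the levels of
  \<open>f 1 \<plusminus> \<dots> \<plusminus> f n\<close> by a Hardy transform of the sum of the levels of the \<open>f k\<close>. Along a subsequence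
  that sum is \<open>n\<close> times a fixed profile plus an error, so truncation at measure \<open>1\<close> makes the norm
  \<open>o(n ^ (1/p))\<close>, whereas it should be of order \<open>n ^ (1/p)\<close>. The error is controlled by a gliding
  hump for \<open>p < q\<close>; for \<open>q < p\<close> no mass can escape to high levels, since bumps at different levels
  would produce sums of size \<open>n ^ (1/q)\<close>.

  If \<open>p > 2\<close>, then \<open>L\<^sub>2\<close>-orthogonality gives \<open>f k\<close> arbitrarily close to \<open>0\<close> in measure, and since no mass
  escapes also in norm. If \<open>p = 2\<close> and \<open>q < 2\<close>, the coefficients \<open>k ^ (-1/2)\<close> for \<open>k < 4 ^ L\<close> (rounded to
  powers of \<open>2\<close>) give a vector with \<open>norm ^ q\<close> of order \<open>L\<close>, but its image only has
  \<open>norm ^ q = o(L)\<close>: it has second moment of order \<open>L\<close>, and Hoelder's inequality over the \<open>O(L)\<close>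
  relevant levels gains because the high levels of the \<open>f k\<close> carry little mass.
\<close>

subsection \<open>Elementary inequalities and sign averages\<close>

text \<open>The exponent \<open>a = q / p\<close> may lie on either side of \<open>1\<close> and the
  norms are only quasi-norms, so neither a triangle inequality nor duality is at hand. They are
  replaced by Khintchine's inequality in the form: the average over signs of
  \<open>(c + N) powr a\<close>, with \<open>N\<close> the squared norm of the signed sum, is at
  most \<open>(c + D * S) powr a\<close>, with \<open>S\<close> the sum of the squared norms; this
  holds for every \<open>a > 0\<close>. The constant \<open>c\<close> couples the two halves of a
  truncation: the measure where some summand is large goes into \<open>c\<close>, the rest is a
  second moment, and both stay under one power. Only the levels \<open>2 ^ i\<close> with
  \<open>i \<ge> 0\<close> are recorded. This is why lower estimates read
  \<open>Kl * (1 + B)\<close>: the \<open>1\<close> is harmless against norms tending to infinity,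
  and for \<open>p > 2\<close>, where a single function is tested, it is removed by rescaling. When
  \<open>p \<ge> 2\<close>, the hypotheses give \<open>q \<le> 1 < p\<close>, so tails are uniform
  there as well. After the reduction to \<open>lorentz_basis\<close> scalars are just elements of a
  Euclidean space, with real signs and coefficients.\<close>

lemma powr_add_le:
  fixes u v a :: real
  assumes "0 \<le> u" "0 \<le> v" "0 < a"
  shows "(u + v) powr a \<le> 2 powr a * (u powr a + v powr a)"
proof -
  have "(u + v) powr a \<le> (2 * max u v) powr a"
    using assms by (intro powr_mono2) auto
  also have "\<dots> = 2 powr a * max u v powr a"
    using assms by (simp add: powr_mult)
  also have "max u v powr a \<le> u powr a + v powr a"
    by (auto simp: max_def)
  finally show ?thesis by simp
qed

text \<open>After division by \<open>s = u + v\<close> both numbers lie in \<open>[0, 1]\<close>,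
  where \<open>t \<le> t powr a\<close>.\<close>

lemma powr_add_le_add_powr:
  fixes u v a :: real
  assumes "0 \<le> u" "0 \<le> v" "0 < a" "a \<le> 1"
  shows "(u + v) powr a \<le> u powr a + v powr a"
proof (cases "u + v = 0")
  case False
  define s where "s = u + v"
  have s: "0 < s" using False assms by (simp add: s_def)
  have le: "t / s \<le> (t / s) powr a" if "0 \<le> t" "t \<le> s" for t
  proof (cases "t = 0")
    case False
    then show ?thesis using that s assms powr_mono'[of a 1 "t / s"] by simp
  qed (use assms in auto)
  have "1 = u / s + v / s" using s by (simp add: s_def flip: add_divide_distrib)
  also have "\<dots> \<le> (u / s) powr a + (v / s) powr a"
    using assms by (intro add_mono le) (auto simp: s_def)
  also have "\<dots> = (u powr a + v powr a) / s powr a"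
    using assms s by (simp add: powr_divide add_divide_distrib)
  finally show ?thesis using s by (simp add: s_def pos_le_divide_eq)
qed (use assms in auto)

lemma sum_powr_le_add_powr:
  fixes h :: "'i \<Rightarrow> real"
  assumes "\<And>i. i \<in> P \<Longrightarrow> 0 \<le> h i" "0 < a" "a \<le> 1"
  shows "(\<Sum>i\<in>P. h i) powr a \<le> (\<Sum>i\<in>P. h i powr a)"
  using assms(1)
proof (induction P rule: infinite_finite_induct)
  case (insert i P)
  have "(\<Sum>j\<in>insert i P. h j) powr a = (h i + sum h P) powr a"
    using insert.hyps by simp
  also have "\<dots> \<le> h i powr a + sum h P powr a"
    using assms insert.prems by (intro powr_add_le_add_powr) (auto intro!: sum_nonneg)
  also have "sum h P powr a \<le> (\<Sum>j\<in>P. h j powr a)"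
    using insert by auto
  finally show ?case using insert.hyps by simp
qed (use assms in auto)

text \<open>Hoelder's inequality against the constant 1: Young's inequality between each
  \<open>h i\<close> and the mean \<open>m\<close> sums to exactly \<open>sum h P\<close>. It is
  applied both to averages over signs and to sums over levels.\<close>

lemma sum_powr_le_card:
  fixes h :: "'i \<Rightarrow> real"
  assumes h: "\<And>i. i \<in> P \<Longrightarrow> 0 \<le> h i" and a: "0 < a" "a \<le> 1"
  shows "(\<Sum>i\<in>P. h i powr a) \<le> real (card P) powr (1 - a) * (\<Sum>i\<in>P. h i) powr a"
proof (cases "sum h P = 0 \<or> infinite P \<or> a = 1")
  case True
  then consider "infinite P" | "a = 1" "finite P" | "finite P" "sum h P = 0" by blast
  then show ?thesis
  proof cases
    case 3
    then have "h i = 0" if "i \<in> P" for i using h that by (simp add: sum_nonneg_eq_0_iff)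
    then show ?thesis using 3 a by (simp add: sum.neutral)
  next
    case 2
    then show ?thesis using h
      by (cases "P = {}") (auto simp: sum_nonneg)
  qed auto
next
  case False
  define n where "n = real (card P)"
  define m where "m = sum h P / n"
  have n: "0 < n" using False by (auto simp: n_def card_gt_0_iff)
  have S: "0 < sum h P" using False sum_nonneg[of P h] h by fastforce
  have m: "0 < m" using n S by (simp add: m_def)
  have "h i powr a * m powr (1 - a) \<le> a * h i + (1 - a) * m" if "i \<in> P" for i
  proof (cases "h i = 0")
    case False
    then show ?thesis
      using h[OF that] m a by (intro Youngs_inequality_0) auto
  qed (use m a in auto)
  then have "(\<Sum>i\<in>P. h i powr a * m powr (1 - a)) \<le> (\<Sum>i\<in>P. a * h i + (1 - a) * m)"
    by (intro sum_mono)
  also have "\<dots> = a * sum h P + (1 - a) * (n * m)"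
    by (simp add: sum.distrib sum_distrib_left n_def)
  also have "\<dots> = sum h P" using n by (simp add: m_def algebra_simps)
  finally have "(\<Sum>i\<in>P. h i powr a) * m powr (1 - a) \<le> sum h P"
    by (simp add: sum_distrib_right)
  then have "(\<Sum>i\<in>P. h i powr a) \<le> sum h P / m powr (1 - a)"
    using m by (simp add: pos_le_divide_eq)
  also have "\<dots> = sum h P * n powr (1 - a) / sum h P powr (1 - a)"
    using n S by (simp add: m_def powr_divide)
  also have "\<dots> = n powr (1 - a) * (sum h P / sum h P powr (1 - a))" by simp
  also have "sum h P / sum h P powr (1 - a) = sum h P powr a"
    using S powr_diff[of "sum h P" 1 "1 - a"] by simp
  finally show ?thesis by (simp add: n_def)
qed

text \<open>Writing \<open>t = sqrt t * sqrt t\<close>, one factor keeps the geometric series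
  summable while the other is absorbed into the maximum \<open>m\<close>; then
  \<open>m powr a\<close> is a single term of the right-hand sum. This treats
  \<open>a \<le> 1\<close> and \<open>a \<ge> 1\<close> at once.\<close>

lemma geometric_sum_powr_le:
  fixes v :: "nat \<Rightarrow> real" and t a :: real
  assumes t: "0 < t" "t < 1" and a: "0 < a" and v: "\<And>j. 0 \<le> v j"
  shows "(\<Sum>j\<le>i. t ^ (i - j) * v j) powr a
    \<le> (1 / (1 - sqrt t)) powr a * (\<Sum>j\<le>i. (sqrt t powr a) ^ (i - j) * v j powr a)"
proof -
  define s where "s = sqrt t"
  have s: "0 < s" "s < 1" "s * s = t" using t by (auto simp: s_def)
  define m where "m = Max ((\<lambda>j. s ^ (i - j) * v j) ` {..i})"
  have m: "s ^ (i - j) * v j \<le> m" if "j \<le> i" for j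
    unfolding m_def using that by (intro Max_ge) auto
  have m0: "0 \<le> m" using m[of i] v[of i] by simp
  have "m \<in> (\<lambda>j. s ^ (i - j) * v j) ` {..i}" unfolding m_def by (intro Max_in) auto
  then obtain j where j: "j \<le> i" "m = s ^ (i - j) * v j" by auto
  have "(\<Sum>j\<le>i. t ^ (i - j) * v j) = (\<Sum>j\<le>i. s ^ (i - j) * (s ^ (i - j) * v j))"
    using s by (intro sum.cong) (auto simp flip: power_mult_distrib)
  also have "\<dots> \<le> (\<Sum>j\<le>i. s ^ (i - j) * m)"
    using m s by (intro sum_mono mult_left_mono) auto
  also have "\<dots> = (\<Sum>j\<le>i. s ^ j) * m"
    unfolding sum_distrib_right
    by (rule sum.reindex_bij_witness[of _ "\<lambda>j. i - j" "\<lambda>j. i - j"]) auto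
  also have "\<dots> \<le> 1 / (1 - s) * m"
  proof -
    have "(\<Sum>j\<le>i. s ^ j) \<le> (\<Sum>j. s ^ j)" using s by (intro sum_le_suminf) (auto intro!: summable_geometric)
    also have "\<dots> = 1 / (1 - s)" using s by (intro suminf_geometric) auto
    finally show ?thesis using m0 by (intro mult_right_mono)
  qed
  finally have "(\<Sum>j\<le>i. t ^ (i - j) * v j) powr a \<le> (1 / (1 - s) * m) powr a"
    using t v a by (intro powr_mono2) (auto intro!: sum_nonneg)
  also have "\<dots> = (1 / (1 - s)) powr a * m powr a" using s m0 by (simp add: powr_mult powr_divide)
  also have "m powr a = (s powr a) ^ (i - j) * v j powr a"
    using s v by (simp add: j powr_mult powr_power powr_powr mult.commute flip: powr_realpow)
  also have "\<dots> \<le> (\<Sum>j\<le>i. (s powr a) ^ (i - j) * v j powr a)"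
    using j by (intro member_le_sum) auto
  finally show ?thesis using s by (simp add: s_def mult_left_mono)
qed

section \<open>Khintchine's inequality for positive semidefinite forms, with sign patterns encoded
  as sets\<close>

definition sgn_of :: "nat set \<Rightarrow> nat \<Rightarrow> real" where
  "sgn_of U k = (if k \<in> U then 1 else -1)"

lemma sgn_of_simps [simp]: "\<bar>sgn_of U k\<bar> = 1" "sgn_of U k * sgn_of U k = 1"
  by (auto simp: sgn_of_def)

text \<open>Sign averages are sums over the \<open>2 ^ n\<close> subsets of \<open>{..<n}\<close>;
  this is conditioning on the last sign, which drives the inductions on \<open>n\<close>.\<close>

lemma sum_Pow_lessThan_Suc:
  fixes F :: "nat set \<Rightarrow> 'a::comm_monoid_add"
  shows "(\<Sum>U\<in>Pow {..<Suc n}. F U) = (\<Sum>U\<in>Pow {..<n}. F U + F (insert n U))"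
proof -
  have "(\<Sum>U\<in>Pow {..<Suc n}. F U) = (\<Sum>U\<in>Pow {..<n} \<union> insert n ` Pow {..<n}. F U)"
    by (simp add: lessThan_Suc Pow_insert)
  also have "\<dots> = (\<Sum>U\<in>Pow {..<n}. F U) + (\<Sum>U\<in>insert n ` Pow {..<n}. F U)"
    by (intro sum.union_disjoint) auto
  also have "(\<Sum>U\<in>insert n ` Pow {..<n}. F U) = (\<Sum>U\<in>Pow {..<n}. F (insert n U))"
    by (subst sum.reindex) (auto simp: inj_on_def)
  finally show ?thesis by (simp add: sum.distrib)
qed

text \<open>The exact linear term is the point, since it cancels between \<open>t\<close> and
  \<open>- t\<close>; \<open>4 ^ N\<close> is a crude bound for the rest that suits the
  induction.\<close>

lemma one_plus_power_le:
  fixes t :: real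
  assumes "\<bar>t\<bar> \<le> 1"
  shows "(1 + t) ^ N \<le> 1 + N * t + 4 ^ N * t\<^sup>2"
proof (induction N)
  case (Suc N)
  have t: "t * t\<^sup>2 \<le> t\<^sup>2" using assms mult_right_mono[of t 1 "t\<^sup>2"] by auto
  have N: "real N \<le> 4 ^ N"
    using order.trans[OF less_imp_le[OF of_nat_less_two_power] power_mono[of 2 "4::real" N]] by simp
  have "(1 + t) ^ Suc N \<le> (1 + t) * (1 + N * t + 4 ^ N * t\<^sup>2)"
    using Suc assms by (auto intro!: mult_left_mono)
  also have "\<dots> = 1 + Suc N * t + (N + 4 ^ N) * t\<^sup>2 + 4 ^ N * (t * t\<^sup>2)"
    by (simp add: algebra_simps power2_eq_square)
  also have "\<dots> \<le> 1 + Suc N * t + (N + 4 ^ N) * t\<^sup>2 + 4 ^ N * t\<^sup>2"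
    using t by (intro add_left_mono mult_left_mono) auto
  also have "\<dots> \<le> 1 + Suc N * t + 4 ^ Suc N * t\<^sup>2"
    using mult_right_mono[OF order.trans[OF N], of "2 * 4 ^ N" "t\<^sup>2"]
    by (simp add: algebra_simps)
  finally show ?case .
qed simp

text \<open>One step of Khintchine's inequality: \<open>X\<close> stands for the squared norm of the
  old sum (plus a constant), \<open>Y\<close> for that of the new vector, \<open>B\<close> for twice
  their inner product, and the bound on \<open>B\<close> is Cauchy-Schwarz. After normalisation by
  \<open>A = X + Y\<close> the linear terms cancel, and the quadratic one
  \<open>A * t\<^sup>2\<close> is at most \<open>4 * Y\<close>.\<close>

lemma two_point_power:
  fixes X Y B :: real
  assumes X: "0 \<le> X" and Y: "0 \<le> Y" and B: "B\<^sup>2 \<le> 4 * (X * Y)" and N: "1 \<le> N"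
  shows "(X + Y + B) ^ N + (X + Y - B) ^ N \<le> 2 * (X + (1 + 4 ^ Suc N) * Y) ^ N"
proof (cases "X + Y = 0")
  case True
  then show ?thesis using assms by (auto simp: add_nonneg_eq_0_iff)
next
  case False
  define A where "A = X + Y"
  define t where "t = B / A"
  have A: "0 < A" using False X Y by (simp add: A_def)
  have "4 * (X * Y) \<le> A\<^sup>2"
    using zero_le_power2[of "X - Y"] by (simp add: A_def power2_eq_square algebra_simps)
  then have "B\<^sup>2 \<le> A\<^sup>2" using B by simp
  then have BA: "\<bar>B\<bar> \<le> A" using A by (simp add: abs_le_square_iff[symmetric])
  have t: "\<bar>t\<bar> \<le> 1" using BA A by (simp add: t_def)
  have At: "A * t = B" using A by (simp add: t_def)
  have "(1 + t) ^ N + (1 + (- t)) ^ N \<le> 2 * (1 + 4 ^ N * t\<^sup>2)"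
    using one_plus_power_le[of t N] one_plus_power_le[of "-t" N] t by (simp add: algebra_simps)
  also have "1 + 4 ^ N * t\<^sup>2 \<le> (1 + 4 ^ N * t\<^sup>2) ^ N"
    using N by (intro self_le_power) auto
  finally have *: "(1 + t) ^ N + (1 - t) ^ N \<le> 2 * (1 + 4 ^ N * t\<^sup>2) ^ N" by simp
  have "(A + B) ^ N + (A - B) ^ N = A ^ N * ((1 + t) ^ N + (1 - t) ^ N)"
    by (simp add: At algebra_simps flip: power_mult_distrib)
  also have "\<dots> \<le> A ^ N * (2 * (1 + 4 ^ N * t\<^sup>2) ^ N)"
    using A * by (intro mult_left_mono) auto
  also have "\<dots> = 2 * (A + 4 ^ N * (A * t\<^sup>2)) ^ N"
    by (simp add: algebra_simps flip: power_mult_distrib)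
  also have "\<dots> \<le> 2 * (X + (1 + 4 ^ Suc N) * Y) ^ N"
  proof -
    have "A * t\<^sup>2 = B\<^sup>2 / A" using A by (simp add: t_def power2_eq_square)
    also have "\<dots> \<le> 4 * Y"
    proof -
      have "B\<^sup>2 \<le> 4 * Y * X" using B by (simp add: algebra_simps)
      also have "\<dots> \<le> 4 * Y * A" using Y X by (intro mult_left_mono) (auto simp: A_def)
      finally show ?thesis using A by (simp add: pos_divide_le_eq)
    qed
    finally have "A + 4 ^ N * (A * t\<^sup>2) \<le> X + Y + 4 ^ N * (4 * Y)"
      by (simp add: A_def)
    then show ?thesis using A by (intro mult_left_mono power_mono) (auto simp: algebra_simps)
  qed
  finally show ?thesis by (simp add: A_def)
qed

text \<open>The squared norm of the combination with coefficients \<open>c\<close> when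
  \<open>G\<close> is a Gram matrix. Keeping \<open>G\<close> abstract lets one inequality serve
  inner products of values at a point and of functions in \<open>L\<^sub>2\<close>.\<close>

definition gram_form :: "(nat \<Rightarrow> nat \<Rightarrow> real) \<Rightarrow> nat \<Rightarrow> (nat \<Rightarrow> real) \<Rightarrow> real" where
  "gram_form G n c = (\<Sum>k<n. \<Sum>l<n. c k * c l * G k l)"

lemma gram_form_Suc:
  assumes "\<And>k l. G k l = G l k"
  shows "gram_form G (Suc n) c = gram_form G n c + 2 * (c n * (\<Sum>k<n. c k * G k n)) + c n * c n * G n n"
proof -
  have "(\<Sum>l<n. c n * c l * G n l) = c n * (\<Sum>k<n. c k * G k n)"
    by (simp add: sum_distrib_left assms[of n] mult.assoc)
  moreover have "(\<Sum>k<n. c k * c n * G k n) = c n * (\<Sum>k<n. c k * G k n)"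
    by (simp add: sum_distrib_left algebra_simps)
  ultimately show ?thesis by (simp add: gram_form_def sum.distrib)
qed

lemma gram_form_cong: "(\<And>k. k < n \<Longrightarrow> c k = d k) \<Longrightarrow> gram_form G n c = gram_form G n d"
  unfolding gram_form_def by (intro sum.cong refl) auto

text \<open>Positivity of the form at \<open>c\<close> extended by a last coefficient
  \<open>s\<close> is a quadratic inequality in \<open>s\<close>.\<close>

lemma gram_form_Cauchy_Schwarz:
  assumes sym: "\<And>k l. G k l = G l k" and psd: "\<And>n c. 0 \<le> gram_form G n c"
  shows "(\<Sum>k<n. c k * G k n)\<^sup>2 \<le> gram_form G n c * G n n"
proof -
  define b where "b = (\<Sum>k<n. c k * G k n)"
  define Q where "Q = gram_form G n c"
  have q: "0 \<le> Q + 2 * (s * b) + s * s * G n n" for s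
  proof -
    have "0 \<le> gram_form G (Suc n) (c(n := s))" by (rule psd)
    also have "\<dots> = Q + 2 * (s * b) + s * s * G n n"
      unfolding gram_form_Suc[OF sym] b_def Q_def
      by (simp cong: gram_form_cong)
    finally show ?thesis .
  qed
  have G: "0 \<le> G n n"
  proof -
    have "0 \<le> gram_form G (Suc n) (\<lambda>k. if k = n then 1 else 0)" by (rule psd)
    also have "\<dots> = G n n" unfolding gram_form_Suc[OF sym] by (simp add: gram_form_def)
    finally show ?thesis .
  qed
  show ?thesis
  proof (cases "G n n = 0")
    case True
    have "b = 0"
    proof (rule ccontr)
      assume "b \<noteq> 0"
      \<comment> \<open>Without a quadratic term, the affine function of \<open>s\<close> takes the
        value \<open>-1\<close> at this point.\<close>
      then show False using q[of "- (Q + 1) / (2 * b)"] True by (simp add: field_simps)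
    qed
    then show ?thesis using True by (simp add: b_def)
  next
    case False
    then have "0 < G n n" using G by simp
    moreover have "0 \<le> Q - b\<^sup>2 / G n n"
      using q[of "- b / G n n"] False by (simp add: power2_eq_square field_simps)
    ultimately show ?thesis by (simp add: b_def Q_def field_simps)
  qed
qed

text \<open>Induction on \<open>n\<close>: the additive constant \<open>c\<close> absorbs the diagonal terms already
  processed, so that no Minkowski inequality is needed.\<close>
lemma gram_form_sign_power:
  assumes sym: "\<And>k l. G k l = G l k" and psd: "\<And>n c. 0 \<le> gram_form G n c"
    and N: "1 \<le> N" and c: "0 \<le> c"
  shows "(\<Sum>U\<in>Pow {..<n}. (c + gram_form G n (sgn_of U)) ^ N)
    \<le> 2 ^ n * (c + (1 + 4 ^ Suc N) * (\<Sum>k<n. G k k)) ^ N"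
  using c
proof (induction n arbitrary: c)
  case 0
  then show ?case by (simp add: gram_form_def)
next
  case (Suc n)
  define C :: real where "C = 1 + 4 ^ Suc N"
  have G: "0 \<le> G n n"
  proof -
    have "0 \<le> gram_form G (Suc n) (\<lambda>k. if k = n then 1 else 0)" by (rule psd)
    also have "\<dots> = G n n" unfolding gram_form_Suc[OF sym] by (simp add: gram_form_def)
    finally show ?thesis .
  qed
  have C: "0 \<le> C" by (simp add: C_def)
  have "(\<Sum>U\<in>Pow {..<Suc n}. (c + gram_form G (Suc n) (sgn_of U)) ^ N)
    = (\<Sum>U\<in>Pow {..<n}. (c + gram_form G (Suc n) (sgn_of U)) ^ N
        + (c + gram_form G (Suc n) (sgn_of (insert n U))) ^ N)"
    by (rule sum_Pow_lessThan_Suc)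
  also have "\<dots> \<le> (\<Sum>U\<in>Pow {..<n}. 2 * (c + C * G n n + gram_form G n (sgn_of U)) ^ N)"
  proof (intro sum_mono)
    fix U assume U: "U \<in> Pow {..<n}"
    define X where "X = c + gram_form G n (sgn_of U)"
    define B where "B = 2 * (\<Sum>k<n. sgn_of U k * G k n)"
    have "gram_form G n (sgn_of (insert n U)) = gram_form G n (sgn_of U)"
      by (intro gram_form_cong) (auto simp: sgn_of_def)
    moreover have "(\<Sum>k<n. sgn_of (insert n U) k * G k n) = (\<Sum>k<n. sgn_of U k * G k n)"
      by (intro sum.cong) (auto simp: sgn_of_def)
    moreover have "sgn_of U n = -1" "sgn_of (insert n U) n = 1" using U by (auto simp: sgn_of_def)
    ultimately have e: "c + gram_form G (Suc n) (sgn_of U) = X + G n n - B"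
      "c + gram_form G (Suc n) (sgn_of (insert n U)) = X + G n n + B"
      unfolding gram_form_Suc[OF sym] by (auto simp: X_def B_def)
    have "B\<^sup>2 = 4 * (\<Sum>k<n. sgn_of U k * G k n)\<^sup>2" by (simp add: B_def power_mult_distrib)
    also have "\<dots> \<le> 4 * (gram_form G n (sgn_of U) * G n n)"
      using gram_form_Cauchy_Schwarz[OF sym psd] by (intro mult_left_mono) auto
    also have "\<dots> \<le> 4 * (X * G n n)"
      using Suc.prems G by (intro mult_left_mono mult_right_mono) (auto simp: X_def)
    finally have "(X + G n n + B) ^ N + (X + G n n - B) ^ N \<le> 2 * (X + C * G n n) ^ N"
      unfolding C_def using Suc.prems psd G N by (intro two_point_power) (auto simp: X_def)
    then show "(c + gram_form G (Suc n) (sgn_of U)) ^ N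
        + (c + gram_form G (Suc n) (sgn_of (insert n U))) ^ N
        \<le> 2 * (c + C * G n n + gram_form G n (sgn_of U)) ^ N"
      unfolding e by (simp add: X_def algebra_simps)
  qed
  also have "\<dots> = 2 * (\<Sum>U\<in>Pow {..<n}. (c + C * G n n + gram_form G n (sgn_of U)) ^ N)"
    by (simp add: sum_distrib_left)
  also have "\<dots> \<le> 2 * (2 ^ n * (c + C * G n n + C * (\<Sum>k<n. G k k)) ^ N)"
    using Suc.IH[of "c + C * G n n"] Suc.prems C G by (intro mult_left_mono) (auto simp: C_def)
  also have "\<dots> = 2 ^ Suc n * (c + C * (\<Sum>k<Suc n. G k k)) ^ N"
    by (simp add: algebra_simps)
  finally show ?case by (simp add: C_def)
qed

definition khintchine_const :: "real \<Rightarrow> real" where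
  "khintchine_const a = 1 + 4 ^ Suc (nat \<lceil>a\<rceil>)"

lemma khintchine_const_ge_1: "1 \<le> khintchine_const a"
  by (simp add: khintchine_const_def)

text \<open>Integer exponents suffice: with \<open>N\<close> the ceiling of \<open>a\<close>, the
  power \<open>d = a / N \<le> 1\<close> is concave and passes outside the sign average by
  \<open>sum_powr_le_card\<close>.\<close>

lemma gram_form_sign_powr:
  assumes sym: "\<And>k l. G k l = G l k" and psd: "\<And>n c. 0 \<le> gram_form G n c"
    and a: "0 < a" and c: "0 \<le> c"
  shows "(\<Sum>U\<in>Pow {..<n}. (c + gram_form G n (sgn_of U)) powr a)
    \<le> 2 ^ n * (c + khintchine_const a * (\<Sum>k<n. G k k)) powr a"
proof -
  define N where "N = nat \<lceil>a\<rceil>"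
  define d where "d = a / N"
  define m where "m = c + khintchine_const a * (\<Sum>k<n. G k k)"
  define h where "h U = c + gram_form G n (sgn_of U)" for U
  have N: "1 \<le> N" "a \<le> N" using a by (auto simp: N_def) linarith+
  have d: "0 < d" "d \<le> 1" using a N by (auto simp: d_def)
  have h: "0 \<le> h U" for U using c psd by (simp add: h_def)
  have pw: "x powr a = (x ^ N) powr d" if "0 \<le> x" for x :: real
  proof (cases "x = 0")
    case False
    then show ?thesis using that N by (simp add: d_def powr_powr flip: powr_realpow)
  qed (use N a d in auto)
  have Gk: "0 \<le> G k k" for k
  proof -
    have "0 \<le> gram_form G (Suc k) (\<lambda>l. if l = k then 1 else 0)" by (rule psd)
    also have "\<dots> = G k k" unfolding gram_form_Suc[OF sym] by (simp add: gram_form_def)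
    finally show ?thesis .
  qed
  have m: "0 \<le> m" unfolding m_def using c Gk khintchine_const_ge_1[of a]
    by (intro add_nonneg_nonneg mult_nonneg_nonneg sum_nonneg) auto
  have "(\<Sum>U\<in>Pow {..<n}. h U powr a) = (\<Sum>U\<in>Pow {..<n}. (h U ^ N) powr d)"
    using h pw by simp
  also have "\<dots> \<le> real (card (Pow {..<n})) powr (1 - d) * (\<Sum>U\<in>Pow {..<n}. h U ^ N) powr d"
    using h d by (intro sum_powr_le_card) auto
  also have "\<dots> \<le> (2 ^ n) powr (1 - d) * (2 ^ n * m ^ N) powr d"
    using gram_form_sign_power[OF sym psd N(1) c, of n] d h
    by (intro mult_mono powr_mono2 sum_nonneg)
      (auto simp: card_Pow h_def m_def khintchine_const_def N_def)
  also have "\<dots> = (2 ^ n) powr (1 - d) * (2 ^ n) powr d * (m ^ N) powr d"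
    using m by (simp add: powr_mult)
  also have "\<dots> = 2 ^ n * m powr a"
    using pw[OF m] by (simp flip: powr_add)
  finally show ?thesis by (simp add: h_def m_def)
qed

subsection \<open>Level sets\<close>

definition lev :: "'b measure \<Rightarrow> ('b \<Rightarrow> 'k::real_normed_vector) \<Rightarrow> nat \<Rightarrow> real" where
  "lev M f i = measure M {x \<in> space M. 2 ^ i < norm (f x)}"

text \<open>A partial sum, so that all estimates stay among the reals and finiteness of the Lorentz
  norm becomes a bound uniform in \<open>I\<close>.\<close>

definition level_sum :: "real \<Rightarrow> real \<Rightarrow> 'b measure \<Rightarrow> ('b \<Rightarrow> 'k::real_normed_vector) \<Rightarrow> nat \<Rightarrow> real" where
  "level_sum p q M f I = (\<Sum>i<I. (2 ^ i) powr q * lev M f i powr (q / p))"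

definition band :: "real \<Rightarrow> real \<Rightarrow> ('b \<Rightarrow> 'k::real_normed_vector) \<Rightarrow> 'b \<Rightarrow> 'k" where
  "band u v f x = (if u < norm (f x) \<and> norm (f x) \<le> v then f x else 0)"

definition sgn_sum :: "nat set \<Rightarrow> nat \<Rightarrow> (nat \<Rightarrow> 'b \<Rightarrow> 'k::real_normed_vector) \<Rightarrow> 'b \<Rightarrow> 'k" where
  "sgn_sum U n g x = (\<Sum>k<n. sgn_of U k *\<^sub>R g k x)"

lemma lev_nonneg [simp]: "0 \<le> lev M f i"
  by (simp add: lev_def)

lemma level_sum_nonneg: "0 \<le> level_sum p q M f I"
  by (auto simp: level_sum_def intro!: sum_nonneg)

lemma level_sum_mono: "I \<le> J \<Longrightarrow> level_sum p q M f I \<le> level_sum p q M f J"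
  unfolding level_sum_def by (intro sum_mono2) auto

lemma band_measurable [measurable]:
  fixes f :: "'b \<Rightarrow> 'k::{real_normed_vector, second_countable_topology}"
  assumes [measurable]: "f \<in> borel_measurable M"
  shows "band u v f \<in> borel_measurable M"
  unfolding band_def by measurable

lemma sgn_sum_measurable [measurable]:
  fixes g :: "nat \<Rightarrow> 'b \<Rightarrow> 'k::{real_normed_vector, second_countable_topology}"
  assumes [measurable]: "\<And>k. g k \<in> borel_measurable M"
  shows "sgn_sum U n g \<in> borel_measurable M"
  unfolding sgn_sum_def by measurable

lemma norm_sgn_sum_le:
  assumes "\<And>k. k < n \<Longrightarrow> norm (g k x) \<le> R k"
  shows "norm (sgn_sum U n g x) \<le> (\<Sum>k<n. R k)"
  unfolding sgn_sum_def using assms by (intro sum_norm_le) auto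

lemma norm_sgn_sum_sq:
  fixes g :: "nat \<Rightarrow> 'b \<Rightarrow> 'k::real_inner"
  shows "(norm (\<Sum>k<n. c k *\<^sub>R g k x))\<^sup>2 = gram_form (\<lambda>k l. g k x \<bullet> g l x) n c"
  unfolding power2_norm_eq_inner gram_form_def
  by (simp add: inner_sum_left inner_sum_right sum_distrib_left ac_simps inner_commute)

lemma sgn_sum_norm_powr:
  fixes g :: "nat \<Rightarrow> 'b \<Rightarrow> 'k::real_inner"
  assumes "0 < a"
  shows "(\<Sum>U\<in>Pow {..<n}. ((norm (sgn_sum U n g x))\<^sup>2) powr a)
    \<le> 2 ^ n * (khintchine_const a * (\<Sum>k<n. (norm (g k x))\<^sup>2)) powr a"
proof -
  have "0 \<le> gram_form (\<lambda>k l. g k x \<bullet> g l x) m c" for m c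
    by (simp flip: norm_sgn_sum_sq)
  then show ?thesis
    using gram_form_sign_powr[of "\<lambda>k l. g k x \<bullet> g l x" a 0 n] assms
    by (simp add: sgn_sum_def norm_sgn_sum_sq inner_commute flip: power2_norm_eq_inner)
qed

lemma four_power_eq: "(4::real) ^ m = (2 ^ m)\<^sup>2"
  by (simp add: power2_eq_square flip: power_mult_distrib)

text \<open>If \<open>2 ^ m < s \<le> 2 ^ Suc m\<close>, then the \<open>m\<close>-th summand alone
  is at least \<open>s\<^sup>2\<close>.\<close>

lemma band_sq_le_sum:
  fixes s :: real
  assumes "m0 \<le> m1"
  shows "(if 2 ^ m0 < s \<and> s \<le> 2 ^ m1 then s\<^sup>2 else 0)
    \<le> (\<Sum>m=m0..<m1. 4 ^ Suc m * (if 2 ^ m < s then 1 else 0))"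
  using assms
proof (induction m1 rule: dec_induct)
  case (step m)
  have "s\<^sup>2 \<le> 4 ^ Suc m" if "0 \<le> s" "s \<le> 2 ^ Suc m"
    using power_mono[OF that(2,1), of 2] by (simp only: four_power_eq)
  note * = this
  have nn: "0 \<le> (\<Sum>m=m0..<m. 4 ^ Suc m * (if 2 ^ m < s then 1 else 0 :: real))"
    by (intro sum_nonneg) auto
  show ?case
  proof (cases "2 ^ m < s \<and> s \<le> 2 ^ Suc m")
    case True
    then have "0 \<le> s" using order.trans[of 0 "2 ^ m" s] by simp
    then show ?thesis using * True nn step by (simp add: add_increasing)
  next
    case False
    then consider "s \<le> 2 ^ m" | "2 ^ Suc m < s" by linarith
    then show ?thesis
    proof cases
      case 1
      then show ?thesis using step nn by (simp split: if_splits)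
    next
      case 2
      then show ?thesis using step nn by simp
    qed
  qed
qed auto

context prob_space
begin

lemma lev_le_1 [simp]: "lev M f i \<le> 1"
  by (simp add: lev_def)

lemma lev_antimono:
  fixes f :: "'a \<Rightarrow> 'k::{real_normed_vector, second_countable_topology}"
  assumes [measurable]: "f \<in> borel_measurable M" and "i \<le> j"
  shows "lev M f j \<le> lev M f i"
proof -
  have le: "(2::real) ^ i \<le> 2 ^ j" using assms(2) by (intro power_increasing) auto
  show ?thesis
    unfolding lev_def by (intro finite_measure_mono) (auto intro: le_less_trans[OF le])
qed

lemma lev_Suc_add:
  fixes f g :: "'a \<Rightarrow> 'k::{real_normed_vector, second_countable_topology}"
  assumes [measurable]: "f \<in> borel_measurable M" "g \<in> borel_measurable M"
    and h: "\<And>x. x \<in> space M \<Longrightarrow> h x = f x + g x"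
  shows "lev M h (Suc i) \<le> lev M f i + lev M g i"
proof -
  have "lev M h (Suc i) \<le> measure M ({x \<in> space M. 2 ^ i < norm (f x)} \<union> {x \<in> space M. 2 ^ i < norm (g x)})"
    unfolding lev_def
  proof (intro finite_measure_mono)
    show "{x \<in> space M. 2 ^ Suc i < norm (h x)}
      \<subseteq> {x \<in> space M. 2 ^ i < norm (f x)} \<union> {x \<in> space M. 2 ^ i < norm (g x)}"
    proof
      fix x assume x: "x \<in> {x \<in> space M. 2 ^ Suc i < norm (h x)}"
      then have "2 ^ i + 2 ^ i < norm (f x) + norm (g x)"
        using norm_triangle_ineq[of "f x" "g x"] h[of x] by auto
      then show "x \<in> {x \<in> space M. 2 ^ i < norm (f x)} \<union> {x \<in> space M. 2 ^ i < norm (g x)}"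
        using x by auto
    qed
  qed auto
  also have "\<dots> \<le> lev M f i + lev M g i"
    unfolding lev_def by (intro measure_Un_le) auto
  finally show ?thesis .
qed

lemma lev_eq_integral:
  fixes f :: "'a \<Rightarrow> 'k::{real_normed_vector, second_countable_topology}"
  assumes [measurable]: "f \<in> borel_measurable M"
  shows "lev M f i = (\<integral>x. (if 2 ^ i < norm (f x) then 1 else 0) \<partial>M)"
proof -
  have "(\<integral>x. (if 2 ^ i < norm (f x) then 1 else 0) \<partial>M)
    = (\<integral>x. indicat_real {x \<in> space M. 2 ^ i < norm (f x)} x \<partial>M)"
    by (intro Bochner_Integration.integral_cong) (auto simp: indicator_def)
  then show ?thesis by (simp add: lev_def)
qed

lemma integrable_bounded:
  fixes h :: "'a \<Rightarrow> real"
  assumes "h \<in> borel_measurable M" "\<And>x. x \<in> space M \<Longrightarrow> \<bar>h x\<bar> \<le> R"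
  shows "integrable M h"
  using assms by (intro integrable_const_bound[where B = R]) auto

lemma integral_band_sq_le:
  fixes f :: "'a \<Rightarrow> 'k::{real_normed_vector, second_countable_topology}"
  assumes [measurable]: "f \<in> borel_measurable M" and m: "m0 \<le> m1" and u: "2 ^ m0 \<le> u"
  shows "(\<integral>x. (norm (band u (2 ^ m1) f x))\<^sup>2 \<partial>M) \<le> (\<Sum>m=m0..<m1. 4 ^ Suc m * lev M f m)"
proof -
  have "(\<integral>x. (norm (band u (2 ^ m1) f x))\<^sup>2 \<partial>M)
    \<le> (\<integral>x. (\<Sum>m=m0..<m1. 4 ^ Suc m * (if 2 ^ m < norm (f x) then 1 else 0 :: real)) \<partial>M)"
  proof (intro integral_mono)
    show "integrable M (\<lambda>x. (norm (band u (2 ^ m1) f x))\<^sup>2)"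
      by (rule integrable_bounded[where R = "(2 ^ m1)\<^sup>2"])
         (auto simp: band_def intro!: power_mono)
    show "integrable M (\<lambda>x. \<Sum>m=m0..<m1. 4 ^ Suc m * (if 2 ^ m < norm (f x) then 1 else 0 :: real))"
      by (intro Bochner_Integration.integrable_sum integrable_mult_right
          integrable_bounded[where R = 1]) auto
    show "(norm (band u (2 ^ m1) f x))\<^sup>2
      \<le> (\<Sum>m=m0..<m1. 4 ^ Suc m * (if 2 ^ m < norm (f x) then 1 else 0))" for x
      using band_sq_le_sum[OF m, of "norm (f x)"] u
      by (auto simp: band_def split: if_splits intro!: sum_nonneg)
  qed
  also have "\<dots> = (\<Sum>m=m0..<m1. 4 ^ Suc m * lev M f m)"
    by (subst Bochner_Integration.integral_sum)
      (auto simp: lev_eq_integral intro!: integrable_mult_right integrable_bounded[where R = 1])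
  finally show ?thesis .
qed

text \<open>The \<open>1\<close> pays for the values of norm at most \<open>1\<close>, which the
  levels do not see.\<close>

lemma integral_band_sq_le':
  fixes f :: "'a \<Rightarrow> 'k::{real_normed_vector, second_countable_topology}"
  assumes [measurable]: "f \<in> borel_measurable M"
  shows "(\<integral>x. (norm (band 0 (2 ^ i) f x))\<^sup>2 \<partial>M) \<le> 1 + (\<Sum>m<i. 4 ^ Suc m * lev M f m)"
proof -
  have int: "integrable M (\<lambda>x. (norm (band u v f x))\<^sup>2)" if "0 \<le> v" for u v
      by (rule integrable_bounded[where R = "v\<^sup>2"])
         (use that in \<open>auto simp: band_def intro!: power_mono\<close>)
  have "(\<integral>x. (norm (band 0 (2 ^ i) f x))\<^sup>2 \<partial>M)
    \<le> (\<integral>x. 1 + (norm (band (2 ^ 0) (2 ^ i) f x))\<^sup>2 \<partial>M)"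
    by (intro integral_mono int Bochner_Integration.integrable_add)
       (auto simp: band_def power_le_one)
  also have "\<dots> = 1 + (\<integral>x. (norm (band (2 ^ 0) (2 ^ i) f x))\<^sup>2 \<partial>M)"
    by (subst Bochner_Integration.integral_add) (auto intro!: int simp: prob_space)
  also have "\<dots> \<le> 1 + (\<Sum>m=0..<i. 4 ^ Suc m * lev M f m)"
    by (intro add_left_mono integral_band_sq_le) auto
  finally show ?thesis by (simp add: atLeast0LessThan)
qed

lemma lev_le_integral_powr:
  fixes h :: "'a \<Rightarrow> 'k::{real_normed_vector, second_countable_topology}"
  assumes [measurable]: "h \<in> borel_measurable M" and R: "\<And>x. x \<in> space M \<Longrightarrow> norm (h x) \<le> R"
    and b: "0 < b"
  shows "lev M h i \<le> (\<integral>x. ((norm (h x))\<^sup>2) powr b \<partial>M) / (4 ^ i) powr b"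
proof -
  have "lev M h i \<le> (\<integral>x. ((norm (h x))\<^sup>2) powr b / (4 ^ i) powr b \<partial>M)"
    unfolding lev_eq_integral[OF assms(1)]
  proof (intro integral_mono)
    show "integrable M (\<lambda>x. ((norm (h x))\<^sup>2) powr b / (4 ^ i) powr b)"
    proof (rule integrable_bounded[where R = "(R\<^sup>2) powr b / (4 ^ i) powr b"])
      fix x assume "x \<in> space M"
      then have "(norm (h x))\<^sup>2 \<le> R\<^sup>2" using R by (intro power_mono) auto
      then show "\<bar>((norm (h x))\<^sup>2) powr b / (4 ^ i) powr b\<bar> \<le> (R\<^sup>2) powr b / (4 ^ i) powr b"
        using b by (auto intro!: divide_right_mono powr_mono2)
    qed measurable
    show "(if 2 ^ i < norm (h x) then 1 else 0) \<le> ((norm (h x))\<^sup>2) powr b / (4 ^ i) powr b" for x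
    proof (cases "2 ^ i < norm (h x)")
      case True
      then have "(2 ^ i)\<^sup>2 \<le> (norm (h x))\<^sup>2" by (intro power_mono) auto
      then have "(4 ^ i) powr b \<le> ((norm (h x))\<^sup>2) powr b"
        using b by (intro powr_mono2) (auto simp: four_power_eq)
      then show ?thesis using True by simp
    qed auto
  qed (auto intro!: integrable_bounded[where R = 1])
  then show ?thesis by simp
qed

lemma lev_le_integral_sq:
  fixes h :: "'a \<Rightarrow> 'k::{real_normed_vector, second_countable_topology}"
  assumes "h \<in> borel_measurable M" "\<And>x. x \<in> space M \<Longrightarrow> norm (h x) \<le> R"
  shows "lev M h i \<le> (\<integral>x. (norm (h x))\<^sup>2 \<partial>M) / 4 ^ i"
  using lev_le_integral_powr[OF assms, of 1 i] by simp

text \<open>Here the power is taken after integration, so the Gram matrix \<open>G\<close> consists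
  of \<open>L\<^sub>2\<close> inner products; the bounds \<open>R\<close> make them finite.\<close>

lemma sgn_sum_integral_powr:
  fixes g :: "nat \<Rightarrow> 'a \<Rightarrow> 'k::euclidean_space"
  assumes [measurable]: "\<And>k. g k \<in> borel_measurable M"
    and R: "\<And>k x. x \<in> space M \<Longrightarrow> norm (g k x) \<le> R k" and a: "0 < a" and c: "0 \<le> c"
  shows "(\<Sum>U\<in>Pow {..<n}. (c + (\<integral>x. (norm (sgn_sum U n g x))\<^sup>2 \<partial>M)) powr a)
    \<le> 2 ^ n * (c + khintchine_const a * (\<Sum>k<n. \<integral>x. (norm (g k x))\<^sup>2 \<partial>M)) powr a"
proof -
  define G where "G k l = (\<integral>x. g k x \<bullet> g l x \<partial>M)" for k l
  have int: "integrable M (\<lambda>x. g k x \<bullet> g l x)" for k l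
  proof (rule integrable_bounded[where R = "R k * R l"])
    fix x assume x: "x \<in> space M"
    have "\<bar>g k x \<bullet> g l x\<bar> \<le> norm (g k x) * norm (g l x)" by (rule Cauchy_Schwarz_ineq2)
    also have "\<dots> \<le> R k * R l"
      using R[OF x] by (intro mult_mono) (auto intro: order.trans[OF norm_ge_zero])
    finally show "\<bar>g k x \<bullet> g l x\<bar> \<le> R k * R l" .
  qed measurable
  have eq: "gram_form G n d = (\<integral>x. (norm (\<Sum>k<n. d k *\<^sub>R g k x))\<^sup>2 \<partial>M)" for n d
    unfolding norm_sgn_sum_sq gram_form_def G_def using int
    by (simp add: Bochner_Integration.integral_sum Bochner_Integration.integrable_sum)
  have "(\<Sum>U\<in>Pow {..<n}. (c + gram_form G n (sgn_of U)) powr a)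
    \<le> 2 ^ n * (c + khintchine_const a * (\<Sum>k<n. G k k)) powr a"
    using a c by (intro gram_form_sign_powr) (auto simp: eq, auto simp: G_def inner_commute)
  then show ?thesis by (simp add: eq sgn_sum_def G_def power2_norm_eq_inner)
qed

text \<open>Where no \<open>norm (g k)\<close> exceeds \<open>2 ^ i\<close>, the sum coincides with
  that of the truncations \<open>h k\<close>, to which Chebyshev's inequality applies. The union
  bound for the exceptional set enters as the additive constant \<open>4 ^ i * E\<close> of
  Khintchine's inequality.\<close>

lemma sgn_sum_lev_powr:
  fixes g :: "nat \<Rightarrow> 'a \<Rightarrow> 'k::euclidean_space"
  assumes [measurable]: "\<And>k. g k \<in> borel_measurable M" and a: "0 < a"
  shows "(\<Sum>U\<in>Pow {..<n}. lev M (sgn_sum U n g) i powr a)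
    \<le> 2 ^ n * ((4 ^ i * (\<Sum>k<n. lev M (g k) i)
      + khintchine_const a * (\<Sum>k<n. \<integral>x. (norm (band 0 (2 ^ i) (g k) x))\<^sup>2 \<partial>M)) / 4 ^ i) powr a"
proof -
  define h where "h k = band 0 (2 ^ i) (g k)" for k
  define E where "E = (\<Sum>k<n. lev M (g k) i)"
  define Y where "Y U = (\<integral>x. (norm (sgn_sum U n h x))\<^sup>2 \<partial>M)" for U
  have [measurable]: "h k \<in> borel_measurable M" for k by (simp add: h_def)
  have hb: "norm (h k x) \<le> 2 ^ i" for k x by (auto simp: h_def band_def)
  have E: "0 \<le> E" by (auto simp: E_def intro!: sum_nonneg)
  have K: "0 \<le> 4 ^ i * E + khintchine_const a * (\<Sum>k<n. \<integral>x. (norm (h k x))\<^sup>2 \<partial>M)"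
    using E khintchine_const_ge_1[of a]
    by (intro add_nonneg_nonneg mult_nonneg_nonneg sum_nonneg) auto
  have sets: "{x \<in> space M. 2 ^ i < norm (g k x)} \<in> sets M"
    "{x \<in> space M. 2 ^ i < norm (sgn_sum U n h x)} \<in> sets M" for k U by measurable
  have "lev M (sgn_sum U n g) i \<le> (4 ^ i * E + Y U) / 4 ^ i" for U
  proof -
    have "lev M (sgn_sum U n g) i \<le> measure M ((\<Union>k<n. {x \<in> space M. 2 ^ i < norm (g k x)})
        \<union> {x \<in> space M. 2 ^ i < norm (sgn_sum U n h x)})"
      unfolding lev_def
    proof (intro finite_measure_mono subsetI)
      fix x assume x: "x \<in> {x \<in> space M. 2 ^ i < norm (sgn_sum U n g x)}"
      show "x \<in> (\<Union>k<n. {x \<in> space M. 2 ^ i < norm (g k x)})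
        \<union> {x \<in> space M. 2 ^ i < norm (sgn_sum U n h x)}"
      proof (rule ccontr)
        assume c: "\<not> ?thesis"
        then have "h k x = g k x" if "k < n" for k
          using that x by (auto simp: h_def band_def not_less)
        then have "sgn_sum U n h x = sgn_sum U n g x" by (simp add: sgn_sum_def)
        then show False using c x by auto
      qed
    qed (intro sets.Un sets.finite_UN sets finite_lessThan)
    also have "\<dots> \<le> measure M (\<Union>k<n. {x \<in> space M. 2 ^ i < norm (g k x)}) + lev M (sgn_sum U n h) i"
      unfolding lev_def by (intro measure_Un_le sets.finite_UN sets finite_lessThan)
    also have "\<dots> \<le> E + Y U / 4 ^ i"
      unfolding E_def Y_def
    proof (intro add_mono)
      show "measure M (\<Union>k<n. {x \<in> space M. 2 ^ i < norm (g k x)}) \<le> (\<Sum>k<n. lev M (g k) i)"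
        unfolding lev_def by (intro measure_UNION_le sets finite_lessThan)
      show "lev M (sgn_sum U n h) i \<le> (\<integral>x. (norm (sgn_sum U n h x))\<^sup>2 \<partial>M) / 4 ^ i"
        by (rule lev_le_integral_sq[where R = "\<Sum>k<n. 2 ^ i"]) (use norm_sgn_sum_le[of n h _ "\<lambda>_. 2 ^ i"] hb in auto)
    qed
    finally show ?thesis by (simp add: add_divide_distrib)
  qed
  then have "(\<Sum>U\<in>Pow {..<n}. lev M (sgn_sum U n g) i powr a)
    \<le> (\<Sum>U\<in>Pow {..<n}. ((4 ^ i * E + Y U) / 4 ^ i) powr a)"
    using a by (intro sum_mono powr_mono2) auto
  also have "\<dots> = (\<Sum>U\<in>Pow {..<n}. (4 ^ i * E + Y U) powr a) / (4 ^ i) powr a"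
    using E by (simp add: powr_divide sum_divide_distrib Y_def)
  also have "\<dots> \<le> (2 ^ n * (4 ^ i * E + khintchine_const a * (\<Sum>k<n. \<integral>x. (norm (h k x))\<^sup>2 \<partial>M)) powr a) / (4 ^ i) powr a"
    unfolding Y_def using E hb a
    by (intro divide_right_mono sgn_sum_integral_powr[where R = "\<lambda>_. 2 ^ i"]) auto
  also have "\<dots> = 2 ^ n * ((4 ^ i * E + khintchine_const a * (\<Sum>k<n. \<integral>x. (norm (h k x))\<^sup>2 \<partial>M)) / 4 ^ i) powr a"
    using K by (subst powr_divide) simp_all
  finally show ?thesis by (simp add: E_def h_def)
qed

end

subsection \<open>Lorentz norms and level sets\<close>

lemma epowr_ennreal: "0 \<le> x \<Longrightarrow> ennreal x epowr r = ennreal (x powr r)"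
  by (simp add: epowr_def)

lemma epowr_top [simp]: "top epowr r = top"
  by (simp add: epowr_def)

lemma epowr_0 [simp]: "0 epowr r = 0"
  by (simp add: epowr_def)

lemma epowr_1 [simp]: "1 epowr r = 1"
  by (simp add: epowr_def)

lemma epowr_mono: "x \<le> y \<Longrightarrow> 0 < r \<Longrightarrow> x epowr r \<le> y epowr r"
  by (cases x; cases y) (auto simp: epowr_ennreal top_unique intro!: powr_mono2)

lemma epowr_inverse_epowr: "0 < q \<Longrightarrow> (x epowr (1 / q)) epowr q = x"
  by (cases x) (auto simp: epowr_ennreal powr_powr)

lemma epowr_mult_ennreal:
  "0 < c \<Longrightarrow> (ennreal c * x) epowr r = ennreal (c powr r) * x epowr r"
  by (cases x) (auto simp: epowr_ennreal powr_mult ennreal_mult_top simp flip: ennreal_mult)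

definition lorentz_integral :: "'b measure \<Rightarrow> real \<Rightarrow> real \<Rightarrow> ('b \<Rightarrow> 'k::real_normed_field) \<Rightarrow> ennreal" where
  "lorentz_integral M p q f =
    (\<integral>\<^sup>+ t \<in> {0<..}. (ennreal (t powr (1/p)) * rearrangement M f t) epowr q / ennreal t \<partial>lborel)"

lemma lorentz_norm_epowr: "0 < q \<Longrightarrow> lorentz_norm M p q f epowr q = lorentz_integral M p q f"
  by (simp add: lorentz_norm_def lorentz_integral_def epowr_inverse_epowr)

lemma nn_integral_powr_interval:
  fixes a D :: real
  assumes "0 < a" "0 \<le> D"
  shows "(\<integral>\<^sup>+ t. ennreal (t powr (a - 1)) * indicator {0<..<D} t \<partial>lborel) = ennreal (D powr a / a)"
proof -
  have "((\<lambda>t. t powr (a - 1)) has_integral (D powr a / a)) {0..D}"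
    using has_integral_powr_from_0[of "a - 1" D] assms by simp
  then have "((\<lambda>t. t powr (a - 1)) has_integral (D powr a / a)) {0<..<D}"
    by (subst has_integral_Icc_iff_Ioo[symmetric])
  then have "(\<integral>\<^sup>+t\<in>{0<..<D}. ennreal (t powr (a - 1)) \<partial>lborel) = ennreal (D powr a / a)"
    by (intro nn_integral_has_integral_lebesgue') auto
  then show ?thesis .
qed

lemma lorentz_integrand:
  assumes "0 < t"
  shows "(ennreal (t powr (1/p)) * x) epowr q / ennreal t = ennreal (t powr (q/p - 1)) * x epowr q"
proof -
  have *: "ennreal (t powr (q/p)) / ennreal t = ennreal (t powr (q/p - 1))"
    using assms by (simp add: divide_ennreal powr_diff)
  have "(ennreal (t powr (1/p)) * x) epowr q / ennreal t = ennreal (t powr (q/p)) * x epowr q / ennreal t"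
    using assms by (simp add: epowr_mult_ennreal powr_powr)
  also have "\<dots> = ennreal (t powr (q/p)) / ennreal t * x epowr q"
    by (simp add: divide_ennreal_def ac_simps)
  finally show ?thesis by (simp add: *)
qed

text \<open>A geometric sum is comparable to its last term, with factor \<open>b / (b - 1)\<close>
  for the ratio \<open>b = 2 powr q\<close>.\<close>

lemma sum_dyadic_le:
  fixes r q :: real
  assumes q: "0 < q" and r: "0 \<le> r"
  shows "(\<Sum>i<I. (2 ^ i) powr q * (if 2 ^ i \<le> r then 1 else 0)) \<le> 2 powr q / (2 powr q - 1) * r powr q"
proof (induction I)
  case 0
  have "1 < (2::real) powr q" using q by simp
  then show ?case by simp
next
  case (Suc I)
  define b :: real where "b = 2 powr q"
  have b: "1 < b" using q by (simp add: b_def)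
  have bi: "(2 ^ i) powr q = b ^ i" for i :: nat
    by (induction i) (auto simp: b_def powr_mult)
  show ?case
  proof (cases "2 ^ I \<le> r")
    case True
    have "(\<Sum>i<Suc I. (2 ^ i) powr q * (if 2 ^ i \<le> r then 1 else 0)) \<le> (\<Sum>i<Suc I. b ^ i)"
      using b by (intro sum_mono) (auto simp: bi)
    also have "\<dots> = (b ^ Suc I - 1) / (b - 1)" using b by (simp add: geometric_sum del: sum.lessThan_Suc)
    also have "\<dots> \<le> b / (b - 1) * (2 ^ I) powr q"
      using b by (simp add: bi divide_simps)
    also have "\<dots> \<le> b / (b - 1) * r powr q"
      using b True q by (intro mult_left_mono powr_mono2) auto
    finally show ?thesis by (simp add: b_def)
  next
    case False
    then show ?thesis using Suc by simp
  qed
qed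

context prob_space
begin

lemma distribution_fun_eq_lev: "distribution_fun M f (2 ^ i) = ennreal (lev M f i)"
  by (simp add: distribution_fun_def lev_def emeasure_eq_measure)

lemma rearrangement_le:
  assumes "lev M f i \<le> t"
  shows "rearrangement M f t \<le> ennreal (2 ^ i)"
  unfolding rearrangement_def
  using assms by (intro Inf_lower imageI) (auto simp: distribution_fun_eq_lev ennreal_leI)

lemma rearrangement_ge:
  fixes f :: "'a \<Rightarrow> 'k::{real_normed_field, second_countable_topology}"
  assumes [measurable]: "f \<in> borel_measurable M" and t: "0 < t" "t < lev M f i"
  shows "ennreal (2 ^ i) \<le> rearrangement M f t"
  unfolding rearrangement_def
proof (intro Inf_greatest, clarify)
  fix l :: real assume l: "0 < l" "distribution_fun M f l \<le> ennreal t"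
  show "ennreal (2 ^ i) \<le> ennreal l"
  proof (rule ccontr)
    assume "\<not> ?thesis"
    then have "l < 2 ^ i" using ennreal_leI[of "2 ^ i" l] by (meson not_less)
    then have "ennreal (lev M f i) \<le> distribution_fun M f l"
      unfolding distribution_fun_eq_lev[symmetric] distribution_fun_def
      by (intro emeasure_mono) auto
    also have "\<dots> \<le> ennreal t" by (rule l)
    finally show False using t by (simp add: ennreal_le_iff)
  qed
qed

lemma rearrangement_eq_0:
  assumes "1 \<le> t"
  shows "rearrangement M f t = 0"
proof -
  have d: "distribution_fun M f l \<le> ennreal t" for l
    unfolding distribution_fun_def
    using order.trans[OF prob_le_1 assms] by (simp add: emeasure_eq_measure ennreal_leI)
  have "rearrangement M f t \<le> 0"
  proof (rule ennreal_le_epsilon)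
    fix e :: real assume "0 < e"
    then have "ennreal e \<in> ennreal ` {l. l > 0 \<and> distribution_fun M f l \<le> ennreal t}"
      using d by (intro imageI CollectI conjI)
    then have "rearrangement M f t \<le> ennreal e"
      unfolding rearrangement_def by (rule Inf_lower)
    then show "rearrangement M f t \<le> 0 + ennreal e" by simp
  qed
  then show ?thesis by simp
qed

text \<open>\<open>lev M f i powr a / a\<close> is the integral of \<open>t powr (a - 1)\<close>
  over \<open>0 < t < lev M f i\<close>. For fixed \<open>t\<close> only levels with
  \<open>2 ^ i \<le> rearrangement M f t\<close> contribute, and \<open>sum_dyadic_le\<close> adds
  them up.\<close>

lemma level_sum_le_lorentz_integral:
  fixes f :: "'a \<Rightarrow> 'k::{real_normed_field, second_countable_topology}"
  assumes [measurable]: "f \<in> borel_measurable M" and p: "0 < p" and q: "0 < q"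
  shows "ennreal (level_sum p q M f I)
    \<le> ennreal (q / p * (2 powr q / (2 powr q - 1))) * lorentz_integral M p q f"
proof -
  define a where "a = q / p"
  define K where "K = 2 powr q / (2 powr q - 1)"
  have a: "0 < a" using p q by (simp add: a_def)
  have "1 < (2::real) powr q" using q by simp
  then have K: "0 < K" by (simp add: K_def)
  define h where "h t = (\<Sum>i<I. (2 ^ i) powr q / K * indicator {0<..<lev M f i} t)" for t :: real
  have h: "ennreal (h t) = (\<Sum>i<I. ennreal ((2 ^ i) powr q / K) * indicator {0<..<lev M f i} t)" for t
  proof -
    have "ennreal (h t) = (\<Sum>i<I. ennreal ((2 ^ i) powr q / K * indicator {0<..<lev M f i} t))"
      unfolding h_def using K by (intro sum_ennreal[symmetric]) auto
    also have "\<dots> = (\<Sum>i<I. ennreal ((2 ^ i) powr q / K) * indicator {0<..<lev M f i} t)"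
      by (intro sum.cong) (auto split: split_indicator)
    finally show ?thesis .
  qed
  have "level_sum p q M f I / (a * K) = (\<Sum>i<I. (2 ^ i) powr q / K * (lev M f i powr a / a))"
    unfolding level_sum_def a_def[symmetric] sum_divide_distrib by (simp add: mult.commute[of a K])
  then have "ennreal (level_sum p q M f I / (a * K))
    = (\<Sum>i<I. ennreal ((2 ^ i) powr q / K * (lev M f i powr a / a)))"
    using a K by (simp add: sum_ennreal)
  also have "\<dots> = (\<Sum>i<I. ennreal ((2 ^ i) powr q / K) * ennreal (lev M f i powr a / a))"
    using a K by (intro sum.cong refl ennreal_mult) auto
  finally have "ennreal (level_sum p q M f I / (a * K))
    = (\<Sum>i<I. ennreal ((2 ^ i) powr q / K) * ennreal (lev M f i powr a / a))" .
  also have "\<dots> = (\<Sum>i<I. ennreal ((2 ^ i) powr q / K)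
      * (\<integral>\<^sup>+ t. ennreal (t powr (a - 1)) * indicator {0<..<lev M f i} t \<partial>lborel))"
    using a by (simp add: nn_integral_powr_interval)
  also have "\<dots> = (\<integral>\<^sup>+ t. (\<Sum>i<I. ennreal ((2 ^ i) powr q / K)
      * (ennreal (t powr (a - 1)) * indicator {0<..<lev M f i} t)) \<partial>lborel)"
    by (subst nn_integral_sum) (auto simp: nn_integral_cmult)
  also have "\<dots> = (\<integral>\<^sup>+ t. ennreal (t powr (a - 1)) * ennreal (h t) \<partial>lborel)"
    by (intro nn_integral_cong) (simp only: h sum_distrib_left mult.left_commute[of _ "ennreal (_ powr (a - 1))"])
  also have "\<dots> \<le> lorentz_integral M p q f"
    unfolding lorentz_integral_def
  proof (intro nn_integral_mono)
    fix t :: real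
    show "ennreal (t powr (a - 1)) * ennreal (h t)
      \<le> (ennreal (t powr (1/p)) * rearrangement M f t) epowr q / ennreal t * indicator {0<..} t"
    proof (cases "0 < t")
      case False
      then have "h t = 0" unfolding h_def by (intro sum.neutral) auto
      then show ?thesis by simp
    next
      case True
      have "ennreal (h t) \<le> rearrangement M f t epowr q"
      proof (cases "rearrangement M f t")
        case (real r)
        have "h t \<le> (\<Sum>i<I. (2 ^ i) powr q / K * (if 2 ^ i \<le> r then 1 else 0))"
          unfolding h_def
        proof (intro sum_mono mult_left_mono)
          fix i
          show "indicator {0<..<lev M f i} t \<le> (if 2 ^ i \<le> r then 1 else 0 :: real)"
            using rearrangement_ge[of f t i] True real by (auto simp: indicator_def)
        qed (use K in auto)
        also have "\<dots> = (\<Sum>i<I. (2 ^ i) powr q * (if 2 ^ i \<le> r then 1 else 0)) / K"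
          by (simp add: sum_divide_distrib)
        also have "\<dots> \<le> (K * r powr q) / K"
          using K sum_dyadic_le[OF q real(1), of I, folded K_def] by (intro divide_right_mono) auto
        finally show ?thesis using real K by (simp add: epowr_ennreal ennreal_leI)
      qed simp
      then have "ennreal (t powr (a - 1)) * ennreal (h t)
        \<le> ennreal (t powr (a - 1)) * rearrangement M f t epowr q"
        by (intro mult_left_mono) auto
      then show ?thesis using True by (simp add: lorentz_integrand a_def)
    qed
  qed
  finally have "ennreal (a * K) * ennreal (level_sum p q M f I / (a * K)) \<le> ennreal (a * K) * lorentz_integral M p q f"
    by (intro mult_left_mono) auto
  moreover have "ennreal (a * K) * ennreal (level_sum p q M f I / (a * K)) = ennreal (level_sum p q M f I)"
    using a K by (subst ennreal_mult[symmetric]) (auto simp: level_sum_nonneg)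
  ultimately show ?thesis by (simp add: K_def a_def)
qed

text \<open>For \<open>0 < t < 1\<close> let \<open>i\<close> be the first level with
  \<open>lev M f i \<le> t\<close>, so that the rearrangement at \<open>t\<close> is at most
  \<open>2 ^ i\<close>. If \<open>i > 0\<close>, the preceding level still exceeds \<open>t\<close>
  and its summand absorbs the value at the price \<open>2 powr q\<close>; the case
  \<open>i = 0\<close> produces the summand \<open>1\<close> of the bound.\<close>

lemma lorentz_integral_le_level_sum:
  fixes f :: "'a \<Rightarrow> 'k::{real_normed_field, second_countable_topology}"
  assumes [measurable]: "f \<in> borel_measurable M" and p: "0 < p" and q: "0 < q"
    and B: "\<And>I. level_sum p q M f I \<le> B"
  shows "lorentz_integral M p q f \<le> ennreal (p / q * 2 powr q * (1 + B))"
proof -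
  define a where "a = q / p"
  have a: "0 < a" using p q by (simp add: a_def)
  have B0: "0 \<le> B" using B[of 0] by (simp add: level_sum_def)
  define W where "W D t = ennreal (t powr (a - 1)) * indicator {0<..<D} t" for D t :: real
  have [measurable]: "W D \<in> borel_measurable borel" for D unfolding W_def by measurable
  have intW: "(\<integral>\<^sup>+ t. W D t \<partial>lborel) = ennreal (D powr a / a)" if "0 \<le> D" for D
    unfolding W_def using a that by (rule nn_integral_powr_interval)
  have "lorentz_integral M p q f
    \<le> (\<integral>\<^sup>+ t. W 1 t + ennreal (2 powr q) * (\<Sum>i. ennreal ((2 ^ i) powr q) * W (lev M f i) t) \<partial>lborel)"
    unfolding lorentz_integral_def
  proof (intro nn_integral_mono)
    fix t :: real
    show "(ennreal (t powr (1/p)) * rearrangement M f t) epowr q / ennreal t * indicator {0<..} t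
      \<le> W 1 t + ennreal (2 powr q) * (\<Sum>i. ennreal ((2 ^ i) powr q) * W (lev M f i) t)"
    proof (cases "0 < t \<and> t < 1")
      case False
      then show ?thesis by (auto simp: rearrangement_eq_0 not_less)
    next
      case True
      \<comment> \<open>Otherwise every summand is at least \<open>t powr a\<close>, and the partial
        sums exceed \<open>B\<close>.\<close>
      have "\<exists>i. lev M f i \<le> t"
      proof (rule ccontr)
        assume n: "\<not> ?thesis"
        have "real I * t powr a \<le> B" for I
        proof -
          have "(\<Sum>i<I. t powr a) \<le> level_sum p q M f I"
            unfolding level_sum_def a_def[symmetric]
          proof (intro sum_mono)
            fix i
            have "1 * t powr a \<le> (2 ^ i) powr q * lev M f i powr a"
              using True n a q by (intro mult_mono powr_mono2) (auto simp: not_le ge_one_powr_ge_zero less_imp_le)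
            then show "t powr a \<le> (2 ^ i) powr q * lev M f i powr a" by simp
          qed
          then show ?thesis using B[of I] by simp
        qed
        moreover obtain I where "B < real I * t powr a"
          using True reals_Archimedean3[of "t powr a"] by auto
        ultimately show False by (simp add: not_le[symmetric])
      qed
      then obtain i where i: "lev M f i \<le> t" "\<And>j. j < i \<Longrightarrow> t < lev M f j"
        using exists_least_iff[of "\<lambda>i. lev M f i \<le> t"] by (auto simp: not_le)
      have R: "rearrangement M f t epowr q \<le> ennreal (2 ^ i) epowr q"
        using q by (intro epowr_mono rearrangement_le i)
      have "(ennreal (t powr (1/p)) * rearrangement M f t) epowr q / ennreal t * indicator {0<..} t
        = ennreal (t powr (a - 1)) * rearrangement M f t epowr q"
        using True by (simp add: lorentz_integrand a_def)
      also have "\<dots> \<le> ennreal (t powr (a - 1)) * ennreal (2 ^ i) epowr q"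
        using R by (intro mult_left_mono) auto
      also have "\<dots> \<le> W 1 t + ennreal (2 powr q) * (\<Sum>i. ennreal ((2 ^ i) powr q) * W (lev M f i) t)"
      proof (cases i)
        case 0
        then show ?thesis using True by (simp add: W_def)
      next
        case (Suc j)
        have e: "ennreal (2 ^ i) epowr q = ennreal (2 powr q) * ennreal ((2 ^ j) powr q)"
          unfolding Suc by (subst epowr_ennreal) (auto simp: powr_mult simp flip: ennreal_mult)
        have "ennreal (t powr (a - 1)) * ennreal (2 ^ i) epowr q
          = ennreal (2 powr q) * (ennreal ((2 ^ j) powr q) * W (lev M f j) t)"
          using Suc True i(2)[of j]
          unfolding e by (simp add: W_def ac_simps)
        also have "\<dots> \<le> ennreal (2 powr q) * (\<Sum>i. ennreal ((2 ^ i) powr q) * W (lev M f i) t)"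
          by (intro mult_left_mono sum_le_suminf[of _ "{j}", simplified]) auto
        finally show ?thesis by (simp add: add_increasing)
      qed
      finally show ?thesis .
    qed
  qed
  also have "\<dots> = ennreal (1 / a) + ennreal (2 powr q) * (\<Sum>i. ennreal ((2 ^ i) powr q) * ennreal (lev M f i powr a / a))"
    by (subst nn_integral_add) (auto simp: nn_integral_cmult nn_integral_suminf intW)
  also have "(\<Sum>i. ennreal ((2 ^ i) powr q) * ennreal (lev M f i powr a / a)) \<le> ennreal (B / a)"
  proof (intro suminf_le_const summableI)
    fix I
    have "(\<Sum>i<I. ennreal ((2 ^ i) powr q) * ennreal (lev M f i powr a / a)) = ennreal (level_sum p q M f I / a)"
      using a by (simp add: level_sum_def a_def[symmetric] sum_divide_distrib flip: ennreal_mult)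
    then show "(\<Sum>i<I. ennreal ((2 ^ i) powr q) * ennreal (lev M f i powr a / a)) \<le> ennreal (B / a)"
      using B a by (auto intro!: ennreal_leI divide_right_mono)
  qed
  also have "ennreal (1 / a) + ennreal (2 powr q) * ennreal (B / a) = ennreal (1 / a + 2 powr q * (B / a))"
    using a B0 by (simp flip: ennreal_mult ennreal_plus)
  also have "\<dots> \<le> ennreal (p / q * 2 powr q * (1 + B))"
  proof (intro ennreal_leI)
    have "1 / a * 1 \<le> 1 / a * 2 powr q" using a q by (intro mult_left_mono) (auto simp: ge_one_powr_ge_zero)
    moreover have "p / q = 1 / a" by (simp add: a_def)
    ultimately show "1 / a + 2 powr q * (B / a) \<le> p / q * 2 powr q * (1 + B)"
      by (simp add: add_divide_distrib algebra_simps)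
  qed
  finally show ?thesis by (simp add: mult_left_mono)
qed

end

section \<open>Discrete Lorentz norms of finitely supported sequences\<close>

lemma seq_rearrangement_le:
  assumes s: "0 < s" and a: "\<And>j. norm (a j) \<le> s"
  shows "seq_rearrangement a k \<le> ennreal s"
proof -
  have "{x \<in> space (count_space UNIV). s < norm (a x)} = {}" using a by (auto simp: not_less)
  then have "distribution_fun (count_space UNIV) a s = 0" by (simp add: distribution_fun_def)
  then show ?thesis
    unfolding seq_rearrangement_def rearrangement_def using s by (intro Inf_lower imageI) auto
qed

lemma seq_rearrangement_eq_0:
  assumes A: "finite A" "card A \<le> k" and a: "\<And>j. j \<notin> A \<Longrightarrow> a j = 0"
  shows "seq_rearrangement a k = 0"
proof -
  have "seq_rearrangement a k \<le> 0"
  proof (rule ennreal_le_epsilon)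
    fix e :: real assume e: "0 < e"
    have sub: "{x \<in> space (count_space UNIV). e < norm (a x)} \<subseteq> A"
    proof
      fix x assume "x \<in> {x \<in> space (count_space UNIV). e < norm (a x)}"
      then have "a x \<noteq> 0" using e by auto
      then show "x \<in> A" using a by blast
    qed
    have "distribution_fun (count_space UNIV) a e \<le> emeasure (count_space UNIV) A"
      unfolding distribution_fun_def using sub by (intro emeasure_mono) auto
    also have "\<dots> = ennreal (real (card A))"
      using A by (simp add: emeasure_count_space_finite ennreal_of_nat_eq_real_of_nat)
    also have "\<dots> \<le> ennreal (real k)" using A by (intro ennreal_leI) simp
    finally have "ennreal e \<in> ennreal ` {l. l > 0 \<and> distribution_fun (count_space UNIV) a l \<le> ennreal (real k)}"
      using e by (intro imageI CollectI conjI)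
    then have "seq_rearrangement a k \<le> ennreal e"
      unfolding seq_rearrangement_def rearrangement_def by (rule Inf_lower)
    then show "seq_rearrangement a k \<le> 0 + ennreal e" by simp
  qed
  then show ?thesis by simp
qed

lemma seq_rearrangement_ge:
  assumes inj: "inj_on \<kappa> {..k}" and w: "\<And>j. j \<le> k \<Longrightarrow> w \<le> norm (a (\<kappa> j))"
  shows "ennreal w \<le> seq_rearrangement a k"
  unfolding seq_rearrangement_def rearrangement_def
proof (intro Inf_greatest, clarify)
  fix l :: real assume l: "0 < l" "distribution_fun (count_space UNIV) a l \<le> ennreal (real k)"
  have "w \<le> l"
  proof (rule ccontr)
    assume c: "\<not> ?thesis"
    then have sub: "\<kappa> ` {..k} \<subseteq> {x \<in> space (count_space UNIV). l < norm (a x)}" using w by fastforce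
    \<comment> \<open>The indices \<open>0, ..., k\<close> give \<open>k + 1\<close> entries above
      \<open>l\<close>, one more than the rearrangement at \<open>k\<close> allows.\<close>
    have "ennreal (real (Suc k)) = ennreal (real (card (\<kappa> ` {..k})))" using inj by (simp add: card_image)
    also have "\<dots> = emeasure (count_space UNIV) (\<kappa> ` {..k})"
      by (simp add: emeasure_count_space_finite ennreal_of_nat_eq_real_of_nat)
    also have "\<dots> \<le> distribution_fun (count_space UNIV) a l"
      unfolding distribution_fun_def using sub by (intro emeasure_mono) auto
    also have "\<dots> \<le> ennreal (real k)" by (rule l)
    finally show False by (simp add: ennreal_le_iff del: of_nat_Suc)
  qed
  then show "ennreal w \<le> ennreal l" by (rule ennreal_leI)
qed

definition lorentz_seq_sum :: "real \<Rightarrow> real \<Rightarrow> (nat \<Rightarrow> 'k::real_normed_field) \<Rightarrow> ennreal" where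
  "lorentz_seq_sum p q a = (\<Sum>k. seq_rearrangement a k epowr q
            * ennreal (real (Suc k) powr (q/p) - real k powr (q/p)))"

lemma lorentz_seq_norm_epowr: "0 < q \<Longrightarrow> lorentz_seq_norm p q a epowr q = lorentz_seq_sum p q a"
  by (simp add: lorentz_seq_norm_def lorentz_seq_sum_def epowr_inverse_epowr)

lemma lorentz_seq_weight_nonneg:
  "0 < p \<Longrightarrow> 0 < q \<Longrightarrow> 0 \<le> real (Suc k) powr (q/p) - real k powr (q/p)"
  by (simp add: powr_mono2)

lemma lorentz_seq_sum_le:
  assumes p: "0 < p" and q: "0 < q" and s: "0 < s" and a: "\<And>j. norm (a j) \<le> s"
    and A: "finite A" "card A \<le> n" and a0: "\<And>j. j \<notin> A \<Longrightarrow> a j = 0"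
  shows "lorentz_seq_sum p q a \<le> ennreal (s powr q * real n powr (q/p))"
proof -
  let ?w = "\<lambda>k. real (Suc k) powr (q/p) - real k powr (q/p)"
  have "lorentz_seq_sum p q a = (\<Sum>k<n. seq_rearrangement a k epowr q * ennreal (?w k))"
    unfolding lorentz_seq_sum_def
    using seq_rearrangement_eq_0[of A _ a] A a0 by (intro suminf_finite) auto
  also have "\<dots> \<le> (\<Sum>k<n. ennreal s epowr q * ennreal (?w k))"
    using q by (intro sum_mono mult_right_mono epowr_mono seq_rearrangement_le s a) auto
  also have "\<dots> = (\<Sum>k<n. ennreal (s powr q * ?w k))"
    using s lorentz_seq_weight_nonneg[OF p q]
    by (intro sum.cong refl) (subst ennreal_mult, auto simp: epowr_ennreal)
  also have "\<dots> = ennreal (\<Sum>k<n. s powr q * ?w k)"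
    using s lorentz_seq_weight_nonneg[OF p q] by (intro sum_ennreal mult_nonneg_nonneg) auto
  also have "(\<Sum>k<n. s powr q * ?w k) = s powr q * (\<Sum>k<n. ?w k)"
    by (simp only: sum_distrib_left)
  also have "(\<Sum>k<n. ?w k) = real n powr (q/p)"
    using sum_lessThan_telescope[of "\<lambda>k. real k powr (q/p)" n] by simp
  finally show ?thesis .
qed

lemma lorentz_seq_sum_ge:
  assumes p: "0 < p" and q: "0 < q" and inj: "inj_on \<kappa> {..<n}"
    and w: "\<And>k. k < n \<Longrightarrow> 0 \<le> w k \<and> w k \<le> norm (a (\<kappa> k))"
    and dec: "\<And>j k. j \<le> k \<Longrightarrow> k < n \<Longrightarrow> w k \<le> w j"
  shows "ennreal (\<Sum>k<n. w k powr q * (real (Suc k) powr (q/p) - real k powr (q/p))) \<le> lorentz_seq_sum p q a"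
proof -
  let ?w = "\<lambda>k. real (Suc k) powr (q/p) - real k powr (q/p)"
  have "ennreal (\<Sum>k<n. w k powr q * ?w k) = (\<Sum>k<n. ennreal (w k powr q * ?w k))"
    using lorentz_seq_weight_nonneg[OF p q] by (intro sum_ennreal[symmetric] mult_nonneg_nonneg) auto
  also have "\<dots> = (\<Sum>k<n. ennreal (w k) epowr q * ennreal (?w k))"
    using lorentz_seq_weight_nonneg[OF p q] w
    by (intro sum.cong refl) (subst ennreal_mult, auto simp: epowr_ennreal)
  also have "\<dots> \<le> (\<Sum>k<n. seq_rearrangement a k epowr q * ennreal (?w k))"
  proof (intro sum_mono mult_right_mono epowr_mono q)
    fix k assume k: "k \<in> {..<n}"
    show "ennreal (w k) \<le> seq_rearrangement a k"
    proof (rule seq_rearrangement_ge)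
      show "inj_on \<kappa> {..k}" using inj k by (auto intro: inj_on_subset)
      show "w k \<le> norm (a (\<kappa> j))" if "j \<le> k" for j
        using dec[OF that] w[of j] k that by auto
    qed
  qed auto
  also have "\<dots> \<le> lorentz_seq_sum p q a"
    unfolding lorentz_seq_sum_def by (intro sum_le_suminf) auto
  finally show ?thesis .
qed

lemma finite_support_in_lorentz_seq_space:
  assumes p: "0 < p" and q: "0 < q" and fin: "finite {j. a j \<noteq> 0}"
  shows "a \<in> lorentz_seq_space p q"
proof -
  define A where "A = {j. a j \<noteq> 0}"
  have b: "norm (a j) \<le> 1 + (\<Sum>j\<in>A. norm (a j))" for j
  proof (cases "j \<in> A")
    case True
    then have "norm (a j) \<le> (\<Sum>j\<in>A. norm (a j))"
      using fin by (intro member_le_sum) (auto simp: A_def)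
    then show ?thesis by simp
  next
    case False
    then show ?thesis by (auto simp: A_def intro!: add_nonneg_nonneg sum_nonneg)
  qed
  have "0 < 1 + (\<Sum>j\<in>A. norm (a j))" by (intro add_pos_nonneg sum_nonneg) auto
  then have "lorentz_seq_norm p q a epowr q < top"
    unfolding lorentz_seq_norm_epowr[OF q]
    using lorentz_seq_sum_le[OF p q _ b, of A "card A"] fin
    by (intro le_less_trans[OF _ ennreal_less_top]) (auto simp: A_def)
  then have "lorentz_seq_norm p q a \<noteq> top" by (metis epowr_top less_irrefl)
  then show ?thesis by (simp add: lorentz_seq_space_def less_top)
qed

text \<open>Everything that is used of an embedding, \<open>f k\<close> being the image of the
  \<open>k\<close>-th unit vector. The injection \<open>\<kappa>\<close> makes passing to
  subsequences part of the assumptions. Only finite real combinations occur, so almost-everywhere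
  linearity and the scalar field are dealt with once, in the next reduction.\<close>

locale lorentz_basis = prob_space M for M :: "'a measure" +
  fixes p q Ku Kl :: real and f :: "nat \<Rightarrow> 'a \<Rightarrow> 'k::euclidean_space"
  assumes p_pos: "0 < p" and q_pos: "0 < q"
    and f_measurable [measurable]: "\<And>k. f k \<in> borel_measurable M"
    and upper: "\<And>\<kappa> n c s I. inj_on \<kappa> {..<n} \<Longrightarrow> 0 < s \<Longrightarrow> (\<And>k. k < n \<Longrightarrow> \<bar>c k\<bar> \<le> s)
      \<Longrightarrow> level_sum p q M (\<lambda>x. \<Sum>k<n. c k *\<^sub>R f (\<kappa> k) x) I \<le> Ku * (s powr q * real n powr (q/p))"
    and lower: "\<And>\<kappa> n c w B. inj_on \<kappa> {..<n} \<Longrightarrow> (\<And>k. k < n \<Longrightarrow> 0 \<le> w k \<and> w k \<le> \<bar>c k\<bar>)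
      \<Longrightarrow> (\<And>j k. j \<le> k \<Longrightarrow> k < n \<Longrightarrow> w k \<le> w j)
      \<Longrightarrow> (\<And>I. level_sum p q M (\<lambda>x. \<Sum>k<n. c k *\<^sub>R f (\<kappa> k) x) I \<le> B)
      \<Longrightarrow> (\<Sum>k<n. w k powr q * (real (Suc k) powr (q/p) - real k powr (q/p))) \<le> Kl * (1 + B)"

lemma (in prob_space) lorentz_norm_cong_AE:
  assumes "AE x in M. g x = h x" "g \<in> borel_measurable M" "h \<in> borel_measurable M"
  shows "lorentz_norm M p q g = lorentz_norm M p q h"
proof -
  note [measurable] = assms(2,3)
  have "distribution_fun M g l = distribution_fun M h l" for l
    unfolding distribution_fun_def using assms(1) by (intro emeasure_eq_AE) auto
  then show ?thesis by (simp add: lorentz_norm_def rearrangement_def)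
qed

text \<open>On finite combinations linearity is applied finitely often, so the exceptional null sets
  are harmless. The two norm inequalities are raised to the power \<open>q\<close> and then
  translated into level sums.\<close>

lemma lorentz_iso_embedding_imp_basis:
  fixes T :: "(nat \<Rightarrow> 'k::{real_normed_field, euclidean_space}) \<Rightarrow> 'a \<Rightarrow> 'k"
  assumes "prob_space M" and p: "0 < p" and q: "0 < q" and T: "lorentz_iso_embedding p q M T"
  obtains Ku Kl and f :: "nat \<Rightarrow> 'a \<Rightarrow> 'k" where "lorentz_basis M p q Ku Kl f"
proof -
  interpret prob_space M by fact
  define e where "e k j = (if j = k then 1 else 0 :: 'k)" for k j :: nat
  define f where "f k = T (e k)" for k
  define v where "v \<kappa> n c j = (\<Sum>k<n. of_real (c k) * e (\<kappa> k) j)" for \<kappa> :: "nat \<Rightarrow> nat" and n :: nat and c j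
  define S where "S \<kappa> n c x = (\<Sum>k<n. c k *\<^sub>R f (\<kappa> k) x)" for \<kappa> :: "nat \<Rightarrow> nat" and n c x
  from T obtain C where C: "1 \<le> C"
    and Cl: "\<And>a. a \<in> lorentz_seq_space p q \<Longrightarrow> lorentz_seq_norm p q a / ennreal C \<le> lorentz_norm M p q (T a)"
    and Cu: "\<And>a. a \<in> lorentz_seq_space p q \<Longrightarrow> lorentz_norm M p q (T a) \<le> ennreal C * lorentz_seq_norm p q a"
    and Tm: "\<And>a. a \<in> lorentz_seq_space p q \<Longrightarrow> T a \<in> borel_measurable M"
    and Tadd: "\<And>a b. a \<in> lorentz_seq_space p q \<Longrightarrow> b \<in> lorentz_seq_space p q
      \<Longrightarrow> AE x in M. T (\<lambda>k. a k + b k) x = T a x + T b x"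
    and Tsc: "\<And>c a. a \<in> lorentz_seq_space p q \<Longrightarrow> AE x in M. T (\<lambda>k. c * a k) x = c * T a x"
    unfolding lorentz_iso_embedding_def lorentz_space_def by blast
  have vj: "{j. v \<kappa> n c j \<noteq> 0} \<subseteq> \<kappa> ` {..<n}" for \<kappa> n c
  proof
    fix j assume "j \<in> {j. v \<kappa> n c j \<noteq> 0}"
    then have "\<exists>k<n. of_real (c k) * e (\<kappa> k) j \<noteq> (0::'k)"
      unfolding v_def by (metis (mono_tags, lifting) lessThan_iff mem_Collect_eq sum.neutral)
    then show "j \<in> \<kappa> ` {..<n}" by (auto simp: e_def split: if_splits)
  qed
  have v_space: "v \<kappa> n c \<in> lorentz_seq_space p q" for \<kappa> n c
    using vj[of \<kappa> n c] by (intro finite_support_in_lorentz_seq_space p q) (auto intro: finite_subset)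
  have e_space: "e k \<in> lorentz_seq_space p q" for k
    by (intro finite_support_in_lorentz_seq_space p q) (auto simp: e_def intro: finite_subset[of _ "{k}"])
  have ce_space: "(\<lambda>j. of_real c * e k j) \<in> lorentz_seq_space p q" for k c
    by (intro finite_support_in_lorentz_seq_space p q) (auto simp: e_def intro: finite_subset[of _ "{k}"])
  have fm [measurable]: "f k \<in> borel_measurable M" for k
    unfolding f_def by (intro Tm e_space)
  have Sm [measurable]: "S \<kappa> n c \<in> borel_measurable M" for \<kappa> n c
    unfolding S_def by measurable
  have AE: "AE x in M. T (v \<kappa> n c) x = S \<kappa> n c x" for \<kappa> n c
  proof (induction n)
    case 0
    \<comment> \<open>The empty sum requires \<open>T\<close> to vanish almost everywhere at the
      zero sequence, which is homogeneity with scalar \<open>0\<close>.\<close>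
    have "AE x in M. T (\<lambda>j. 0 * e 0 j) x = 0 * T (e 0) x" by (rule Tsc[OF e_space])
    then show ?case by (simp add: v_def S_def fun_eq_iff[symmetric] cong: AE_cong)
  next
    case (Suc n)
    have "AE x in M. T (\<lambda>j. v \<kappa> n c j + of_real (c n) * e (\<kappa> n) j) x
      = T (v \<kappa> n c) x + T (\<lambda>j. of_real (c n) * e (\<kappa> n) j) x"
      by (rule Tadd[OF v_space ce_space])
    moreover have "AE x in M. T (\<lambda>j. of_real (c n) * e (\<kappa> n) j) x = of_real (c n) * T (e (\<kappa> n)) x"
      by (rule Tsc[OF e_space])
    ultimately have "AE x in M. T (\<lambda>j. v \<kappa> n c j + of_real (c n) * e (\<kappa> n) j) x = S \<kappa> (Suc n) c x"
      using Suc by eventually_elim (simp add: S_def f_def scaleR_conv_of_real)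
    moreover have "v \<kappa> (Suc n) c = (\<lambda>j. v \<kappa> n c j + of_real (c n) * e (\<kappa> n) j)"
      by (simp add: v_def fun_eq_iff)
    ultimately show ?case by simp
  qed
  have norm_eq: "lorentz_norm M p q (T (v \<kappa> n c)) = lorentz_norm M p q (S \<kappa> n c)" for \<kappa> n c
    by (rule lorentz_norm_cong_AE[OF AE Tm[OF v_space] Sm])
  have vk: "v \<kappa> n c (\<kappa> k) = of_real (c k)" if "inj_on \<kappa> {..<n}" "k < n" for \<kappa> n c k
  proof -
    have "v \<kappa> n c (\<kappa> k) = (\<Sum>l<n. if l = k then of_real (c l) else 0)"
      unfolding v_def using that by (intro sum.cong) (auto simp: e_def inj_on_def)
    also have "\<dots> = of_real (c k)" using that by simp
    finally show ?thesis .
  qed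
  have up: "lorentz_integral M p q (S \<kappa> n c) \<le> ennreal (C powr q) * lorentz_seq_sum p q (v \<kappa> n c)" for \<kappa> n c
    using epowr_mono[OF Cu[OF v_space, of \<kappa> n c] q] C
    by (simp add: epowr_mult_ennreal lorentz_norm_epowr[OF q] lorentz_seq_norm_epowr[OF q] norm_eq)
  have low: "lorentz_seq_sum p q (v \<kappa> n c) \<le> ennreal (C powr q) * lorentz_integral M p q (S \<kappa> n c)" for \<kappa> n c
  proof -
    have "lorentz_seq_norm p q (v \<kappa> n c) = ennreal C * (lorentz_seq_norm p q (v \<kappa> n c) / ennreal C)"
      using C by (simp add: ennreal_times_divide ennreal_mult_divide_eq mult.commute[of "ennreal C"])
    also have "\<dots> \<le> ennreal C * lorentz_norm M p q (S \<kappa> n c)"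
      using Cl[OF v_space, of \<kappa> n c] by (intro mult_left_mono) (auto simp: norm_eq)
    finally show ?thesis
      using epowr_mono[OF _ q] C
      by (fastforce simp: epowr_mult_ennreal lorentz_norm_epowr[OF q] lorentz_seq_norm_epowr[OF q] dest: epowr_mono[OF _ q])
  qed
  define K where "K = q / p * (2 powr q / (2 powr q - 1))"
  have b: "1 < (2::real) powr q" using q by simp
  have K: "0 \<le> K"
    unfolding K_def using p q less_imp_le[OF b] by (intro mult_nonneg_nonneg divide_nonneg_nonneg) simp_all
  have "lorentz_basis M p q (K * C powr q) (C powr q * (p / q * 2 powr q)) f"
  proof unfold_locales
    show "0 < p" "0 < q" "\<And>k. f k \<in> borel_measurable M" using p q by auto
  next
    fix \<kappa> :: "nat \<Rightarrow> nat" and n :: nat and c :: "nat \<Rightarrow> real" and s :: real and I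
    assume inj: "inj_on \<kappa> {..<n::nat}" and s: "0 < (s::real)" and c: "\<And>k. k < n \<Longrightarrow> \<bar>c k\<bar> \<le> s"
    have vb: "norm (v \<kappa> n c j) \<le> s" for j
    proof (cases "j \<in> \<kappa> ` {..<n}")
      case True
      then show ?thesis using vk[OF inj, of _ c] c by auto
    next
      case False
      then have "v \<kappa> n c j = 0" using vj[of \<kappa> n c] by auto
      then show ?thesis using s by simp
    qed
    have "ennreal (level_sum p q M (S \<kappa> n c) I) \<le> ennreal K * lorentz_integral M p q (S \<kappa> n c)"
      unfolding K_def using p q by (intro level_sum_le_lorentz_integral) auto
    also have "\<dots> \<le> ennreal K * (ennreal (C powr q) * ennreal (s powr q * real n powr (q/p)))"
      using vj[of \<kappa> n c]
      by (intro mult_left_mono order.trans[OF up] lorentz_seq_sum_le[OF p q s vb, of "\<kappa> ` {..<n}"])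
         (auto simp: card_image_le[of "{..<n}", simplified])
    also have "\<dots> = ennreal (K * C powr q * (s powr q * real n powr (q/p)))"
      using K by (simp add: ennreal_mult' mult.assoc)
    finally show "level_sum p q M (\<lambda>x. \<Sum>k<n. c k *\<^sub>R f (\<kappa> k) x) I \<le> K * C powr q * (s powr q * real n powr (q/p))"
      using K by (subst (asm) ennreal_le_iff) (auto simp: S_def[abs_def])
  next
    fix \<kappa> :: "nat \<Rightarrow> nat" and n :: nat and c w :: "nat \<Rightarrow> real" and B
    assume inj: "inj_on \<kappa> {..<n::nat}" and w: "\<And>k. k < n \<Longrightarrow> 0 \<le> w k \<and> w k \<le> \<bar>c k\<bar>"
      and dec: "\<And>j k. j \<le> k \<Longrightarrow> k < n \<Longrightarrow> (w k :: real) \<le> w j"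
      and B: "\<And>I. level_sum p q M (\<lambda>x. \<Sum>k<n. c k *\<^sub>R f (\<kappa> k) x) I \<le> B"
    have B0: "0 \<le> B" using B[of 0] by (simp add: level_sum_def)
    have "ennreal (\<Sum>k<n. w k powr q * (real (Suc k) powr (q/p) - real k powr (q/p)))
      \<le> lorentz_seq_sum p q (v \<kappa> n c)"
      using w vk[OF inj, of _ c] by (intro lorentz_seq_sum_ge[OF p q inj _ dec]) auto
    also have "\<dots> \<le> ennreal (C powr q) * lorentz_integral M p q (S \<kappa> n c)" by (rule low)
    also have "\<dots> \<le> ennreal (C powr q) * ennreal (p / q * 2 powr q * (1 + B))"
      using B by (intro mult_left_mono lorentz_integral_le_level_sum p q) (auto simp: S_def[abs_def])
    also have "\<dots> = ennreal (C powr q * (p / q * 2 powr q) * (1 + B))"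
      by (subst ennreal_mult'[symmetric]) (auto simp: mult.assoc)
    finally show "(\<Sum>k<n. w k powr q * (real (Suc k) powr (q/p) - real k powr (q/p)))
      \<le> C powr q * (p / q * 2 powr q) * (1 + B)"
      using p q B0 by (subst (asm) ennreal_le_iff) auto
  qed
  then show ?thesis by (rule that)
qed

subsection \<open>Images of the unit vector basis\<close>

lemma norm_le_norm_add_or_diff:
  fixes x y :: "'k::real_normed_vector"
  shows "norm x \<le> norm (y + x) \<or> norm x \<le> norm (y - x)"
proof (rule ccontr)
  assume "\<not> ?thesis"
  moreover have "norm (2 *\<^sub>R x) \<le> norm (y + x) + norm (y - x)"
    using norm_triangle_ineq4[of "y + x" "y - x"] by (simp add: scaleR_2)
  ultimately show False by simp
qed

lemma sgn_sum_split:
  assumes "k < n"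
  shows "sgn_sum U n g x = (\<Sum>l\<in>{..<n} - {k}. sgn_of U l *\<^sub>R g l x) + sgn_of U k *\<^sub>R g k x"
  unfolding sgn_sum_def using assms by (subst sum.remove[of _ k]) auto

text \<open>The sets \<open>U\<close> are paired by flipping the sign of the \<open>k\<close>-th summand.\<close>
lemma (in prob_space) lev_powr_le_sum_sgn_sum:
  fixes g :: "nat \<Rightarrow> 'a \<Rightarrow> 'k::euclidean_space"
  assumes [measurable]: "\<And>k. g k \<in> borel_measurable M" and k: "k < n" and a: "0 < a"
  shows "2 ^ n * lev M (g k) i powr a \<le> 2 * 2 powr a * (\<Sum>U\<in>Pow {..<n}. lev M (sgn_sum U n g) i powr a)"
proof -
  define flip where "flip U = (if k \<in> U then U - {k} else insert k U)" for U
  have flip: "lev M (g k) i powr a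
    \<le> 2 powr a * (lev M (sgn_sum U n g) i powr a + lev M (sgn_sum (flip U) n g) i powr a)" for U
  proof -
    have sub: "{x \<in> space M. 2 ^ i < norm (g k x)}
      \<subseteq> {x \<in> space M. 2 ^ i < norm (sgn_sum U n g x)} \<union> {x \<in> space M. 2 ^ i < norm (sgn_sum (flip U) n g x)}"
    proof
      fix x assume x: "x \<in> {x \<in> space M. 2 ^ i < norm (g k x)}"
      define y where "y = (\<Sum>l\<in>{..<n} - {k}. sgn_of U l *\<^sub>R g l x)"
      have "(\<Sum>l\<in>{..<n} - {k}. sgn_of (flip U) l *\<^sub>R g l x) = y"
        unfolding y_def by (intro sum.cong) (auto simp: flip_def sgn_of_def)
      moreover have "sgn_of (flip U) k = - sgn_of U k" by (simp add: flip_def sgn_of_def)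
      ultimately have "sgn_sum U n g x = y + sgn_of U k *\<^sub>R g k x"
        "sgn_sum (flip U) n g x = y - sgn_of U k *\<^sub>R g k x"
        using k by (simp_all add: sgn_sum_split[of k] y_def)
      moreover have "norm (sgn_of U k *\<^sub>R g k x) = norm (g k x)" by simp
      ultimately show "x \<in> {x \<in> space M. 2 ^ i < norm (sgn_sum U n g x)}
          \<union> {x \<in> space M. 2 ^ i < norm (sgn_sum (flip U) n g x)}"
        using x norm_le_norm_add_or_diff[of "sgn_of U k *\<^sub>R g k x" y] by auto
    qed
    have "lev M (g k) i \<le> measure M ({x \<in> space M. 2 ^ i < norm (sgn_sum U n g x)}
        \<union> {x \<in> space M. 2 ^ i < norm (sgn_sum (flip U) n g x)})"
      unfolding lev_def using sub by (intro finite_measure_mono) measurable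
    also have "\<dots> \<le> lev M (sgn_sum U n g) i + lev M (sgn_sum (flip U) n g) i"
      unfolding lev_def by (intro measure_Un_le) measurable
    finally have "lev M (g k) i powr a \<le> (lev M (sgn_sum U n g) i + lev M (sgn_sum (flip U) n g) i) powr a"
      using a by (intro powr_mono2) auto
    then show ?thesis
      using powr_add_le[of "lev M (sgn_sum U n g) i" "lev M (sgn_sum (flip U) n g) i" a] a by simp
  qed
  have "2 ^ n * lev M (g k) i powr a = (\<Sum>U\<in>Pow {..<n}. lev M (g k) i powr a)"
    by (simp add: card_Pow)
  also have "\<dots> \<le> (\<Sum>U\<in>Pow {..<n}. 2 powr a * (lev M (sgn_sum U n g) i powr a + lev M (sgn_sum (flip U) n g) i powr a))"
    by (intro sum_mono flip)
  also have "\<dots> = 2 powr a * ((\<Sum>U\<in>Pow {..<n}. lev M (sgn_sum U n g) i powr a)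
      + (\<Sum>U\<in>Pow {..<n}. lev M (sgn_sum (flip U) n g) i powr a))"
    by (simp only: sum_distrib_left sum.distrib distrib_left)
  also have "(\<Sum>U\<in>Pow {..<n}. lev M (sgn_sum (flip U) n g) i powr a)
    = (\<Sum>U\<in>Pow {..<n}. lev M (sgn_sum U n g) i powr a)"
    using k by (intro sum.reindex_bij_witness[of _ flip flip]) (auto simp: flip_def)
  finally show ?thesis by simp
qed

context lorentz_basis
begin

definition level_term :: "nat \<Rightarrow> nat \<Rightarrow> real" where
  "level_term k i = (2 ^ i) powr q * lev M (f k) i powr (q/p)"

lemma level_term_nonneg [simp]: "0 \<le> level_term k i"
  by (simp add: level_term_def)

lemma exponent_pos: "0 < q / p"
  using p_pos q_pos by simp

lemma level_term_sum_le: "(\<Sum>i<I. level_term k i) \<le> Ku"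
  using upper[of "\<lambda>_. k" 1 1 "\<lambda>_. 1" I] by (simp add: level_sum_def level_term_def inj_on_def)

lemma Ku_nonneg: "0 \<le> Ku"
  using level_term_sum_le[of 0 0] by simp

lemma upper_sgn_sum:
  assumes "inj_on \<kappa> {..<n}"
  shows "level_sum p q M (sgn_sum U n (\<lambda>k. f (\<kappa> k))) I \<le> Ku * real n powr (q/p)"
  using upper[of \<kappa> n 1 "sgn_of U" I] assms by (simp add: sgn_sum_def[abs_def])

text \<open>Averages below \<open>B\<close> for each \<open>I\<close> yield one sign pattern good
  for all \<open>I\<close> simultaneously: there are finitely many patterns and
  \<open>level_sum\<close> grows with \<open>I\<close>, so individually bad indices could be
  replaced by their maximum.\<close>

lemma lower_average:
  assumes inj: "inj_on \<kappa> {..<n}" and w: "\<And>k. k < n \<Longrightarrow> 0 \<le> w k"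
    and dec: "\<And>j k. j \<le> k \<Longrightarrow> k < n \<Longrightarrow> w k \<le> w j"
    and B: "\<And>I. (\<Sum>U\<in>Pow {..<n}. level_sum p q M (sgn_sum U n (\<lambda>k x. w k *\<^sub>R f (\<kappa> k) x)) I) \<le> 2 ^ n * B"
  shows "(\<Sum>k<n. w k powr q * (real (Suc k) powr (q/p) - real k powr (q/p))) \<le> Kl * (1 + B)"
proof -
  define L where "L U I = level_sum p q M (sgn_sum U n (\<lambda>k x. w k *\<^sub>R f (\<kappa> k) x)) I" for U I
  have "\<exists>U\<in>Pow {..<n}. \<forall>I. L U I \<le> B"
  proof (rule ccontr)
    assume "\<not> ?thesis"
    then have "\<forall>U\<in>Pow {..<n}. \<exists>I. B < L U I" by (auto simp: not_le)
    then obtain J where J: "\<And>U. U \<in> Pow {..<n} \<Longrightarrow> B < L U (J U)" by metis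
    define I where "I = Max (J ` Pow {..<n})"
    have "B < L U I" if "U \<in> Pow {..<n}" for U
    proof -
      have "J U \<le> I" unfolding I_def using that by (intro Max_ge) auto
      then have "L U (J U) \<le> L U I" unfolding L_def by (rule level_sum_mono)
      then show ?thesis using J[OF that] by simp
    qed
    then have "(\<Sum>U\<in>Pow {..<n}. B) < (\<Sum>U\<in>Pow {..<n}. L U I)"
      by (intro sum_strict_mono) auto
    then show False using B[of I] by (simp add: card_Pow L_def)
  qed
  then obtain U where "\<And>I. L U I \<le> B" by blast
  then show ?thesis
    using w dec by (intro lower[OF inj, where c = "\<lambda>k. sgn_of U k * w k"])
      (auto simp: L_def sgn_sum_def[abs_def] abs_mult)
qed

text \<open>At every level the sign average over all of \<open>A\<close> dominates each single
  summand up to a constant, so a different summand may be selected at each level without extra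
  cost.\<close>

lemma sum_selected_level_term_le:
  assumes A: "finite A" and g: "\<And>i. i < I \<Longrightarrow> g i \<in> A"
  shows "(\<Sum>i<I. level_term (g i) i) \<le> 2 * 2 powr (q/p) * Ku * real (card A) powr (q/p)"
proof -
  define n where "n = card A"
  define a where "a = q/p"
  have a: "0 < a" using exponent_pos by (simp add: a_def)
  obtain \<kappa> where \<kappa>: "bij_betw \<kappa> {..<n} A"
    using ex_bij_betw_nat_finite[OF A] by (auto simp: n_def atLeast0LessThan)
  define S where "S U = sgn_sum U n (\<lambda>k. f (\<kappa> k))" for U
  have "2 ^ n * (\<Sum>i<I. level_term (g i) i) = (\<Sum>i<I. (2 ^ i) powr q * (2 ^ n * lev M (f (g i)) i powr a))"
    by (simp add: level_term_def a_def sum_distrib_left ac_simps)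
  also have "\<dots> \<le> (\<Sum>i<I. (2 ^ i) powr q * (2 * 2 powr a * (\<Sum>U\<in>Pow {..<n}. lev M (S U) i powr a)))"
  proof (intro sum_mono mult_left_mono)
    fix i assume i: "i \<in> {..<I}"
    then obtain k where k: "k < n" "g i = \<kappa> k"
      using g[of i] \<kappa> by (auto simp: bij_betw_def)
    show "2 ^ n * lev M (f (g i)) i powr a \<le> 2 * 2 powr a * (\<Sum>U\<in>Pow {..<n}. lev M (S U) i powr a)"
      using lev_powr_le_sum_sgn_sum[of "\<lambda>k. f (\<kappa> k)" k n a i] k a by (simp add: S_def)
  qed auto
  also have "\<dots> = 2 * 2 powr a * (\<Sum>U\<in>Pow {..<n}. level_sum p q M (S U) I)"
    unfolding level_sum_def a_def[symmetric] sum_distrib_left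
    by (subst sum.swap) (simp add: ac_simps)
  also have "\<dots> \<le> 2 * 2 powr a * (\<Sum>U\<in>Pow {..<n}. Ku * real n powr a)"
    unfolding a_def S_def using \<kappa>
    by (intro mult_left_mono sum_mono upper_sgn_sum) (auto simp: bij_betw_def)
  also have "\<dots> = 2 ^ n * (2 * 2 powr a * Ku * real n powr a)"
    by (simp add: card_Pow)
  finally show ?thesis by (simp add: n_def a_def)
qed

text \<open>For \<open>q < p\<close> infinitely many escaping bumps on disjoint windows would make sums of \<open>n\<close> basis
  vectors as large as \<open>n powr (1/q)\<close> instead of \<open>n powr (1/p)\<close>.\<close>
lemma uniform_tails:
  assumes qp: "q < p" and d: "0 < d"
  shows "\<exists>I0. \<forall>k J. (\<Sum>i=I0..<J. level_term k i) \<le> d"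
proof (rule ccontr)
  assume "\<not> ?thesis"
  then have ex: "\<exists>k J. d < (\<Sum>i=I0..<J. level_term k i)" for I0 by (auto simp: not_le)
  \<comment> \<open>\<open>g\<close> assigns to each level the vector whose bump occupies the window
    around it. A vector may recur, hence only \<open>card A \<le> m\<close>.\<close>
  have "\<exists>g A I. finite A \<and> card A \<le> m \<and> (\<forall>i<I. g i \<in> A) \<and> real m * d \<le> (\<Sum>i<I. level_term (g i) i)" for m
  proof (induction m)
    case 0
    show ?case by (intro exI[of _ "\<lambda>_. 0"] exI[of _ "{}"] exI[of _ 0]) auto
  next
    case (Suc m)
    then obtain g A I where IH: "finite A" "card A \<le> m" "\<forall>i<I. g i \<in> A" "real m * d \<le> (\<Sum>i<I. level_term (g i) i)"
      by blast
    obtain k J where kJ: "d < (\<Sum>i=I..<J. level_term k i)" using ex by blast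
    have IJ: "I \<le> J" using kJ d by (cases "I \<le> J") auto
    define h where "h i = (if i < I then g i else k)" for i
    have "(\<Sum>i<J. level_term (h i) i) = (\<Sum>i<I. level_term (h i) i) + (\<Sum>i=I..<J. level_term (h i) i)"
      using IJ sum.atLeastLessThan_concat[of 0 I J "\<lambda>i. level_term (h i) i"] by (simp add: atLeast0LessThan)
    also have "\<dots> = (\<Sum>i<I. level_term (g i) i) + (\<Sum>i=I..<J. level_term k i)" by (simp add: h_def)
    finally have "real (Suc m) * d \<le> (\<Sum>i<J. level_term (h i) i)" using IH(4) kJ by (simp add: algebra_simps)
    moreover have "card (insert k A) \<le> Suc m" using IH by (simp add: card_insert_if)
    ultimately show ?case using IH
      by (intro exI[of _ h] exI[of _ "insert k A"] exI[of _ J]) (auto simp: h_def)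
  qed
  moreover have "real m * d \<le> 2 * 2 powr (q/p) * Ku * real m powr (q/p)"
    if "finite A" "card A \<le> m" "\<forall>i<I. g i \<in> A" "real m * d \<le> (\<Sum>i<I. level_term (g i) i)" for m g A I
  proof -
    have "real m * d \<le> 2 * 2 powr (q/p) * Ku * real (card A) powr (q/p)"
      using that sum_selected_level_term_le[of A I g] by auto
    also have "\<dots> \<le> 2 * 2 powr (q/p) * Ku * real m powr (q/p)"
      using that Ku_nonneg exponent_pos by (intro mult_left_mono powr_mono2) auto
    finally show ?thesis .
  qed
  ultimately have le: "real m * d \<le> 2 * 2 powr (q/p) * Ku * real m powr (q/p)" for m by meson
  have "eventually (\<lambda>m. real m * d > 2 * 2 powr (q/p) * Ku * real m powr (q/p)) sequentially"
  proof -
    have "q/p < 1" using qp p_pos by simp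
    then have "((\<lambda>m. 2 * 2 powr (q/p) * Ku * real m powr (q/p - 1)) \<longlongrightarrow> 2 * 2 powr (q/p) * Ku * 0) sequentially"
      by (intro tendsto_mult tendsto_const tendsto_neg_powr filterlim_real_sequentially) auto
    then have "eventually (\<lambda>m. 2 * 2 powr (q/p) * Ku * real m powr (q/p - 1) < d) sequentially"
      using d by (intro order_tendstoD) auto
    then show ?thesis using eventually_gt_at_top[of 0]
    proof eventually_elim
      case (elim m)
      then have "real m * (2 * 2 powr (q/p) * Ku * real m powr (q/p - 1)) < real m * d" by simp
      then show ?case using elim by (simp add: powr_diff)
    qed
  qed
  then obtain m where "real m * d > 2 * 2 powr (q/p) * Ku * real m powr (q/p)"
    by (auto simp: eventually_sequentially)
  then show False using le[of m] by simp
qed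

lemma convergent_levels:
  obtains r l where "strict_mono (r :: nat \<Rightarrow> nat)" "\<And>i. (\<lambda>k. lev M (f (r k)) i) \<longlonglongrightarrow> l i"
proof -
  interpret subseqs "\<lambda>i s. convergent (\<lambda>k. lev M (f (s k)) i)"
  proof
    fix i :: nat and s :: "nat \<Rightarrow> nat" assume "strict_mono s"
    have "bounded (range (\<lambda>k. lev M (f (s k)) i))"
      by (rule boundedI[of _ 1]) auto
    then obtain l r where "strict_mono (r :: nat \<Rightarrow> nat)" "((\<lambda>k. lev M (f (s k)) i) \<circ> r) \<longlonglongrightarrow> l"
      using bounded_imp_convergent_subsequence by blast
    then show "\<exists>r. strict_mono r \<and> convergent (\<lambda>k. lev M (f ((s \<circ> r) k)) i)"
      by (auto simp: convergent_def o_def)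
  qed
  have "convergent (\<lambda>k. lev M (f (diagseq k)) i)" for i
  proof -
    have "convergent (\<lambda>k. lev M (f ((diagseq \<circ> (+) (Suc i)) k)) i)"
    proof (rule diagseq_holds)
      fix s r :: "nat \<Rightarrow> nat" and i
      assume "strict_mono r" "convergent (\<lambda>k. lev M (f (s k)) i)"
      then show "convergent (\<lambda>k. lev M (f ((s \<circ> r) k)) i)"
        using convergent_subseq_convergent[of "\<lambda>k. lev M (f (s k)) i" r] by (simp add: o_def)
    qed
    then have "convergent (\<lambda>k. lev M (f (diagseq (k + Suc i))) i)" by (simp add: add.commute)
    then show ?thesis by (simp only: convergent_ignore_initial_segment[of "\<lambda>k. lev M (f (diagseq k)) i"])
  qed
  then have "\<exists>l. \<forall>i. (\<lambda>k. lev M (f (diagseq k)) i) \<longlonglongrightarrow> l i"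
    unfolding convergent_def by (intro choice) blast
  then show ?thesis using that subseq_diagseq by blast
qed

end

subsection \<open>The case p < 2\<close>

lemma sum_convolution_le:
  fixes t :: real and v :: "nat \<Rightarrow> real"
  assumes t: "0 \<le> t" "t < 1" and v: "\<And>j. 0 \<le> v j"
  shows "(\<Sum>i<I. \<Sum>j\<le>i. t ^ (i - j) * v j) \<le> (\<Sum>j<I. v j) / (1 - t)"
proof -
  have "(\<Sum>i<I. \<Sum>j\<le>i. t ^ (i - j) * v j) = (\<Sum>(j, m)\<in>{(j, m). j + m < I}. t ^ m * v j)"
    by (rule sum.triangle_reindex[symmetric])
  also have "\<dots> \<le> (\<Sum>(j, m)\<in>{..<I} \<times> {..<I}. t ^ m * v j)"
    using t v by (intro sum_mono2) auto
  also have "\<dots> = (\<Sum>j<I. v j) * (\<Sum>m<I. t ^ m)"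
    by (simp add: sum.cartesian_product[symmetric] sum_product mult.commute)
  also have "\<dots> \<le> (\<Sum>j<I. v j) * (1 / (1 - t))"
  proof (intro mult_left_mono sum_nonneg v)
    have "(\<Sum>m<I. t ^ m) \<le> (\<Sum>m. t ^ m)"
      using t by (intro sum_le_suminf summable_geometric) auto
    also have "\<dots> = 1 / (1 - t)" using t by (intro suminf_geometric) auto
    finally show "(\<Sum>m<I. t ^ m) \<le> 1 / (1 - t)" .
  qed
  finally show ?thesis by simp
qed

lemma summable_tail_le:
  fixes x :: "nat \<Rightarrow> real"
  assumes "summable x" "\<And>i. 0 \<le> x i" "0 < d"
  obtains I0 where "\<And>J. (\<Sum>i=I0..<J. x i) \<le> d"
proof -
  obtain N where N: "\<And>m n. N \<le> m \<Longrightarrow> norm (sum x {m..<n}) < d"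
    using assms(1,3) unfolding summable_Cauchy by meson
  then have "(\<Sum>i=N..<J. x i) \<le> d" for J using N[of N J] by (simp add: abs_less_iff less_imp_le)
  then show ?thesis by (rule that)
qed

lemma exists_powr_gt:
  fixes a Z :: real
  assumes a: "0 < a"
  shows "\<exists>n\<ge>N. Z < real n powr a"
proof -
  obtain m :: nat where m: "(\<bar>Z\<bar> + 1) powr (1 / a) < real m" using reals_Archimedean2 by blast
  have "Z < \<bar>Z\<bar> + 1" by simp
  also have "\<dots> = ((\<bar>Z\<bar> + 1) powr (1 / a)) powr a" using a by (simp add: powr_powr)
  also have "\<dots> \<le> real (max N m) powr a" using a m by (intro powr_mono2) auto
  finally show ?thesis by (intro exI[of _ "max N m"]) auto
qed

context lorentz_basis
begin

lemma level_sum_lower_uniform: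
  assumes inj: "inj_on \<kappa> {..<n}"
    and B: "\<And>I. (\<Sum>U\<in>Pow {..<n}. level_sum p q M (sgn_sum U n (\<lambda>k. f (\<kappa> k))) I) \<le> 2 ^ n * B"
  shows "real n powr (q/p) \<le> Kl * (1 + B)"
  using lower_average[OF inj, of "\<lambda>_. 1" B] B
    sum_lessThan_telescope[of "\<lambda>k. real k powr (q/p)" n] by simp

text \<open>This is where \<open>p < 2\<close> enters: after multiplication by
  \<open>(2 ^ i) powr p\<close> the truncated second moments become a convolution in which level
  \<open>j \<le> i\<close> has weight \<open>\<theta> ^ (i - j)\<close> with
  \<open>\<theta> = 2 powr (p - 2) < 1\<close>. The extra \<open>n\<close> in \<open>v 0\<close>
  stems from the \<open>1\<close> in \<open>integral_band_sq_le'\<close>; \<open>t\<close> and the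
  second factor of \<open>K\<close> come from \<open>geometric_sum_powr_le\<close>.\<close>

lemma sgn_sum_level_le:
  fixes \<kappa> :: "nat \<Rightarrow> nat" and n :: nat
  assumes p2: "p < 2"
  defines "t \<equiv> sqrt (2 powr (p - 2)) powr (q/p)"
  defines "K \<equiv> (4 * khintchine_const (q/p)) powr (q/p) * (1 / (1 - sqrt (2 powr (p - 2)))) powr (q/p)"
  defines "v \<equiv> \<lambda>j. (2 ^ j) powr p * (\<Sum>k<n. lev M (f (\<kappa> k)) j) + (if j = 0 then real n else 0)"
  shows "(\<Sum>U\<in>Pow {..<n}. (2 ^ i) powr q * lev M (sgn_sum U n (\<lambda>k. f (\<kappa> k))) i powr (q/p))
    \<le> 2 ^ n * (K * (\<Sum>j\<le>i. t ^ (i - j) * v j powr (q/p)))"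
proof -
  define a where "a = q/p"
  define D where "D = khintchine_const a"
  define \<theta> where "\<theta> = (2::real) powr (p - 2)"
  define L where "L j = (\<Sum>k<n. lev M (f (\<kappa> k)) j)" for j
  have a: "0 < a" using exponent_pos by (simp add: a_def)
  have D: "1 \<le> D" using khintchine_const_ge_1 by (simp add: D_def)
  have \<theta>: "0 < \<theta>" "\<theta> < 1" using p2 by (auto simp: \<theta>_def powr_less_one)
  have L0: "0 \<le> L j" for j by (auto simp: L_def intro!: sum_nonneg)
  have v0: "0 \<le> v j" for j using L0 by (auto simp: v_def L_def[symmetric])
  define T where "T = (4 ^ i * L i + D * (\<Sum>k<n. \<integral>x. (norm (band 0 (2 ^ i) (f (\<kappa> k)) x))\<^sup>2 \<partial>M)) / 4 ^ i"
  have \<theta>4: "4 ^ j * \<theta> ^ j = (2 ^ j) powr p" for j :: nat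
  proof -
    have "\<theta> ^ j = (2 ^ j) powr (p - 2)" by (induction j) (auto simp: \<theta>_def powr_mult)
    then show ?thesis by (simp add: powr_diff four_power_eq)
  qed
  have T0: "0 \<le> T" unfolding T_def using L0 D
    by (intro divide_nonneg_nonneg add_nonneg_nonneg mult_nonneg_nonneg sum_nonneg) auto
  have "4 ^ i * T = 4 ^ i * L i + D * (\<Sum>k<n. \<integral>x. (norm (band 0 (2 ^ i) (f (\<kappa> k)) x))\<^sup>2 \<partial>M)"
    by (simp add: T_def)
  also have "\<dots> \<le> 4 ^ i * L i + D * (\<Sum>k<n. 1 + (\<Sum>m<i. 4 ^ Suc m * lev M (f (\<kappa> k)) m))"
    using D by (intro add_left_mono mult_left_mono sum_mono integral_band_sq_le') auto
  also have "(\<Sum>k<n. 1 + (\<Sum>m<i. 4 ^ Suc m * lev M (f (\<kappa> k)) m)) = n + 4 * (\<Sum>m<i. 4 ^ m * L m)"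
    by (simp add: sum.distrib L_def sum_distrib_left mult.assoc) (rule sum.swap)
  also have "4 ^ i * L i + D * (n + 4 * (\<Sum>m<i. 4 ^ m * L m)) \<le> 4 * D * (n + (\<Sum>m\<le>i. 4 ^ m * L m))"
  proof -
    have "4 ^ i * L i * 1 \<le> 4 ^ i * L i * (4 * D)" using L0 D by (intro mult_left_mono) auto
    moreover have "D * n \<le> 4 * (D * n)" using D by simp
    ultimately show ?thesis by (simp add: lessThan_Suc_atMost[symmetric] algebra_simps)
  qed
  also have "\<dots> = 4 * D * (4 ^ i * (\<Sum>j\<le>i. \<theta> ^ (i - j) * v j)) / (4 ^ i * \<theta> ^ i)"
  proof -
    have "4 ^ i * (\<theta> ^ (i - j) * v j) = 4 ^ i * \<theta> ^ i * (4 ^ j * L j + (if j = 0 then real n else 0))" if "j \<le> i" for j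
    proof -
      have "\<theta> ^ i = \<theta> ^ (i - j) * \<theta> ^ j" using that by (simp flip: power_add)
      then show ?thesis
        unfolding v_def L_def[symmetric] \<theta>4[symmetric] by (auto simp: algebra_simps)
    qed
    then have "4 ^ i * (\<Sum>j\<le>i. \<theta> ^ (i - j) * v j)
      = 4 ^ i * \<theta> ^ i * (\<Sum>j\<le>i. 4 ^ j * L j + (if j = 0 then real n else 0))"
      by (simp add: sum_distrib_left mult.assoc)
    also have "(\<Sum>j\<le>i. 4 ^ j * L j + (if j = 0 then real n else 0)) = n + (\<Sum>m\<le>i. 4 ^ m * L m)"
      by (simp add: sum.distrib)
    finally show ?thesis using \<theta> by simp
  qed
  finally have "(2 ^ i) powr p * T \<le> 4 * D * (\<Sum>j\<le>i. \<theta> ^ (i - j) * v j)"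
    using \<theta> unfolding \<theta>4[symmetric] by (simp add: field_simps)
  then have "((2 ^ i) powr p * T) powr a \<le> (4 * D * (\<Sum>j\<le>i. \<theta> ^ (i - j) * v j)) powr a"
    using a T0 by (intro powr_mono2) auto
  also have "\<dots> = (4 * D) powr a * (\<Sum>j\<le>i. \<theta> ^ (i - j) * v j) powr a"
    using D \<theta> v0 by (simp add: powr_mult sum_nonneg)
  also have "\<dots> \<le> (4 * D) powr a * ((1 / (1 - sqrt \<theta>)) powr a * (\<Sum>j\<le>i. (sqrt \<theta> powr a) ^ (i - j) * v j powr a))"
    using \<theta> v0 a by (intro mult_left_mono geometric_sum_powr_le) auto
  also have "\<dots> = K * (\<Sum>j\<le>i. t ^ (i - j) * v j powr (q/p))"
    by (simp add: K_def t_def a_def D_def \<theta>_def)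
  finally have T: "((2 ^ i) powr p * T) powr a \<le> K * (\<Sum>j\<le>i. t ^ (i - j) * v j powr (q/p))" .
  have "(\<Sum>U\<in>Pow {..<n}. (2 ^ i) powr q * lev M (sgn_sum U n (\<lambda>k. f (\<kappa> k))) i powr a)
    = (2 ^ i) powr q * (\<Sum>U\<in>Pow {..<n}. lev M (sgn_sum U n (\<lambda>k. f (\<kappa> k))) i powr a)"
    by (simp add: sum_distrib_left)
  also have "\<dots> \<le> (2 ^ i) powr q * (2 ^ n * T powr a)"
    using sgn_sum_lev_powr[of "\<lambda>k. f (\<kappa> k)" a n i] a
    by (intro mult_left_mono) (auto simp: T_def D_def L_def)
  also have "\<dots> = 2 ^ n * ((2 ^ i) powr p * T) powr a"
    using T0 p_pos by (simp add: powr_mult powr_powr a_def)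
  also have "\<dots> \<le> 2 ^ n * (K * (\<Sum>j\<le>i. t ^ (i - j) * v j powr (q/p)))"
    using T by (intro mult_left_mono) auto
  finally show ?thesis by (simp add: a_def)
qed

text \<open>\<open>x\<close> is the common profile and \<open>\<rho>\<close> the error, small
  against \<open>real n powr (q/p)\<close>. Levels below \<open>J\<close> contribute at most
  \<open>B0\<close>, because measures are at most \<open>1\<close>; the others see only the tail of
  the convolved profile \<open>Y\<close> and the error. As \<open>J\<close> is fixed before
  \<open>n\<close>, the norm is too small for large \<open>n\<close>.\<close>

lemma contradiction_if_p_less_2:
  assumes p2: "p < 2" and x: "summable x" "\<And>j. 0 \<le> x j" and C: "0 \<le> C"
    and key: "\<And>\<eta>. 0 < \<eta> \<Longrightarrow> \<exists>N. \<forall>n\<ge>N. \<exists>\<kappa> \<rho>. inj_on \<kappa> {..<n} \<and> (\<forall>j. 0 \<le> \<rho> j)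
      \<and> (\<forall>j. ((2 ^ j) powr p * (\<Sum>k<n. lev M (f (\<kappa> k)) j)) powr (q/p)
            \<le> C * real n powr (q/p) * x j + \<rho> j)
      \<and> (\<forall>J. (\<Sum>j<J. \<rho> j) \<le> \<eta> * real n powr (q/p))"
  shows False
proof -
  define a where "a = q/p"
  have a: "0 < a" using exponent_pos by (simp add: a_def)
  define s where "s = sqrt (2 powr (p - 2))"
  define t where "t = s powr a"
  have s: "0 < s" "s < 1" using p2 by (auto simp: s_def powr_less_one)
  have t: "0 < t" "t < 1" using s a powr_less_mono2[of a s 1] by (auto simp: t_def)
  define K1 where "K1 = (4 * khintchine_const a) powr a * (1 / (1 - s)) powr a"
  have K1: "0 \<le> K1" by (simp add: K1_def)
  define K where "K = max 1 Kl"
  have K: "1 \<le> K" "Kl \<le> K" by (auto simp: K_def)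
  define x' where "x' j = C * x j + (if j = 0 then 1 else 0)" for j
  have x'0: "0 \<le> x' j" for j using x C by (simp add: x'_def)
  have "summable x'"
  proof -
    have "summable (\<lambda>j. if j = 0 then 1 else 0 :: real)" by (rule summable_finite[of "{0}"]) auto
    then show ?thesis unfolding x'_def using x by (intro summable_add summable_mult)
  qed
  define Y where "Y i = (\<Sum>j\<le>i. x' j * t ^ (i - j))" for i
  have "summable Y"
    unfolding Y_def using \<open>summable x'\<close> x'0 t
    by (intro summable_Cauchy_product) (auto intro!: summable_geometric)
  moreover have Y0: "0 \<le> Y i" for i unfolding Y_def using x'0 t by (auto intro!: sum_nonneg)
  moreover have P: "0 < K * K1 * 2 powr a + 1" using K K1 by (intro add_nonneg_pos mult_nonneg_nonneg) auto
  \<comment> \<open>After multiplication by \<open>K * K1 * 2 powr a\<close>, this tail and, through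
    \<open>\<eta>\<close>, the error each cost at most a quarter of \<open>real n powr a\<close>.
    The factor \<open>1 - t\<close> in \<open>\<eta>\<close> pays for the convolution, and the
    \<open>+ 1\<close> keeps the denominators positive.\<close>
  ultimately obtain J where J: "\<And>I. (\<Sum>i=J..<I. Y i) \<le> 1 / (4 * (K * K1 * 2 powr a + 1))"
    using summable_tail_le[of Y "1 / (4 * (K * K1 * 2 powr a + 1))"]
    by (metis divide_pos_pos mult_pos_pos zero_less_numeral zero_less_one)
  define B0 where "B0 = (\<Sum>i<J. (2 ^ i) powr q)"
  define \<eta> where "\<eta> = (1 - t) / (4 * (K * K1 * 2 powr a + 1))"
  have \<eta>: "0 < \<eta>" unfolding \<eta>_def using P t by (intro divide_pos_pos) auto
  obtain N where N: "\<And>n. N \<le> n \<Longrightarrow> \<exists>\<kappa> \<rho>. inj_on \<kappa> {..<n} \<and> (\<forall>j. 0 \<le> \<rho> j)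
      \<and> (\<forall>j. ((2 ^ j) powr p * (\<Sum>k<n. lev M (f (\<kappa> k)) j)) powr a
            \<le> C * real n powr a * x j + \<rho> j)
      \<and> (\<forall>J. (\<Sum>j<J. \<rho> j) \<le> \<eta> * real n powr a)"
    using key[OF \<eta>] unfolding a_def by blast
  have bound: "real n powr a \<le> 2 * K * (1 + B0)" if n: "N \<le> n" for n
  proof -
    obtain \<kappa> \<rho> where inj: "inj_on \<kappa> {..<n}" and \<rho>0: "\<And>j. 0 \<le> \<rho> j"
      and \<rho>: "\<And>j. ((2 ^ j) powr p * (\<Sum>k<n. lev M (f (\<kappa> k)) j)) powr a \<le> C * real n powr a * x j + \<rho> j"
      and \<rho>s: "\<And>J. (\<Sum>j<J. \<rho> j) \<le> \<eta> * real n powr a"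
      using N[OF n] by blast
    define v where "v j = (2 ^ j) powr p * (\<Sum>k<n. lev M (f (\<kappa> k)) j) + (if j = 0 then real n else 0)" for j
    have v: "v j powr a \<le> 2 powr a * (real n powr a * x' j + \<rho> j)" for j
    proof -
      have "v j powr a \<le> 2 powr a * (((2 ^ j) powr p * (\<Sum>k<n. lev M (f (\<kappa> k)) j)) powr a
          + (if j = 0 then real n else 0) powr a)"
        unfolding v_def using a by (intro powr_add_le mult_nonneg_nonneg sum_nonneg) auto
      also have "\<dots> \<le> 2 powr a * ((C * real n powr a * x j + \<rho> j) + (if j = 0 then real n else 0) powr a)"
        by (intro mult_left_mono add_right_mono \<rho>) auto
      also have "\<dots> = 2 powr a * (real n powr a * x' j + \<rho> j)"
        by (simp add: x'_def algebra_simps)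
      finally show ?thesis .
    qed
    define A where "A i = (\<Sum>U\<in>Pow {..<n}. (2 ^ i) powr q * lev M (sgn_sum U n (\<lambda>k. f (\<kappa> k))) i powr a)" for i
    have A1: "A i \<le> 2 ^ n * (2 ^ i) powr q" for i
    proof -
      have "A i \<le> (\<Sum>U\<in>Pow {..<n}. (2 ^ i) powr q * 1)"
        unfolding A_def using a by (intro sum_mono mult_left_mono powr_le1) auto
      then show ?thesis by (simp add: card_Pow)
    qed
    have A2: "A i \<le> 2 ^ n * (K1 * 2 powr a * (real n powr a * Y i + (\<Sum>j\<le>i. t ^ (i - j) * \<rho> j)))" for i
    proof -
      have "A i \<le> 2 ^ n * (K1 * (\<Sum>j\<le>i. t ^ (i - j) * v j powr a))"
        using sgn_sum_level_le[OF p2, of i n \<kappa>]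
        by (simp add: A_def K1_def v_def[abs_def] a_def t_def s_def)
      also have "\<dots> \<le> 2 ^ n * (K1 * (\<Sum>j\<le>i. t ^ (i - j) * (2 powr a * (real n powr a * x' j + \<rho> j))))"
        using K1 t v by (intro mult_left_mono sum_mono) auto
      also have "(\<Sum>j\<le>i. t ^ (i - j) * (2 powr a * (real n powr a * x' j + \<rho> j)))
        = 2 powr a * (real n powr a * Y i + (\<Sum>j\<le>i. t ^ (i - j) * \<rho> j))"
        by (simp add: Y_def sum_distrib_left sum.distrib algebra_simps)
      finally show ?thesis by (simp add: mult.assoc)
    qed
    define B where "B = B0 + K1 * 2 powr a * (real n powr a * (1 / (4 * (K * K1 * 2 powr a + 1)))
      + \<eta> * real n powr a / (1 - t))"
    have "(\<Sum>U\<in>Pow {..<n}. level_sum p q M (sgn_sum U n (\<lambda>k. f (\<kappa> k))) I) \<le> 2 ^ n * B" for I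
    proof -
      have "(\<Sum>U\<in>Pow {..<n}. level_sum p q M (sgn_sum U n (\<lambda>k. f (\<kappa> k))) I)
        \<le> (\<Sum>U\<in>Pow {..<n}. level_sum p q M (sgn_sum U n (\<lambda>k. f (\<kappa> k))) (max I J))"
        by (intro sum_mono level_sum_mono) auto
      also have "\<dots> = (\<Sum>i<max I J. A i)"
        unfolding level_sum_def A_def a_def by (rule sum.swap)
      also have "\<dots> = (\<Sum>i<J. A i) + (\<Sum>i=J..<max I J. A i)"
        using sum.atLeastLessThan_concat[of 0 J "max I J" A] by (simp add: atLeast0LessThan)
      also have "\<dots> \<le> (\<Sum>i<J. 2 ^ n * (2 ^ i) powr q)
        + (\<Sum>i=J..<max I J. 2 ^ n * (K1 * 2 powr a * (real n powr a * Y i + (\<Sum>j\<le>i. t ^ (i - j) * \<rho> j))))"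
        by (intro add_mono sum_mono A1 A2)
      also have "\<dots> = 2 ^ n * (B0 + K1 * 2 powr a * (real n powr a * (\<Sum>i=J..<max I J. Y i)
          + (\<Sum>i=J..<max I J. \<Sum>j\<le>i. t ^ (i - j) * \<rho> j)))"
        by (simp add: B0_def sum_distrib_left[symmetric] sum.distrib distrib_left)
      also have "\<dots> \<le> 2 ^ n * B"
        unfolding B_def
      proof (intro mult_left_mono add_left_mono add_mono)
        show "(\<Sum>i=J..<max I J. Y i) \<le> 1 / (4 * (K * K1 * 2 powr a + 1))" by (rule J)
        have "(\<Sum>i=J..<max I J. \<Sum>j\<le>i. t ^ (i - j) * \<rho> j) \<le> (\<Sum>i<max I J. \<Sum>j\<le>i. t ^ (i - j) * \<rho> j)"
          using t \<rho>0 by (intro sum_mono2) (auto intro!: sum_nonneg mult_nonneg_nonneg)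
        also have "\<dots> \<le> (\<Sum>j<max I J. \<rho> j) / (1 - t)"
          using t \<rho>0 by (intro sum_convolution_le) auto
        also have "\<dots> \<le> \<eta> * real n powr a / (1 - t)" using t \<rho>s by (intro divide_right_mono) auto
        finally show "(\<Sum>i=J..<max I J. \<Sum>j\<le>i. t ^ (i - j) * \<rho> j) \<le> \<eta> * real n powr a / (1 - t)" .
      qed (use K1 in auto)
      finally show ?thesis .
    qed
    then have "real n powr a \<le> Kl * (1 + B)"
      unfolding a_def by (intro level_sum_lower_uniform[OF inj])
    also have "\<dots> \<le> K * (1 + B)"
    proof -
      have "0 \<le> B" unfolding B_def B0_def using K K1 P \<eta> t
        by (intro add_nonneg_nonneg mult_nonneg_nonneg sum_nonneg divide_nonneg_nonneg) auto
      then show ?thesis using K by (intro mult_right_mono) auto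
    qed
    also have "K * (1 + B) = K * (1 + B0) + K * K1 * 2 powr a * (real n powr a / (2 * (K * K1 * 2 powr a + 1)))"
    proof -
      have "\<eta> * real n powr a / (1 - t) = real n powr a * (1 / (4 * (K * K1 * 2 powr a + 1)))"
        using t by (simp add: \<eta>_def)
      moreover have "y * (1 / (4 * Q)) + y * (1 / (4 * Q)) = y / (2 * Q)" for y Q :: real by simp
      ultimately have "B = B0 + K1 * 2 powr a * (real n powr a / (2 * (K * K1 * 2 powr a + 1)))"
        unfolding B_def by presburger
      then show ?thesis by (simp only: distrib_left mult.assoc mult_1_right)
    qed
    also have "K * K1 * 2 powr a * (real n powr a / (2 * (K * K1 * 2 powr a + 1))) \<le> real n powr a / 2"
    proof -
      have "K * K1 * 2 powr a * real n powr a \<le> (K * K1 * 2 powr a + 1) * real n powr a"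
        by (intro mult_right_mono) auto
      then show ?thesis using P by (simp add: field_simps)
    qed
    finally show ?thesis by simp
  qed
  obtain n where "N \<le> n" "2 * K * (1 + B0) < real n powr a"
    using exists_powr_gt[OF a] by blast
  then show False using bound[of n] by simp
qed

section \<open>Limit profiles of the levels along a subsequence\<close>

lemma level_term_subsequence:
  obtains r l x where "strict_mono (r :: nat \<Rightarrow> nat)" "\<And>i. 0 \<le> (l i :: real)"
    "\<And>i. (\<lambda>k. lev M (f (r k)) i) \<longlonglongrightarrow> l i"
    "\<And>i. x i = (2 ^ i) powr q * l i powr (q/p)" "\<And>i. (\<lambda>k. level_term (r k) i) \<longlonglongrightarrow> x i"
    "\<And>i. 0 \<le> x i" "\<And>I. (\<Sum>i<I. x i) \<le> Ku" "summable x"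
proof -
  obtain r l where r: "strict_mono (r :: nat \<Rightarrow> nat)" and l: "\<And>i. (\<lambda>k. lev M (f (r k)) i) \<longlonglongrightarrow> l i"
    using convergent_levels by blast
  define x where "x i = (2 ^ i) powr q * l i powr (q/p)" for i
  have l0: "0 \<le> l i" for i by (rule LIMSEQ_le_const[OF l]) auto
  have level_term: "(\<lambda>k. level_term (r k) i) \<longlonglongrightarrow> x i" for i
    unfolding level_term_def x_def using exponent_pos l
    by (intro tendsto_mult tendsto_const tendsto_powr') auto
  have x0: "0 \<le> x i" for i by (simp add: x_def)
  have xs: "(\<Sum>i<I. x i) \<le> Ku" for I
    by (rule LIMSEQ_le_const2[OF tendsto_sum[OF level_term]]) (auto intro!: level_term_sum_le exI[of _ 0])
  have "summable x" by (rule summableI_nonneg_bounded[OF x0 xs])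
  then show ?thesis using that[OF r l0 l x_def level_term x0 xs] by blast
qed

text \<open>Pointwise convergence improves to convergence of the sums because
  \<open>uniform_tails\<close> controls the tails of all \<open>level_term k\<close> and, in the
  limit, that of \<open>x\<close>.\<close>

lemma level_term_l1_convergence:
  assumes qp: "q < p"
  obtains r x where "strict_mono (r :: nat \<Rightarrow> nat)" "\<And>i. 0 \<le> x i" "summable x"
    "\<And>d. 0 < d \<Longrightarrow> \<exists>k0. \<forall>k\<ge>k0. \<forall>J. (\<Sum>i<J. \<bar>level_term (r k) i - x i\<bar>) \<le> d"
proof -
  obtain r l x where r: "strict_mono (r :: nat \<Rightarrow> nat)" and level_term: "\<And>i. (\<lambda>k. level_term (r k) i) \<longlonglongrightarrow> x i"
    and x: "\<And>i. 0 \<le> x i" "summable x"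
    using level_term_subsequence by metis
  have "\<exists>k0. \<forall>k\<ge>k0. \<forall>J. (\<Sum>i<J. \<bar>level_term (r k) i - x i\<bar>) \<le> d" if d: "0 < d" for d
  proof -
    obtain I0 where I0: "\<And>k J. (\<Sum>i=I0..<J. level_term k i) \<le> d / 4"
      using uniform_tails[OF qp, of "d / 4"] d by auto
    have I0': "(\<Sum>i=I0..<J. x i) \<le> d / 4" for J
      by (rule LIMSEQ_le_const2[OF tendsto_sum[OF level_term]]) (use I0 in blast)
    have "(\<lambda>k. \<Sum>i<I0. \<bar>level_term (r k) i - x i\<bar>) \<longlonglongrightarrow> (\<Sum>i<I0. \<bar>x i - x i\<bar>)"
      by (intro tendsto_intros level_term)
    then have "eventually (\<lambda>k. (\<Sum>i<I0. \<bar>level_term (r k) i - x i\<bar>) < d / 2) sequentially"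
      using d by (intro order_tendstoD) auto
    then obtain k0 where k0: "\<And>k. k0 \<le> k \<Longrightarrow> (\<Sum>i<I0. \<bar>level_term (r k) i - x i\<bar>) < d / 2"
      by (auto simp: eventually_sequentially)
    have "(\<Sum>i<J. \<bar>level_term (r k) i - x i\<bar>) \<le> d" if k: "k0 \<le> k" for k J
    proof -
      have "(\<Sum>i<J. \<bar>level_term (r k) i - x i\<bar>) \<le> (\<Sum>i<max I0 J. \<bar>level_term (r k) i - x i\<bar>)"
        by (intro sum_mono2) auto
      also have "\<dots> = (\<Sum>i<I0. \<bar>level_term (r k) i - x i\<bar>) + (\<Sum>i=I0..<max I0 J. \<bar>level_term (r k) i - x i\<bar>)"
        using sum.atLeastLessThan_concat[of 0 I0 "max I0 J" "\<lambda>i. \<bar>level_term (r k) i - x i\<bar>"]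
        by (simp add: atLeast0LessThan)
      also have "(\<Sum>i=I0..<max I0 J. \<bar>level_term (r k) i - x i\<bar>) \<le> (\<Sum>i=I0..<max I0 J. level_term (r k) i + x i)"
        using x by (intro sum_mono) (auto simp: abs_le_iff)
      also have "\<dots> \<le> d / 4 + d / 4" unfolding sum.distrib by (intro add_mono I0 I0')
      finally show ?thesis using k0[OF k] by simp
    qed
    then show ?thesis by blast
  qed
  then show ?thesis using that[OF r x] by blast
qed

lemma scaled_lev_powr: "((2 ^ j) powr p * lev M (f k) j) powr (q/p) = level_term k j"
  using p_pos by (simp add: level_term_def powr_mult powr_powr)

text \<open>Starting the subsequence late enough makes each of the \<open>n\<close> vectors deviate
  from \<open>x\<close> by total mass at most \<open>\<eta> / n\<close>. The sum \<open>e\<close> of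
  the deviations dominates each of them and still has mass at most \<open>\<eta>\<close>.\<close>

lemma contradiction_q_less_p:
  assumes qp: "q < p" and p2: "p < 2"
  shows False
proof -
  obtain r x where r: "strict_mono (r :: nat \<Rightarrow> nat)" and x: "\<And>i. 0 \<le> x i" "summable x"
    and conv: "\<And>d. 0 < d \<Longrightarrow> \<exists>k0. \<forall>k\<ge>k0. \<forall>J. (\<Sum>i<J. \<bar>level_term (r k) i - x i\<bar>) \<le> d"
    by (rule level_term_l1_convergence[OF qp]) blast
  define a where "a = q/p"
  have a: "0 < a" using exponent_pos by (simp add: a_def)
  show False
  proof (rule contradiction_if_p_less_2[OF p2 x(2,1), of 1])
    fix \<eta> :: real assume \<eta>: "0 < \<eta>"
    show "\<exists>N. \<forall>n\<ge>N. \<exists>\<kappa> \<rho>. inj_on \<kappa> {..<n} \<and> (\<forall>j. 0 \<le> \<rho> j)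
      \<and> (\<forall>j. ((2 ^ j) powr p * (\<Sum>k<n. lev M (f (\<kappa> k)) j)) powr (q/p)
            \<le> 1 * real n powr (q/p) * x j + \<rho> j)
      \<and> (\<forall>J. (\<Sum>j<J. \<rho> j) \<le> \<eta> * real n powr (q/p))"
    proof (intro exI[of _ 1] allI impI)
      fix n :: nat assume n: "1 \<le> n"
      obtain k0 where k0: "\<And>k J. k0 \<le> k \<Longrightarrow> (\<Sum>i<J. \<bar>level_term (r k) i - x i\<bar>) \<le> \<eta> / n"
        using conv[of "\<eta> / n"] \<eta> n by auto
      define \<kappa> where "\<kappa> k = r (k0 + k)" for k
      define e where "e j = (\<Sum>k<n. \<bar>level_term (\<kappa> k) j - x j\<bar>)" for j
      have e0: "0 \<le> e j" for j by (auto simp: e_def intro!: sum_nonneg)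
      have inj: "inj_on \<kappa> {..<n}"
        using strict_mono_eq[OF r] by (auto simp: inj_on_def \<kappa>_def)
      have v: "((2 ^ j) powr p * (\<Sum>k<n. lev M (f (\<kappa> k)) j)) powr a \<le> real n powr a * (x j + e j)" for j
      proof -
        have "(2 ^ j) powr p * (\<Sum>k<n. lev M (f (\<kappa> k)) j) = (\<Sum>k<n. (2 ^ j) powr p * lev M (f (\<kappa> k)) j)"
          by (rule sum_distrib_left)
        also have "\<dots> \<le> (\<Sum>k<n. (x j + e j) powr (1 / a))"
        proof (intro sum_mono)
          fix k assume k: "k \<in> {..<n}"
          have "\<bar>level_term (\<kappa> k) j - x j\<bar> \<le> e j"
            unfolding e_def using k by (intro member_le_sum) auto
          then have "level_term (\<kappa> k) j \<le> x j + e j" by simp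
          then have "level_term (\<kappa> k) j powr (1 / a) \<le> (x j + e j) powr (1 / a)"
            using a by (intro powr_mono2) auto
          then show "(2 ^ j) powr p * lev M (f (\<kappa> k)) j \<le> (x j + e j) powr (1 / a)"
            using a by (simp add: powr_powr a_def[symmetric] flip: scaled_lev_powr)
        qed
        finally have "((2 ^ j) powr p * (\<Sum>k<n. lev M (f (\<kappa> k)) j)) powr a \<le> (n * (x j + e j) powr (1 / a)) powr a"
          using a by (intro powr_mono2 mult_nonneg_nonneg sum_nonneg) auto
        also have "\<dots> = real n powr a * (x j + e j)"
          using a x e0 by (simp add: powr_mult powr_powr)
        finally show ?thesis .
      qed
      have "(\<Sum>j<J. real n powr a * e j) \<le> \<eta> * real n powr a" for J
      proof -
        have "(\<Sum>j<J. e j) = (\<Sum>k<n. \<Sum>j<J. \<bar>level_term (\<kappa> k) j - x j\<bar>)" unfolding e_def by (rule sum.swap)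
        also have "\<dots> \<le> (\<Sum>k<n. \<eta> / n)" unfolding \<kappa>_def by (intro sum_mono k0) auto
        also have "\<dots> = \<eta>" using n by simp
        finally have "real n powr a * (\<Sum>j<J. e j) \<le> real n powr a * \<eta>" by (intro mult_left_mono) auto
        then show ?thesis by (simp only: sum_distrib_left mult.commute[of \<eta>])
      qed
      then show "\<exists>\<kappa> \<rho>. inj_on \<kappa> {..<n} \<and> (\<forall>j. 0 \<le> \<rho> j)
        \<and> (\<forall>j. ((2 ^ j) powr p * (\<Sum>k<n. lev M (f (\<kappa> k)) j)) powr (q/p)
              \<le> 1 * real n powr (q/p) * x j + \<rho> j)
        \<and> (\<forall>J. (\<Sum>j<J. \<rho> j) \<le> \<eta> * real n powr (q/p))"
        using inj v e0 unfolding a_def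
        by (intro exI[of _ \<kappa>] exI[of _ "\<lambda>j. real n powr (q/p) * e j"]) (auto simp: distrib_left)
    qed
  qed auto
qed

text \<open>A Banach--Saks argument by a gliding hump. The point is that the sum of the \<open>n\<close> deviations grows
  like \<open>n powr (1/a)\<close> with \<open>a = q/p\<close>, which is less than \<open>n\<close> for \<open>p < q\<close>.\<close>
lemma deviation_sums:
  assumes r: "strict_mono (r :: nat \<Rightarrow> nat)" and l0: "\<And>i. 0 \<le> l i"
    and l: "\<And>i. (\<lambda>k. lev M (f (r k)) i) \<longlonglongrightarrow> l i"
    and lX: "\<And>J. (\<Sum>j<J. (2 ^ j) powr q * l j powr (q/p)) \<le> Ku"
  shows "\<exists>\<kappa> V. inj_on \<kappa> {..<n} \<and> (\<forall>j. 0 \<le> V j)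
    \<and> (\<forall>j. (2 ^ j) powr p * (\<Sum>k<n. lev M (f (\<kappa> k)) j) \<le> real n * ((2 ^ j) powr p * l j) + V j)
    \<and> (\<forall>J. (\<Sum>j<J. V j powr (q/p)) \<le> real n * (1 + 2 powr (q/p) + 2 powr (q/p) * 2 powr (q/p) * 2 * Ku))"
proof (induction n)
  case 0
  show ?case by (intro exI[of _ "\<lambda>_. 0"]) auto
next
  case (Suc n)
  define a where "a = q/p"
  have a: "0 < a" using exponent_pos by (simp add: a_def)
  define C where "C = 1 + 2 powr a + 2 powr a * 2 powr a * 2 * Ku"
  define z where "z j = (2 ^ j) powr p * l j" for j
  define u where "u m j = (2 ^ j) powr p * \<bar>lev M (f (r m)) j - l j\<bar>" for m j
  obtain \<kappa> V where inj: "inj_on \<kappa> {..<n}" and V0: "\<And>j. 0 \<le> V j"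
    and V: "\<And>j. (2 ^ j) powr p * (\<Sum>k<n. lev M (f (\<kappa> k)) j) \<le> real n * z j + V j"
    and VC: "\<And>J. (\<Sum>j<J. V j powr a) \<le> real n * C"
    using Suc.IH unfolding a_def C_def z_def by blast
  have "summable (\<lambda>j. V j powr a)" by (rule summableI_nonneg_bounded[OF _ VC]) simp
  \<comment> \<open>Beyond \<open>J0\<close> the old deviations have mass at most \<open>1\<close>;
    the new vector is taken so far out that it adds less than \<open>1\<close> below
    \<open>J0\<close>. Beyond \<open>J0\<close> its own deviation is controlled by
    \<open>Ku\<close>. The increments \<open>1\<close> and
    \<open>2 powr a * (1 + 2 powr a * (Ku + Ku))\<close> make up \<open>C\<close>.\<close>
  then obtain J0 where J0: "\<And>J. (\<Sum>j=J0..<J. V j powr a) \<le> 1"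
    using summable_tail_le[of "\<lambda>j. V j powr a" 1] by auto
  have "(\<lambda>m. \<Sum>j<J0. (V j + u m j) powr a) \<longlonglongrightarrow> (\<Sum>j<J0. (V j + (2 ^ j) powr p * \<bar>l j - l j\<bar>) powr a)"
    unfolding u_def using a V0
    by (intro tendsto_sum tendsto_powr' tendsto_add tendsto_mult tendsto_const tendsto_rabs tendsto_diff l) auto
  then have "eventually (\<lambda>m. (\<Sum>j<J0. (V j + u m j) powr a) < (\<Sum>j<J0. V j powr a) + 1) sequentially"
    by (intro order_tendstoD) auto
  moreover have "eventually (\<lambda>m. Max (\<kappa> ` {..<n} \<union> {0}) < m) sequentially" by (rule eventually_gt_at_top)
  ultimately obtain m where m: "(\<Sum>j<J0. (V j + u m j) powr a) < (\<Sum>j<J0. V j powr a) + 1"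
    "Max (\<kappa> ` {..<n} \<union> {0}) < m"
    using eventually_happens[OF eventually_conj] by fastforce
  define \<kappa>' where "\<kappa>' = \<kappa>(n := r m)"
  have "\<kappa> k < r m" if "k < n" for k
  proof -
    have "\<kappa> k \<le> Max (\<kappa> ` {..<n} \<union> {0})" using that by (intro Max_ge) auto
    also have "\<dots> < m" by (rule m)
    also have "\<dots> \<le> r m" by (rule strict_mono_imp_increasing[OF r])
    finally show ?thesis .
  qed
  then have "\<forall>k<n. \<kappa> k \<noteq> r m" by (metis less_irrefl)
  then have inj': "inj_on \<kappa>' {..<Suc n}"
    using inj by (auto simp: \<kappa>'_def inj_on_def less_Suc_eq)
  have V': "(2 ^ j) powr p * (\<Sum>k<Suc n. lev M (f (\<kappa>' k)) j) \<le> real (Suc n) * z j + (V j + u m j)" for j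
  proof -
    have "(2 ^ j) powr p * (\<Sum>k<Suc n. lev M (f (\<kappa>' k)) j)
      = (2 ^ j) powr p * (\<Sum>k<n. lev M (f (\<kappa> k)) j) + (2 ^ j) powr p * lev M (f (r m)) j"
      by (simp add: \<kappa>'_def distrib_left)
    also have "(2 ^ j) powr p * lev M (f (r m)) j \<le> (2 ^ j) powr p * (l j + \<bar>lev M (f (r m)) j - l j\<bar>)"
      by (intro mult_left_mono) auto
    also have "\<dots> = z j + u m j" by (simp add: z_def u_def distrib_left)
    finally show ?thesis using V[of j] by (simp add: algebra_simps)
  qed
  have u: "u m j powr a \<le> 2 powr a * (level_term (r m) j + (2 ^ j) powr q * l j powr a)" for j
  proof -
    have "u m j powr a \<le> ((2 ^ j) powr p * lev M (f (r m)) j + (2 ^ j) powr p * l j) powr a"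
      using a l0[of j] unfolding u_def distrib_left[symmetric]
      by (intro powr_mono2 mult_left_mono) (auto simp: abs_le_iff)
    also have "\<dots> \<le> 2 powr a * (((2 ^ j) powr p * lev M (f (r m)) j) powr a + ((2 ^ j) powr p * l j) powr a)"
      using a l0 by (intro powr_add_le) auto
    also have "((2 ^ j) powr p * l j) powr a = (2 ^ j) powr q * l j powr a"
      using l0 p_pos by (simp add: powr_mult powr_powr a_def)
    finally show ?thesis by (simp add: a_def scaled_lev_powr)
  qed
  have "(\<Sum>j<J. (V j + u m j) powr a) \<le> real (Suc n) * C" for J
  proof -
    have "(\<Sum>j<J. (V j + u m j) powr a) \<le> (\<Sum>j<max J0 J. (V j + u m j) powr a)"
      by (intro sum_mono2) auto
    also have "\<dots> = (\<Sum>j<J0. (V j + u m j) powr a) + (\<Sum>j=J0..<max J0 J. (V j + u m j) powr a)"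
      using sum.atLeastLessThan_concat[of 0 J0 "max J0 J" "\<lambda>j. (V j + u m j) powr a"]
      by (simp add: atLeast0LessThan)
    also have "(\<Sum>j=J0..<max J0 J. (V j + u m j) powr a)
      \<le> (\<Sum>j=J0..<max J0 J. 2 powr a * (V j powr a + 2 powr a * (level_term (r m) j + (2 ^ j) powr q * l j powr a)))"
    proof (intro sum_mono)
      fix j
      have "(V j + u m j) powr a \<le> 2 powr a * (V j powr a + u m j powr a)"
        using V0 a by (intro powr_add_le) (auto simp: u_def)
      also have "\<dots> \<le> 2 powr a * (V j powr a + 2 powr a * (level_term (r m) j + (2 ^ j) powr q * l j powr a))"
        by (intro mult_left_mono add_left_mono u) auto
      finally show "(V j + u m j) powr a
        \<le> 2 powr a * (V j powr a + 2 powr a * (level_term (r m) j + (2 ^ j) powr q * l j powr a))" .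
    qed
    also have "\<dots> = 2 powr a * ((\<Sum>j=J0..<max J0 J. V j powr a)
      + 2 powr a * ((\<Sum>j=J0..<max J0 J. level_term (r m) j) + (\<Sum>j=J0..<max J0 J. (2 ^ j) powr q * l j powr a)))"
      by (simp only: sum_distrib_left[symmetric] sum.distrib)
    also have "\<dots> \<le> 2 powr a * (1 + 2 powr a * (Ku + Ku))"
    proof (intro mult_left_mono add_mono J0)
      have "(\<Sum>j=J0..<max J0 J. level_term (r m) j) \<le> (\<Sum>j<max J0 J. level_term (r m) j)" by (intro sum_mono2) auto
      then show "(\<Sum>j=J0..<max J0 J. level_term (r m) j) \<le> Ku" using level_term_sum_le[of "r m" "max J0 J"] by simp
      have "(\<Sum>j=J0..<max J0 J. (2 ^ j) powr q * l j powr a) \<le> (\<Sum>j<max J0 J. (2 ^ j) powr q * l j powr a)"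
        by (intro sum_mono2) auto
      then show "(\<Sum>j=J0..<max J0 J. (2 ^ j) powr q * l j powr a) \<le> Ku"
        using lX[of "max J0 J"] by (simp add: a_def)
    qed auto
    finally show ?thesis using m(1) VC[of J0] by (simp add: C_def algebra_simps)
  qed
  moreover have "0 \<le> V j + u m j" for j using V0 by (simp add: u_def)
  ultimately show ?case using inj' V'
    unfolding a_def C_def z_def by (intro exI[of _ \<kappa>'] exI[of _ "\<lambda>j. V j + u m j"]) blast
qed

text \<open>The deviations have mass at most \<open>real n * C\<close>, negligible against
  \<open>real n powr a\<close> because \<open>a > 1\<close>. The factor \<open>2 powr a\<close> at
  the profile is the price of separating it from the deviations under the power.\<close>

lemma contradiction_p_less_q:
  assumes pq: "p < q" and p2: "p < 2"
  shows False
proof -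
  obtain r l x where r: "strict_mono (r :: nat \<Rightarrow> nat)" and l0: "\<And>i. 0 \<le> l i"
    and l: "\<And>i. (\<lambda>k. lev M (f (r k)) i) \<longlonglongrightarrow> l i"
    and x_def: "\<And>i. x i = (2 ^ i) powr q * l i powr (q/p)"
    and x: "\<And>i. 0 \<le> x i" "\<And>I. (\<Sum>i<I. x i) \<le> Ku" "summable x"
    using level_term_subsequence by metis
  define a where "a = q/p"
  have a: "0 < a" "1 < a" using exponent_pos pq p_pos by (auto simp: a_def)
  define C where "C = 1 + 2 powr a + 2 powr a * 2 powr a * 2 * Ku"
  show False
  proof (rule contradiction_if_p_less_2[OF p2 x(3,1), of "2 powr a"])
    fix \<eta> :: real assume \<eta>: "0 < \<eta>"
    have "((\<lambda>n. 2 powr a * C * real n powr (1 - a)) \<longlongrightarrow> 2 powr a * C * 0) sequentially"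
      using a by (intro tendsto_mult tendsto_const tendsto_neg_powr filterlim_real_sequentially) auto
    then have "eventually (\<lambda>n. 2 powr a * C * real n powr (1 - a) < \<eta>) sequentially"
      using \<eta> by (intro order_tendstoD) auto
    then obtain N where N: "\<And>n. N \<le> n \<Longrightarrow> 2 powr a * C * real n powr (1 - a) < \<eta>"
      by (auto simp: eventually_sequentially)
    show "\<exists>N. \<forall>n\<ge>N. \<exists>\<kappa> \<rho>. inj_on \<kappa> {..<n} \<and> (\<forall>j. 0 \<le> \<rho> j)
      \<and> (\<forall>j. ((2 ^ j) powr p * (\<Sum>k<n. lev M (f (\<kappa> k)) j)) powr (q/p)
            \<le> 2 powr a * real n powr (q/p) * x j + \<rho> j)
      \<and> (\<forall>J. (\<Sum>j<J. \<rho> j) \<le> \<eta> * real n powr (q/p))"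
    proof (intro exI[of _ "max N 1"] allI impI)
      fix n :: nat assume n: "max N 1 \<le> n"
      obtain \<kappa> V where inj: "inj_on \<kappa> {..<n}" and V0: "\<And>j. 0 \<le> V j"
        and V: "\<And>j. (2 ^ j) powr p * (\<Sum>k<n. lev M (f (\<kappa> k)) j) \<le> real n * ((2 ^ j) powr p * l j) + V j"
        and VC: "\<And>J. (\<Sum>j<J. V j powr a) \<le> real n * C"
        using deviation_sums[OF r l0 l x(2)[unfolded x_def], of n] unfolding a_def C_def by blast
      have v: "((2 ^ j) powr p * (\<Sum>k<n. lev M (f (\<kappa> k)) j)) powr a
        \<le> 2 powr a * real n powr a * x j + 2 powr a * V j powr a" for j
      proof -
        have "((2 ^ j) powr p * (\<Sum>k<n. lev M (f (\<kappa> k)) j)) powr a \<le> (real n * ((2 ^ j) powr p * l j) + V j) powr a"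
          using a V by (intro powr_mono2 mult_nonneg_nonneg sum_nonneg) auto
        also have "\<dots> \<le> 2 powr a * ((real n * ((2 ^ j) powr p * l j)) powr a + V j powr a)"
          using a V0 l0 by (intro powr_add_le) auto
        also have "(real n * ((2 ^ j) powr p * l j)) powr a = real n powr a * x j"
          using l0 p_pos by (simp add: powr_mult powr_powr a_def x_def)
        finally show ?thesis by (simp add: algebra_simps)
      qed
      have s: "(\<Sum>j<J. 2 powr a * V j powr a) \<le> \<eta> * real n powr a" for J
      proof -
        have "(\<Sum>j<J. 2 powr a * V j powr a) = 2 powr a * (\<Sum>j<J. V j powr a)" by (rule sum_distrib_left[symmetric])
        also have "\<dots> \<le> 2 powr a * (real n * C)" by (intro mult_left_mono VC) auto
        also have "\<dots> = 2 powr a * C * real n powr (1 - a) * real n powr a"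
          using n by (simp flip: powr_add)
        also have "\<dots> \<le> \<eta> * real n powr a" using N[of n] n by (intro mult_right_mono) auto
        finally show ?thesis .
      qed
      show "\<exists>\<kappa> \<rho>. inj_on \<kappa> {..<n} \<and> (\<forall>j. 0 \<le> \<rho> j)
        \<and> (\<forall>j. ((2 ^ j) powr p * (\<Sum>k<n. lev M (f (\<kappa> k)) j)) powr (q/p)
              \<le> 2 powr a * real n powr (q/p) * x j + \<rho> j)
        \<and> (\<forall>J. (\<Sum>j<J. \<rho> j) \<le> \<eta> * real n powr (q/p))"
        using inj v s unfolding a_def
        by (intro exI[of _ \<kappa>] exI[of _ "\<lambda>j. 2 powr (q/p) * V j powr (q/p)"]) auto
    qed
  qed auto
qed

end

subsection \<open>The case p > 2\<close>

text \<open>An identity rather than an upper bound, since it serves to bound the averaged second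
  moment from below.\<close>

lemma parallelogram_sgn_sum:
  fixes g :: "nat \<Rightarrow> 'b \<Rightarrow> 'k::real_inner"
  shows "(\<Sum>U\<in>Pow {..<n}. (norm (sgn_sum U n g x))\<^sup>2) = 2 ^ n * (\<Sum>k<n. (norm (g k x))\<^sup>2)"
proof (induction n)
  case (Suc n)
  have "(\<Sum>U\<in>Pow {..<Suc n}. (norm (sgn_sum U (Suc n) g x))\<^sup>2)
    = (\<Sum>U\<in>Pow {..<n}. (norm (sgn_sum U (Suc n) g x))\<^sup>2 + (norm (sgn_sum (insert n U) (Suc n) g x))\<^sup>2)"
    by (rule sum_Pow_lessThan_Suc)
  also have "\<dots> = (\<Sum>U\<in>Pow {..<n}. 2 * (norm (sgn_sum U n g x))\<^sup>2 + 2 * (norm (g n x))\<^sup>2)"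
  proof (intro sum.cong refl)
    fix U assume "U \<in> Pow {..<n}"
    then have U: "n \<notin> U" by auto
    have "sgn_sum (insert n U) n g x = sgn_sum U n g x"
      unfolding sgn_sum_def by (intro sum.cong) (auto simp: sgn_of_def)
    then have "sgn_sum U (Suc n) g x = sgn_sum U n g x - g n x"
      "sgn_sum (insert n U) (Suc n) g x = sgn_sum U n g x + g n x"
      using U by (simp_all add: sgn_sum_def sgn_of_def)
    then show "(norm (sgn_sum U (Suc n) g x))\<^sup>2 + (norm (sgn_sum (insert n U) (Suc n) g x))\<^sup>2
      = 2 * (norm (sgn_sum U n g x))\<^sup>2 + 2 * (norm (g n x))\<^sup>2"
      by (simp add: power2_norm_eq_inner inner_add_left inner_add_right inner_diff_left inner_diff_right inner_commute)
  qed
  also have "\<dots> = 2 ^ Suc n * (\<Sum>k<Suc n. (norm (g k x))\<^sup>2)"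
    using Suc by (simp add: sum.distrib card_Pow algebra_simps flip: sum_distrib_left)
  finally show ?case .
qed (simp add: sgn_sum_def)

context prob_space
begin

text \<open>Stated for the nonnegative integral because finiteness of the second moment is not known
  beforehand.\<close>

lemma nn_integral_sq_le:
  fixes h :: "'a \<Rightarrow> 'k::{real_normed_vector, second_countable_topology}"
  assumes [measurable]: "h \<in> borel_measurable M"
  shows "(\<integral>\<^sup>+ x. ennreal ((norm (h x))\<^sup>2) \<partial>M)
    \<le> ennreal (4 ^ J) + (\<Sum>m. ennreal (4 ^ Suc (J + m) * lev M h (J + m)))"
proof -
  define A where "A m = {x \<in> space M. 2 ^ m < norm (h x)}" for m :: nat
  have [measurable]: "A m \<in> sets M" for m unfolding A_def by measurable
  have "(\<integral>\<^sup>+ x. ennreal ((norm (h x))\<^sup>2) \<partial>M)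
    \<le> (\<integral>\<^sup>+ x. ennreal (4 ^ J) + (\<Sum>m. ennreal (4 ^ Suc (J + m)) * indicator (A (J + m)) x) \<partial>M)"
  proof (intro nn_integral_mono)
    fix x assume x: "x \<in> space M"
    show "ennreal ((norm (h x))\<^sup>2)
      \<le> ennreal (4 ^ J) + (\<Sum>m. ennreal (4 ^ Suc (J + m)) * indicator (A (J + m)) x)"
    proof (cases "norm (h x) \<le> 2 ^ J")
      case True
      then have "(norm (h x))\<^sup>2 \<le> 4 ^ J" by (simp add: four_power_eq power_mono)
      then have "ennreal ((norm (h x))\<^sup>2) \<le> ennreal (4 ^ J)" by (rule ennreal_leI)
      then show ?thesis by (rule add_increasing2[OF zero_le])
    next
      case False
      obtain m where m: "norm (h x) < 2 ^ m" using real_arch_pow[of 2 "norm (h x)"] by auto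
      then have "(2::real) ^ J < 2 ^ m" using False by linarith
      then have Jm: "J \<le> m" by simp
      have "(norm (h x))\<^sup>2 \<le> (\<Sum>l=J..<m. 4 ^ Suc l * (if 2 ^ l < norm (h x) then 1 else 0))"
        using band_sq_le_sum[OF Jm, of "norm (h x)"] False m by simp
      also have "\<dots> = (\<Sum>l<m - J. 4 ^ Suc (J + l) * indicator (A (J + l)) x)"
        unfolding sum.atLeastLessThan_shift_0[of _ J m] atLeast0LessThan o_def
        using x by (intro sum.cong refl) (simp add: A_def)
      finally have "ennreal ((norm (h x))\<^sup>2) \<le> ennreal (\<Sum>l<m - J. 4 ^ Suc (J + l) * indicator (A (J + l)) x)"
        by (rule ennreal_leI)
      also have "\<dots> = (\<Sum>l<m - J. ennreal (4 ^ Suc (J + l) * indicator (A (J + l)) x))"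
        by (intro sum_ennreal[symmetric]) auto
      also have "\<dots> = (\<Sum>l<m - J. ennreal (4 ^ Suc (J + l)) * indicator (A (J + l)) x)"
        by (intro sum.cong) (auto split: split_indicator)
      also have "\<dots> \<le> (\<Sum>l. ennreal (4 ^ Suc (J + l)) * indicator (A (J + l)) x)"
        by (intro sum_le_suminf) auto
      finally show ?thesis by (rule add_increasing[OF zero_le])
    qed
  qed
  also have "\<dots> = ennreal (4 ^ J) + (\<Sum>m. ennreal (4 ^ Suc (J + m)) * emeasure M (A (J + m)))"
    by (subst nn_integral_add) (auto simp: nn_integral_suminf emeasure_space_1 nn_integral_cmult_indicator)
  also have "\<dots> = ennreal (4 ^ J) + (\<Sum>m. ennreal (4 ^ Suc (J + m) * lev M h (J + m)))"
    by (simp add: A_def lev_def emeasure_eq_measure ennreal_mult')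
  finally show ?thesis .
qed

end

context lorentz_basis
begin

text \<open>A single summand of \<open>level_sum\<close> already gives this weak-type bound of order
  \<open>p\<close>.\<close>

lemma lev_sgn_sum_le:
  assumes "inj_on \<kappa> {..<n}"
  shows "lev M (sgn_sum U n (\<lambda>k. f (\<kappa> k))) m \<le> Ku powr (p/q) * real n / (2 ^ m) powr p"
proof -
  define D where "D = lev M (sgn_sum U n (\<lambda>k. f (\<kappa> k))) m"
  have "(2 ^ m) powr q * D powr (q/p) \<le> level_sum p q M (sgn_sum U n (\<lambda>k. f (\<kappa> k))) (Suc m)"
    unfolding level_sum_def D_def by (intro member_le_sum) auto
  also have "\<dots> \<le> Ku * real n powr (q/p)" by (rule upper_sgn_sum[OF assms])
  finally have "((2 ^ m) powr q * D powr (q/p)) powr (p/q) \<le> (Ku * real n powr (q/p)) powr (p/q)"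
    using p_pos q_pos by (intro powr_mono2) auto
  then have "(2 ^ m) powr p * D \<le> Ku powr (p/q) * real n"
    using p_pos q_pos Ku_nonneg by (simp add: powr_mult powr_powr D_def)
  then show ?thesis by (simp add: D_def field_simps)
qed

text \<open>If all \<open>f k\<close> were large in measure, the parallelogram law would push the
  averaged second moment of \<open>n\<close> signed summands above \<open>n * \<epsilon>\<close>.
  For \<open>p > 2\<close> the weak-type bound leaves a geometric tail of ratio
  \<open>2 powr (2 - p)\<close> above level \<open>J\<close>: first \<open>J\<close> makes it at
  most \<open>n * (\<epsilon> / 2)\<close> for every \<open>n\<close>, then \<open>n\<close> is
  chosen to beat \<open>4 ^ J\<close>.\<close>

lemma exists_small_level:
  assumes p2: "2 < p" and \<epsilon>: "0 < \<epsilon>"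
  shows "\<exists>k. lev M (f k) 0 \<le> \<epsilon>"
proof (rule ccontr)
  assume "\<not> ?thesis"
  then have big: "\<epsilon> < lev M (f k) 0" for k by (auto simp: not_le)
  define t where "t = (2::real) powr (2 - p)"
  define c where "c = 4 * Ku powr (p/q)"
  have t: "0 < t" "t < 1" using p2 by (auto simp: t_def powr_less_one)
  have "(\<lambda>J. c * (t ^ J / (1 - t))) \<longlonglongrightarrow> c * (0 / (1 - t))"
    using t by (intro tendsto_intros LIMSEQ_realpow_zero) auto
  then have "eventually (\<lambda>J. c * (t ^ J / (1 - t)) < \<epsilon> / 2) sequentially"
    using \<epsilon> by (intro order_tendstoD) auto
  then obtain J where J: "c * (t ^ J / (1 - t)) < \<epsilon> / 2" by (auto simp: eventually_sequentially)
  obtain n :: nat where n: "4 ^ J / (\<epsilon> / 2) < real n" using reals_Archimedean2 by blast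
  have \<epsilon>n: "4 ^ J < real n * (\<epsilon> / 2)" using n \<epsilon> by (simp add: field_simps)
  define S where "S U = sgn_sum U n f" for U
  have summand: "4 ^ Suc m * lev M (S U) m \<le> n * c * t ^ m" for U m
  proof -
    have "t ^ m = (2 ^ m) powr (2 - p)" by (induction m) (auto simp: t_def powr_mult)
    also have "\<dots> = 4 ^ m / (2 ^ m) powr p" by (simp add: powr_diff four_power_eq)
    finally have tm: "t ^ m = 4 ^ m / (2 ^ m) powr p" .
    have "4 ^ Suc m * lev M (S U) m \<le> 4 ^ Suc m * (Ku powr (p/q) * real n / (2 ^ m) powr p)"
      using lev_sgn_sum_le[of "\<lambda>k. k" n U m] by (intro mult_left_mono) (auto simp: S_def)
    also have "\<dots> = n * c * t ^ m" by (simp add: c_def tm)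
    finally show ?thesis .
  qed
  have int: "(\<integral>\<^sup>+ x. ennreal ((norm (S U x))\<^sup>2) \<partial>M) \<le> ennreal (real n * \<epsilon>)" for U
  proof -
    have "(\<integral>\<^sup>+ x. ennreal ((norm (S U x))\<^sup>2) \<partial>M)
      \<le> ennreal (4 ^ J) + (\<Sum>m. ennreal (4 ^ Suc (J + m) * lev M (S U) (J + m)))"
      by (rule nn_integral_sq_le) (simp add: S_def)
    also have "\<dots> \<le> ennreal (4 ^ J) + ennreal (n * (c * (t ^ J / (1 - t))))"
    proof (intro add_left_mono suminf_le_const summableI)
      fix I
      have "(\<Sum>m<I. 4 ^ Suc (J + m) * lev M (S U) (J + m)) \<le> (\<Sum>m<I. n * c * t ^ (J + m))"
        by (intro sum_mono summand)
      also have "(\<Sum>m<I. n * c * t ^ (J + m)) = n * c * t ^ J * (\<Sum>m<I. t ^ m)"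
        by (simp add: sum_distrib_left power_add mult.assoc)
      also have "\<dots> \<le> n * c * t ^ J * (1 / (1 - t))"
      proof (intro mult_left_mono)
        have "(\<Sum>m<I. t ^ m) \<le> (\<Sum>m. t ^ m)" using t by (intro sum_le_suminf summable_geometric) auto
        then show "(\<Sum>m<I. t ^ m) \<le> 1 / (1 - t)" using t by (simp add: suminf_geometric)
      qed (use t in \<open>auto simp: c_def\<close>)
      finally have "(\<Sum>m<I. 4 ^ Suc (J + m) * lev M (S U) (J + m)) \<le> n * (c * (t ^ J / (1 - t)))"
        by (simp add: mult.assoc)
      then have "ennreal (\<Sum>m<I. 4 ^ Suc (J + m) * lev M (S U) (J + m)) \<le> ennreal (n * (c * (t ^ J / (1 - t))))"
        by (rule ennreal_leI)
      then show "(\<Sum>m<I. ennreal (4 ^ Suc (J + m) * lev M (S U) (J + m))) \<le> ennreal (n * (c * (t ^ J / (1 - t))))"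
        by (subst sum_ennreal) auto
    qed
    also have "\<dots> = ennreal (4 ^ J + n * (c * (t ^ J / (1 - t))))"
      using t by (intro ennreal_plus[symmetric]) (auto simp: c_def)
    also have "\<dots> \<le> ennreal (real n * \<epsilon>)"
    proof (intro ennreal_leI)
      have "n * (c * (t ^ J / (1 - t))) \<le> n * (\<epsilon> / 2)" using J by (intro mult_left_mono) auto
      moreover have "real n * \<epsilon> = real n * (\<epsilon> / 2) + real n * (\<epsilon> / 2)" by simp
      ultimately show "4 ^ J + n * (c * (t ^ J / (1 - t))) \<le> real n * \<epsilon>" using \<epsilon>n by linarith
    qed
    finally show ?thesis .
  qed
  have n0: "0 < n" using n \<epsilon> by (intro gr0I) (auto simp: field_simps not_less)
  have "ennreal (2 ^ n * (\<Sum>k<n. lev M (f k) 0)) = ennreal (2 ^ n) * (\<Sum>k<n. ennreal (lev M (f k) 0))"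
    by (simp add: ennreal_mult' sum_nonneg)
  also have "\<dots> \<le> ennreal (2 ^ n) * (\<Sum>k<n. \<integral>\<^sup>+ x. ennreal ((norm (f k x))\<^sup>2) \<partial>M)"
  proof (intro mult_left_mono sum_mono)
    fix k
    have "ennreal (lev M (f k) 0) = (\<integral>\<^sup>+ x. indicator {x \<in> space M. 2 ^ 0 < norm (f k x)} x \<partial>M)"
      by (subst nn_integral_indicator) (auto simp: lev_def emeasure_eq_measure)
    also have "\<dots> \<le> (\<integral>\<^sup>+ x. ennreal ((norm (f k x))\<^sup>2) \<partial>M)"
      by (intro nn_integral_mono) (auto split: split_indicator simp: one_le_power less_imp_le simp flip: ennreal_1 intro!: ennreal_leI)
    finally show "ennreal (lev M (f k) 0) \<le> (\<integral>\<^sup>+ x. ennreal ((norm (f k x))\<^sup>2) \<partial>M)" .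
  qed auto
  also have "\<dots> = (\<integral>\<^sup>+ x. ennreal (2 ^ n * (\<Sum>k<n. (norm (f k x))\<^sup>2)) \<partial>M)"
    by (simp add: ennreal_mult' sum_nonneg nn_integral_cmult nn_integral_sum flip: sum_ennreal)
  also have "\<dots> = (\<integral>\<^sup>+ x. (\<Sum>U\<in>Pow {..<n}. ennreal ((norm (S U x))\<^sup>2)) \<partial>M)"
    by (simp add: S_def parallelogram_sgn_sum sum_ennreal)
  also have "\<dots> = (\<Sum>U\<in>Pow {..<n}. \<integral>\<^sup>+ x. ennreal ((norm (S U x))\<^sup>2) \<partial>M)"
    unfolding S_def by (intro nn_integral_sum) measurable
  also have "\<dots> \<le> (\<Sum>U\<in>Pow {..<n}. ennreal (real n * \<epsilon>))"
    by (intro sum_mono int)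
  also have "\<dots> = ennreal (2 ^ n * (real n * \<epsilon>))"
    using \<epsilon> by (subst sum_ennreal) (auto simp: card_Pow)
  finally have "(\<Sum>k<n. lev M (f k) 0) \<le> real n * \<epsilon>"
    using \<epsilon> by (subst (asm) ennreal_le_iff) auto
  moreover have "(\<Sum>k<n. \<epsilon>) < (\<Sum>k<n. lev M (f k) 0)"
    using n0 big by (intro sum_strict_mono) auto
  ultimately show False by simp
qed

text \<open>The low levels of a suitable \<open>f k\<close> are small since it is small in measure,
  the high ones by \<open>uniform_tails\<close>, so its level sum is at most \<open>1\<close>.
  Because of the additive \<open>1\<close> in \<open>lower\<close> this only restricts
  \<open>Kl\<close> and is not yet contradictory.\<close>

lemma one_le_twice_lower_const:
  assumes qp: "q < p" and p2: "2 < p"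
  shows "1 \<le> 2 * Kl"
proof -
  define a where "a = q/p"
  have a: "0 < a" using exponent_pos by (simp add: a_def)
  obtain I0 where I0: "\<And>k J. (\<Sum>i=I0..<J. level_term k i) \<le> 1 / 2"
    using uniform_tails[OF qp, of "1 / 2"] by auto
  define R where "R = (\<Sum>i<I0. (2 ^ i) powr q) + 1"
  have R: "1 \<le> R" by (auto simp: R_def intro!: sum_nonneg)
  define \<epsilon> where "\<epsilon> = (1 / (2 * R)) powr (1 / a)"
  have \<epsilon>: "0 < \<epsilon>" using R by (simp add: \<epsilon>_def)
  obtain k where k: "lev M (f k) 0 \<le> \<epsilon>" using exists_small_level[OF p2 \<epsilon>] by blast
  have "(\<Sum>i<I0. level_term k i) \<le> (\<Sum>i<I0. (2 ^ i) powr q * (1 / (2 * R)))"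
  proof (intro sum_mono)
    fix i
    have "lev M (f k) i \<le> \<epsilon>" using lev_antimono[OF f_measurable, of 0 i k] k by simp
    then have "lev M (f k) i powr a \<le> \<epsilon> powr a" using a by (intro powr_mono2) auto
    also have "\<dots> = 1 / (2 * R)" using a R by (simp add: \<epsilon>_def powr_powr)
    finally show "level_term k i \<le> (2 ^ i) powr q * (1 / (2 * R))"
      unfolding level_term_def a_def[symmetric] by (intro mult_left_mono) auto
  qed
  also have "\<dots> = (R - 1) * (1 / (2 * R))"
  proof -
    have R1: "R - 1 = (\<Sum>i<I0. (2 ^ i) powr q)" by (simp add: R_def)
    show ?thesis by (simp only: R1 sum_distrib_right)
  qed
  also have "\<dots> \<le> 1 / 2" using R by (simp add: field_simps)
  finally have head: "(\<Sum>i<I0. level_term k i) \<le> 1 / 2" .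
  have "level_sum p q M (\<lambda>x. \<Sum>j<(1::nat). 1 *\<^sub>R f k x) I \<le> 1" for I
  proof -
    have "level_sum p q M (\<lambda>x. \<Sum>j<(1::nat). 1 *\<^sub>R f k x) I = (\<Sum>i<I. level_term k i)"
      by (simp add: level_sum_def level_term_def)
    also have "\<dots> \<le> (\<Sum>i<max I0 I. level_term k i)" by (intro sum_mono2) auto
    also have "\<dots> = (\<Sum>i<I0. level_term k i) + (\<Sum>i=I0..<max I0 I. level_term k i)"
      using sum.atLeastLessThan_concat[of 0 I0 "max I0 I" "level_term k"] by (simp add: atLeast0LessThan)
    also have "\<dots> \<le> 1 / 2 + 1 / 2" by (intro add_mono head I0)
    finally show ?thesis by simp
  qed
  then show ?thesis
    using lower[of "\<lambda>_. k" 1 "\<lambda>_. 1" "\<lambda>_. 1" 1] by (simp add: inj_on_def)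
qed

text \<open>Enlarging the functions divides \<open>Kl\<close> by \<open>s powr q\<close>, which
  overcomes the additive \<open>1\<close> in \<open>lower\<close>.\<close>

lemma scaled:
  assumes s: "0 < s"
  shows "lorentz_basis M p q (Ku * s powr q) (Kl / s powr q) (\<lambda>k x. s *\<^sub>R f k x)"
proof unfold_locales
  show "0 < p" "0 < q" "\<And>k. (\<lambda>x. s *\<^sub>R f k x) \<in> borel_measurable M"
    using p_pos q_pos by auto
next
  fix \<kappa> :: "nat \<Rightarrow> nat" and n :: nat and c :: "nat \<Rightarrow> real" and s' :: real and I
  assume *: "inj_on \<kappa> {..<n}" "0 < s'" "\<And>k. k < n \<Longrightarrow> \<bar>c k\<bar> \<le> s'"
  have "level_sum p q M (\<lambda>x. \<Sum>k<n. (c k * s) *\<^sub>R f (\<kappa> k) x) I \<le> Ku * ((s' * s) powr q * real n powr (q/p))"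
    using * s by (intro upper) (auto simp: abs_mult)
  then show "level_sum p q M (\<lambda>x. \<Sum>k<n. c k *\<^sub>R s *\<^sub>R f (\<kappa> k) x) I \<le> Ku * s powr q * (s' powr q * real n powr (q/p))"
    using * s by (simp add: powr_mult ac_simps)
next
  fix \<kappa> :: "nat \<Rightarrow> nat" and n :: nat and c w :: "nat \<Rightarrow> real" and B
  assume *: "inj_on \<kappa> {..<n}" "\<And>k. k < n \<Longrightarrow> 0 \<le> w k \<and> w k \<le> \<bar>c k\<bar>"
    "\<And>j k. j \<le> k \<Longrightarrow> k < n \<Longrightarrow> w k \<le> w j"
    "\<And>I. level_sum p q M (\<lambda>x. \<Sum>k<n. c k *\<^sub>R s *\<^sub>R f (\<kappa> k) x) I \<le> B"
  have "(\<Sum>k<n. (s * w k) powr q * (real (Suc k) powr (q/p) - real k powr (q/p))) \<le> Kl * (1 + B)"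
    using * s by (intro lower[of \<kappa> n _ "\<lambda>k. c k * s"]) (auto simp: abs_mult mult.commute[of s] mult_right_mono)
  moreover have "(\<Sum>k<n. (s * w k) powr q * (real (Suc k) powr (q/p) - real k powr (q/p)))
    = s powr q * (\<Sum>k<n. w k powr q * (real (Suc k) powr (q/p) - real k powr (q/p)))"
    using * s unfolding sum_distrib_left by (intro sum.cong) (auto simp: powr_mult)
  ultimately show "(\<Sum>k<n. w k powr q * (real (Suc k) powr (q/p) - real k powr (q/p))) \<le> Kl / s powr q * (1 + B)"
    using s by (simp add: field_simps)
qed

lemma contradiction_p_greater_2:
  assumes qp: "q < p" and p2: "2 < p"
  shows False
proof -
  \<comment> \<open>Chosen so that \<open>2 * (Kl / s powr q) < 1\<close>, whatever the sign of
    \<open>Kl\<close>.\<close>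
  define s where "s = (2 * \<bar>Kl\<bar> + 1) powr (1 / q)"
  have s: "0 < s" by (simp add: s_def)
  have "s powr q = 2 * \<bar>Kl\<bar> + 1" using q_pos by (simp add: s_def powr_powr)
  moreover have "1 \<le> 2 * (Kl / s powr q)"
    by (rule lorentz_basis.one_le_twice_lower_const[OF scaled[OF s] qp p2])
  ultimately show False by (simp add: field_simps)
qed

end

subsection \<open>The case p = 2\<close>

definition log4 :: "nat \<Rightarrow> nat" where
  "log4 k = (LEAST j. k < 4 ^ j)"

lemma log4_less: "k < 4 ^ log4 k"
proof -
  have "k < 4 ^ k" by (rule less_le_trans[OF less_exp]) (simp add: power_mono)
  then show ?thesis unfolding log4_def by (rule LeastI)
qed

lemma log4_le: "k < 4 ^ j \<Longrightarrow> log4 k \<le> j"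
  unfolding log4_def by (rule Least_le)

lemma log4_mono: "j \<le> k \<Longrightarrow> log4 j \<le> log4 k"
  using log4_less[of k] by (intro log4_le) simp

lemma log4_eq_Suc: "4 ^ j \<le> k \<Longrightarrow> k < 4 ^ Suc j \<Longrightarrow> log4 k = Suc j"
proof (rule antisym)
  assume k: "4 ^ j \<le> k"
  show "Suc j \<le> log4 k"
  proof (rule ccontr)
    assume "\<not> ?thesis"
    then have "(4::nat) ^ log4 k \<le> 4 ^ j" by (intro power_increasing) auto
    then show False using k log4_less[of k] by linarith
  qed
qed (rule log4_le)

text \<open>On a block \<open>4 ^ j \<le> k < 4 ^ Suc j\<close> the function \<open>log4\<close> is
  constant and the increments of \<open>W\<close> telescope; the index \<open>0\<close> forms a
  block of its own.\<close>

lemma sum_log4: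
  fixes F :: "nat \<Rightarrow> real" and W :: "nat \<Rightarrow> real"
  shows "(\<Sum>k<4 ^ L. F (log4 k) * (W (Suc k) - W k))
    = F 0 * (W 1 - W 0) + (\<Sum>j<L. F (Suc j) * (W (4 ^ Suc j) - W (4 ^ j)))"
proof (induction L)
  case 0
  have "log4 0 = 0" using log4_le[of 0 0] by simp
  then show ?case by simp
next
  case (Suc L)
  have "(\<Sum>k<4 ^ Suc L. F (log4 k) * (W (Suc k) - W k))
    = (\<Sum>k<4 ^ L. F (log4 k) * (W (Suc k) - W k)) + (\<Sum>k=4 ^ L..<4 ^ Suc L. F (log4 k) * (W (Suc k) - W k))"
    using sum.atLeastLessThan_concat[of 0 "4 ^ L" "4 ^ Suc L" "\<lambda>k. F (log4 k) * (W (Suc k) - W k)"]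
    by (simp add: atLeast0LessThan)
  also have "(\<Sum>k=4 ^ L..<4 ^ Suc L. F (log4 k) * (W (Suc k) - W k))
    = (\<Sum>k=4 ^ L..<4 ^ Suc L. F (Suc L) * (W (Suc k) - W k))"
    by (intro sum.cong refl, subst log4_eq_Suc[of L]) auto
  also have "\<dots> = F (Suc L) * (W (4 ^ Suc L) - W (4 ^ L))"
    unfolding sum_distrib_left[symmetric] by (subst sum_Suc_diff') auto
  finally show ?case using Suc by simp
qed

text \<open>Within a factor \<open>2\<close> of \<open>1 / sqrt k\<close> for \<open>k > 0\<close>:
  the value is \<open>(1 / 2) ^ Suc j\<close> on the block
  \<open>4 ^ j \<le> k < 4 ^ Suc j\<close>.\<close>

definition weight :: "nat \<Rightarrow> real" where
  "weight k = (1 / 2) ^ log4 k"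

lemma weight_pos: "0 < weight k" and weight_le_1: "weight k \<le> 1"
  by (auto simp: weight_def power_le_one)

lemma weight_antimono: "j \<le> k \<Longrightarrow> weight k \<le> weight j"
  unfolding weight_def by (intro power_decreasing log4_mono) auto

lemma sum_weight_sq_le: "(\<Sum>k<4 ^ L. (weight k)\<^sup>2) \<le> real (Suc L)"
proof -
  have "(\<Sum>k<4 ^ L. (weight k)\<^sup>2) = (\<Sum>k<4 ^ L. (1 / 4) ^ log4 k * (real (Suc k) - real k))"
    by (simp add: weight_def power2_eq_square flip: power_mult_distrib)
  also have "\<dots> = 1 + (\<Sum>j<L. (1 / 4) ^ Suc j * (real (4 ^ Suc j) - real (4 ^ j)))"
    using sum_log4[of "\<lambda>j. (1 / 4) ^ j" real L] by simp
  also have "(\<Sum>j<L. (1 / 4) ^ Suc j * (real (4 ^ Suc j) - real (4 ^ j))) \<le> (\<Sum>j<L. 1)"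
    by (intro sum_mono) (simp add: power_one_over field_simps)
  finally show ?thesis by simp
qed

lemma sum_weight_le: "(\<Sum>k<4 ^ L. weight k) \<le> 2 ^ Suc L"
proof -
  have "(\<Sum>k<4 ^ L. weight k) = (\<Sum>k<4 ^ L. (1 / 2) ^ log4 k * (real (Suc k) - real k))"
    by (simp add: weight_def)
  also have "\<dots> = 1 + (\<Sum>j<L. (1 / 2) ^ Suc j * (real (4 ^ Suc j) - real (4 ^ j)))"
    using sum_log4[of "\<lambda>j. (1 / 2) ^ j" real L] by simp
  also have "(\<Sum>j<L. (1 / 2) ^ Suc j * (real (4 ^ Suc j) - real (4 ^ j))) \<le> (\<Sum>j<L. 2 * 2 ^ j)"
  proof (intro sum_mono)
    fix j
    have "(1 / 2) ^ Suc j * (real (4 ^ Suc j) - real (4 ^ j)) = 3 / 2 * ((1 / 2) ^ j * 4 ^ j)" by simp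
    also have "\<dots> = 3 / 2 * 2 ^ j" by (simp flip: power_mult_distrib)
    also have "\<dots> \<le> 2 * 2 ^ j" by simp
    finally show "(1 / 2) ^ Suc j * (real (4 ^ Suc j) - real (4 ^ j)) \<le> 2 * 2 ^ j" .
  qed
  also have "(\<Sum>j<L. 2 * 2 ^ j) = 2 * (2 ^ L - 1 :: real)"
    by (simp add: sum_distrib_left[symmetric] geometric_sum)
  finally show ?thesis by simp
qed

text \<open>For \<open>p = 2\<close> and \<open>q = 2 * a\<close> the right-hand side is the
  \<open>q\<close>-th power of the Lorentz norm of the first \<open>4 ^ L\<close> weights; each of
  the \<open>L\<close> blocks contributes exactly \<open>1 - 4 powr (- a)\<close>.\<close>

lemma sum_weight_powr_ge:
  assumes a: "0 < a"
  shows "real L * (1 - 4 powr (- a))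
    \<le> (\<Sum>k<4 ^ L. weight k powr (2 * a) * (real (Suc k) powr a - real k powr a))"
proof -
  have w: "weight k powr (2 * a) = ((1 / 4) powr a) ^ log4 k" for k
  proof -
    have "weight k powr (2 * a) = (weight k powr 2) powr a" by (simp only: powr_powr)
    also have "weight k powr 2 = (1 / 4) ^ log4 k"
      using weight_pos[of k] by (simp add: weight_def power2_eq_square flip: power_mult_distrib)
    also have "((1 / 4 :: real) ^ j) powr a = ((1 / 4) powr a) ^ j" for j :: nat
      by (induction j) (simp, subst (1 2) power_Suc, subst powr_mult, auto)
    finally show ?thesis .
  qed
  have "real L * (1 - 4 powr (- a)) \<le> 1 + (\<Sum>j<L. ((1 / 4) powr a) ^ Suc j * (real (4 ^ Suc j) powr a - real (4 ^ j) powr a))"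
  proof -
    have "((1 / 4) powr a) ^ Suc j * (real (4 ^ Suc j) powr a - real (4 ^ j) powr a) = 1 - 4 powr (- a)" for j
    proof -
      have *: "real (4 ^ j) powr a = (4 powr a) ^ j" for j :: nat
        by (induction j) (auto simp: powr_mult)
      define B where "B = (4::real) powr a"
      have B: "0 < B" "(1 / 4 :: real) powr a = 1 / B" "4 powr (- a) = 1 / B"
        unfolding B_def by (simp, simp add: powr_divide, rule powr_minus_divide)
      show ?thesis
        unfolding * B(2,3) unfolding B_def[symmetric]
        using B(1) by (simp add: power_one_over field_simps)
    qed
    then show ?thesis by simp
  qed
  also have "\<dots> = (\<Sum>k<4 ^ L. ((1 / 4) powr a) ^ log4 k * (real (Suc k) powr a - real k powr a))"
    using sum_log4[of "\<lambda>j. ((1 / 4) powr a) ^ j" "\<lambda>k. real k powr a" L] by simp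
  finally show ?thesis by (simp add: w)
qed

context prob_space
begin

text \<open>This integrates \<open>sum_dyadic_le\<close> at exponent \<open>2\<close>, whence the
  factor \<open>4 / 3\<close>.\<close>

lemma sum_lev_le_integral_sq:
  fixes h :: "'a \<Rightarrow> 'k::{real_normed_vector, second_countable_topology}"
  assumes [measurable]: "h \<in> borel_measurable M" and R: "\<And>x. x \<in> space M \<Longrightarrow> norm (h x) \<le> R"
    and A: "finite A"
  shows "(\<Sum>i\<in>A. 4 ^ i * lev M h i) \<le> 4 / 3 * (\<integral>x. (norm (h x))\<^sup>2 \<partial>M)"
proof -
  have "(\<Sum>i\<in>A. 4 ^ i * lev M h i) = (\<integral>x. (\<Sum>i\<in>A. 4 ^ i * (if 2 ^ i < norm (h x) then 1 else 0)) \<partial>M)"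
    by (subst Bochner_Integration.integral_sum)
      (auto simp: lev_eq_integral intro!: integrable_mult_right integrable_bounded[where R = 1])
  also have "\<dots> \<le> (\<integral>x. 4 / 3 * (norm (h x))\<^sup>2 \<partial>M)"
  proof (intro integral_mono)
    show "integrable M (\<lambda>x. \<Sum>i\<in>A. 4 ^ i * (if 2 ^ i < norm (h x) then 1 else 0 :: real))"
      by (intro Bochner_Integration.integrable_sum integrable_mult_right
          integrable_bounded[where R = 1]) auto
    show "integrable M (\<lambda>x. 4 / 3 * (norm (h x))\<^sup>2)"
      by (intro integrable_mult_right integrable_bounded[where R = "R\<^sup>2"]) (auto intro!: power_mono R)
    fix x
    obtain I where I: "A \<subseteq> {..<I}" using A finite_nat_bounded by blast
    have "(\<Sum>i\<in>A. 4 ^ i * (if 2 ^ i < norm (h x) then 1 else 0 :: real))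
      \<le> (\<Sum>i<I. 4 ^ i * (if 2 ^ i < norm (h x) then 1 else 0))"
      using I by (intro sum_mono2) auto
    also have "\<dots> \<le> (\<Sum>i<I. (2 ^ i) powr 2 * (if 2 ^ i \<le> norm (h x) then 1 else 0))"
      by (intro sum_mono) (auto simp: four_power_eq)
    also have "\<dots> \<le> 2 powr 2 / (2 powr 2 - 1) * norm (h x) powr 2" by (intro sum_dyadic_le) auto
    also have "\<dots> = 4 / 3 * (norm (h x))\<^sup>2" by simp
    finally show "(\<Sum>i\<in>A. 4 ^ i * (if 2 ^ i < norm (h x) then 1 else 0 :: real)) \<le> 4 / 3 * (norm (h x))\<^sup>2" .
  qed
  finally show ?thesis by simp
qed

lemma sum_powr_four_lev_le:
  fixes h :: "'a \<Rightarrow> 'k::{real_normed_vector, second_countable_topology}"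
  assumes "h \<in> borel_measurable M" "\<And>x. x \<in> space M \<Longrightarrow> norm (h x) \<le> R"
    and A: "finite A" and a: "0 < a" "a \<le> 1"
  shows "(\<Sum>i\<in>A. (4 ^ i * lev M h i) powr a)
    \<le> real (card A) powr (1 - a) * (4 / 3 * (\<integral>x. (norm (h x))\<^sup>2 \<partial>M)) powr a"
proof -
  have "(\<Sum>i\<in>A. (4 ^ i * lev M h i) powr a) \<le> real (card A) powr (1 - a) * (\<Sum>i\<in>A. 4 ^ i * lev M h i) powr a"
    using a by (intro sum_powr_le_card) auto
  also have "\<dots> \<le> real (card A) powr (1 - a) * (4 / 3 * (\<integral>x. (norm (h x))\<^sup>2 \<partial>M)) powr a"
    using assms by (intro mult_left_mono powr_mono2 sum_lev_le_integral_sq) (auto intro!: sum_nonneg)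
  finally show ?thesis .
qed

text \<open>A moment of order \<open>2 b > 2\<close> is needed: with second moments the sum over the levels would only
  be bounded by a multiple of the number of levels.\<close>
lemma sgn_sum_bounded_levels:
  fixes g :: "nat \<Rightarrow> 'a \<Rightarrow> 'k::euclidean_space"
  assumes [measurable]: "\<And>k. g k \<in> borel_measurable M"
    and g: "\<And>k x. x \<in> space M \<Longrightarrow> norm (g k x) \<le> R k"
    and a: "0 < a" "a \<le> 1" and b: "1 < b"
    and S: "(\<Sum>k<n. (R k)\<^sup>2) \<le> V"
  shows "(\<Sum>i<I. \<Sum>U\<in>Pow {..<n}. (4 ^ i * lev M (sgn_sum U n g) i) powr a)
    \<le> 2 ^ n * ((khintchine_const b * V) powr (b * a) / (1 - 4 powr (a * (1 - b))))"
proof -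
  define W where "W = khintchine_const b * V"
  \<comment> \<open>The moment of order \<open>2 * b\<close> makes the averaged
    \<open>4 ^ i * lev\<close> decay like \<open>(4 ^ i) powr (1 - b)\<close>, whose power
    \<open>a\<close> is \<open>t ^ i\<close>.\<close>
  define t where "t = (4::real) powr (a * (1 - b))"
  have t: "0 < t" "t < 1" using a b by (auto simp: t_def mult_pos_neg powr_less_one)
  have V: "0 \<le> V" using S by (rule order.trans[rotated]) (auto intro!: sum_nonneg)
  have W: "0 \<le> W" using V khintchine_const_ge_1[of b] by (simp add: W_def)
  have Sb: "norm (sgn_sum U n g x) \<le> (\<Sum>k<n. R k)" if "x \<in> space M" for U x
    using g that by (intro norm_sgn_sum_le) auto
  have int: "integrable M (\<lambda>x. ((norm (sgn_sum U n g x))\<^sup>2) powr b)" for U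
    using b by (intro integrable_bounded[where R = "((\<Sum>k<n. R k)\<^sup>2) powr b"])
      (auto intro!: powr_mono2 power_mono Sb)
  have lev: "(\<Sum>U\<in>Pow {..<n}. lev M (sgn_sum U n g) i) \<le> 2 ^ n * W powr b / (4 ^ i) powr b" for i
  proof -
    have "(\<Sum>U\<in>Pow {..<n}. lev M (sgn_sum U n g) i)
      \<le> (\<Sum>U\<in>Pow {..<n}. (\<integral>x. ((norm (sgn_sum U n g x))\<^sup>2) powr b \<partial>M) / (4 ^ i) powr b)"
      using b Sb by (intro sum_mono lev_le_integral_powr[where R = "\<Sum>k<n. R k"]) auto
    also have "\<dots> = (\<integral>x. (\<Sum>U\<in>Pow {..<n}. ((norm (sgn_sum U n g x))\<^sup>2) powr b) \<partial>M) / (4 ^ i) powr b"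
      by (simp add: Bochner_Integration.integral_sum int flip: sum_divide_distrib)
    also have "\<dots> \<le> (\<integral>x. 2 ^ n * W powr b \<partial>M) / (4 ^ i) powr b"
    proof (intro divide_right_mono integral_mono Bochner_Integration.integrable_sum int)
      fix x assume x: "x \<in> space M"
      have "(\<Sum>U\<in>Pow {..<n}. ((norm (sgn_sum U n g x))\<^sup>2) powr b)
        \<le> 2 ^ n * (khintchine_const b * (\<Sum>k<n. (norm (g k x))\<^sup>2)) powr b"
        using b by (intro sgn_sum_norm_powr) auto
      also have "\<dots> \<le> 2 ^ n * W powr b"
      proof (intro mult_left_mono powr_mono2)
        have "(\<Sum>k<n. (norm (g k x))\<^sup>2) \<le> (\<Sum>k<n. (R k)\<^sup>2)"
          using g[OF x] by (intro sum_mono power_mono) auto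
        then show "khintchine_const b * (\<Sum>k<n. (norm (g k x))\<^sup>2) \<le> W"
          unfolding W_def using S khintchine_const_ge_1[of b] by (intro mult_left_mono) auto
      qed (use b khintchine_const_ge_1[of b] in \<open>auto intro!: mult_nonneg_nonneg sum_nonneg\<close>)
      finally show "(\<Sum>U\<in>Pow {..<n}. ((norm (sgn_sum U n g x))\<^sup>2) powr b) \<le> 2 ^ n * W powr b" .
    qed auto
    finally show ?thesis by (simp add: prob_space)
  qed
  have "(\<Sum>U\<in>Pow {..<n}. (4 ^ i * lev M (sgn_sum U n g) i) powr a) \<le> 2 ^ n * (W powr (b * a) * t ^ i)" for i
  proof -
    have "(\<Sum>U\<in>Pow {..<n}. (4 ^ i * lev M (sgn_sum U n g) i) powr a)
      \<le> real (card (Pow {..<n})) powr (1 - a) * (\<Sum>U\<in>Pow {..<n}. 4 ^ i * lev M (sgn_sum U n g) i) powr a"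
      using a by (intro sum_powr_le_card) auto
    also have "(\<Sum>U\<in>Pow {..<n}. 4 ^ i * lev M (sgn_sum U n g) i) = 4 ^ i * (\<Sum>U\<in>Pow {..<n}. lev M (sgn_sum U n g) i)"
      by (rule sum_distrib_left[symmetric])
    also have "real (card (Pow {..<n})) powr (1 - a) * (4 ^ i * (\<Sum>U\<in>Pow {..<n}. lev M (sgn_sum U n g) i)) powr a
      \<le> (2 ^ n) powr (1 - a) * (4 ^ i * (2 ^ n * W powr b / (4 ^ i) powr b)) powr a"
      using a by (intro mult_mono powr_mono2 mult_left_mono lev) (auto simp: card_Pow intro!: mult_nonneg_nonneg sum_nonneg)
    also have "\<dots> = (2 ^ n) powr (1 - a) * ((2 ^ n) powr a * (W powr b * (4 ^ i / (4 ^ i) powr b)) powr a)"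
      using W by (simp add: powr_mult[symmetric] ac_simps)
    also have "\<dots> = 2 ^ n * (W powr b * (4 ^ i / (4 ^ i) powr b)) powr a"
      by (simp add: mult.assoc[symmetric] flip: powr_add)
    also have "(W powr b * (4 ^ i / (4 ^ i) powr b)) powr a = W powr (b * a) * ((4 ^ i) powr (1 - b)) powr a"
      using W by (subst powr_mult) (auto simp: powr_powr powr_diff)
    also have "((4 ^ i) powr (1 - b)) powr a = (t ^ i :: real)"
      by (induction i) (auto simp: t_def powr_mult powr_powr mult.commute)
    finally show ?thesis .
  qed
  then have "(\<Sum>i<I. \<Sum>U\<in>Pow {..<n}. (4 ^ i * lev M (sgn_sum U n g) i) powr a)
    \<le> (\<Sum>i<I. 2 ^ n * (W powr (b * a) * t ^ i))" by (intro sum_mono)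
  also have "\<dots> = 2 ^ n * (W powr (b * a) * (\<Sum>i<I. t ^ i))" by (simp add: sum_distrib_left)
  also have "\<dots> \<le> 2 ^ n * (W powr (b * a) * (1 / (1 - t)))"
  proof (intro mult_left_mono)
    have "(\<Sum>i<I. t ^ i) \<le> (\<Sum>i. t ^ i)" using t by (intro sum_le_suminf summable_geometric) auto
    then show "(\<Sum>i<I. t ^ i) \<le> 1 / (1 - t)" using t by (simp add: suminf_geometric)
  qed auto
  finally show ?thesis by (simp add: W_def t_def)
qed

end

text \<open>Each window is enlarged by its two neighbours, so an index lies in at most three of
  them. At \<open>t = 0\<close> truncated subtraction removes the missing left neighbour.\<close>

lemma sum_windows_le:
  fixes y :: "nat \<Rightarrow> real"
  assumes w: "0 < w" and y: "\<And>m. 0 \<le> y m" and Z: "\<And>J. (\<Sum>m=m0..<J. y m) \<le> Z"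
  shows "(\<Sum>t<T. \<Sum>m=max m0 (w * (t - 1))..<w * (t + 2). y m) \<le> 3 * Z"
proof -
  define J where "J = w * (T + 2)"
  define P where "P t m \<longleftrightarrow> w * (t - 1) \<le> m \<and> m < w * (t + 2)" for t m :: nat
  have "(\<Sum>t<T. \<Sum>m=max m0 (w * (t - 1))..<w * (t + 2). y m) \<le> (\<Sum>t<T. \<Sum>m=m0..<J. if P t m then y m else 0)"
  proof (intro sum_mono)
    fix t assume "t \<in> {..<T}"
    then have "w * (t + 2) \<le> J" unfolding J_def by (intro mult_le_mono) auto
    then have "(\<Sum>m=max m0 (w * (t - 1))..<w * (t + 2). y m) = (\<Sum>m=max m0 (w * (t - 1))..<w * (t + 2). if P t m then y m else 0)"
      by (intro sum.cong) (auto simp: P_def)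
    also have "\<dots> \<le> (\<Sum>m=m0..<J. if P t m then y m else 0)"
      using \<open>w * (t + 2) \<le> J\<close> y by (intro sum_mono2) auto
    finally show "(\<Sum>m=max m0 (w * (t - 1))..<w * (t + 2). y m) \<le> (\<Sum>m=m0..<J. if P t m then y m else 0)" .
  qed
  also have "\<dots> = (\<Sum>m=m0..<J. \<Sum>t<T. if P t m then y m else 0)" by (rule sum.swap)
  also have "\<dots> \<le> (\<Sum>m=m0..<J. 3 * y m)"
  proof (intro sum_mono)
    fix m
    have sub: "{t \<in> {..<T}. P t m} \<subseteq> {m div w - 1..m div w + 1}"
    proof
      fix t assume "t \<in> {t \<in> {..<T}. P t m}"
      then have "w * (t - 1) \<le> m" "m < w * (t + 2)" by (auto simp: P_def)
      then have "t - 1 \<le> m div w" "m div w < t + 2"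
        using w by (simp_all add: less_eq_div_iff_mult_less_eq div_less_iff_less_mult mult.commute)
      then show "t \<in> {m div w - 1..m div w + 1}" by auto
    qed
    have "card {t \<in> {..<T}. P t m} \<le> card {m div w - 1..m div w + 1}" by (intro card_mono sub) auto
    also have "\<dots> \<le> 3" by simp
    finally have c: "real (card {t \<in> {..<T}. P t m}) \<le> 3" by simp
    have "(\<Sum>t<T. if P t m then y m else 0) = real (card {t \<in> {..<T}. P t m}) * y m"
      by (simp add: sum.If_cases Int_def)
    also have "\<dots> \<le> 3 * y m" using c y by (intro mult_right_mono) auto
    finally show "(\<Sum>t<T. if P t m then y m else 0) \<le> 3 * y m" .
  qed
  also have "\<dots> \<le> 3 * Z" unfolding sum_distrib_left[symmetric] using Z by (intro mult_left_mono) auto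
  finally show ?thesis .
qed

lemma sum_multiples_le:
  fixes y :: "nat \<Rightarrow> real"
  assumes w: "0 < w" "m0 \<le> w" and y: "\<And>m. 0 \<le> y m" and Z: "\<And>J. (\<Sum>m=m0..<J. y m) \<le> Z"
  shows "(\<Sum>t<T. y (w * (t + 2))) \<le> Z"
proof -
  have "(\<Sum>t<T. y (w * (t + 2))) = (\<Sum>m\<in>(\<lambda>t. w * (t + 2)) ` {..<T}. y m)"
    using w by (subst sum.reindex) (auto simp: inj_on_def)
  also have "\<dots> \<le> (\<Sum>m=m0..<w * (T + 2). y m)"
  proof (intro sum_mono2)
    have "m0 \<le> w * (t + 2)" for t using w by (metis add_gr_0 le_trans mult.commute mult_le_mono1 nat_mult_1 one_le_mult_iff order_refl Suc_leI One_nat_def zero_less_numeral)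
    then show "(\<lambda>t. w * (t + 2)) ` {..<T} \<subseteq> {m0..<w * (T + 2)}" using w by auto
  qed (use y in auto)
  also have "\<dots> \<le> Z" by (rule Z)
  finally show ?thesis .
qed

context prob_space
begin

text \<open>The levels are cut into windows of length \<open>w\<close>. In the window \<open>t\<close> the small summands are
  negligible because the weights add up to at most \<open>2 ^ (L + 1)\<close>, the large ones because there are only
  \<open>4 ^ L\<close> of them, and the remaining ones are treated by orthogonality.\<close>
lemma window_step:
  fixes F :: "nat \<Rightarrow> 'a \<Rightarrow> 'k::euclidean_space" and L m0 w t i :: nat
  assumes [measurable]: "\<And>k. F k \<in> borel_measurable M" and w: "L + 1 \<le> w" and i: "w * t \<le> i"
  defines "g \<equiv> \<lambda>k x. weight k *\<^sub>R (if 2 ^ m0 < norm (F k x) then F k x else 0)"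
  defines "h \<equiv> \<lambda>k x. weight k *\<^sub>R band (2 ^ max m0 (w * (t - 1))) (2 ^ (w * (t + 2))) (F k) x"
  shows "lev M (sgn_sum U (4 ^ L) g) (Suc i)
    \<le> lev M (sgn_sum U (4 ^ L) h) i + (\<Sum>k<4 ^ L. lev M (F k) (w * (t + 2)))"
proof -
  have [measurable]: "g k \<in> borel_measurable M" "h k \<in> borel_measurable M" for k
    unfolding g_def h_def by measurable
  define Hi where "Hi k = {x \<in> space M. 2 ^ (w * (t + 2)) < norm (F k x)}" for k
  have Hi [measurable]: "Hi k \<in> sets M" for k unfolding Hi_def by measurable
  have S: "{x \<in> space M. 2 ^ i < norm (sgn_sum U (4 ^ L) h x)} \<in> sets M" by measurable
  have "lev M (sgn_sum U (4 ^ L) g) (Suc i)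
    \<le> measure M ({x \<in> space M. 2 ^ i < norm (sgn_sum U (4 ^ L) h x)} \<union> (\<Union>k<4 ^ L. Hi k))"
    unfolding lev_def
  proof (intro finite_measure_mono subsetI)
    fix x assume x: "x \<in> {x \<in> space M. 2 ^ Suc i < norm (sgn_sum U (4 ^ L) g x)}"
    show "x \<in> {x \<in> space M. 2 ^ i < norm (sgn_sum U (4 ^ L) h x)} \<union> (\<Union>k<4 ^ L. Hi k)"
    proof (cases "\<exists>k<4 ^ L. x \<in> Hi k")
      case True
      then show ?thesis by auto
    next
      case False
      \<comment> \<open>Off the sets \<open>Hi k\<close> only values up to the lower cut of the band
        are lost. For \<open>t = 0\<close> that cut is \<open>2 ^ m0\<close>, because
        \<open>w * (0 - 1) = 0\<close>, and nothing is lost.\<close>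
      have diff: "norm (g k x - h k x) \<le> weight k * (if t = 0 then 0 else 2 ^ (w * (t - 1)))" if k: "k < 4 ^ L" for k
      proof -
        have le: "norm (F k x) \<le> 2 ^ (w * (t + 2))" using False k x by (auto simp: Hi_def)
        have one: "2 ^ m0 < norm (F k x) \<Longrightarrow> 1 < norm (F k x)"
          using one_le_power[of "2::real" m0] by linarith
        have mx: "(2::real) ^ max m0 (w * (t - 1)) = max (2 ^ m0) (2 ^ (w * (t - 1)))"
          by (simp add: max_def)
        have "norm ((if 2 ^ m0 < norm (F k x) then F k x else 0)
          - band (2 ^ max m0 (w * (t - 1))) (2 ^ (w * (t + 2))) (F k) x) \<le> (if t = 0 then 0 else 2 ^ (w * (t - 1)))"
          using le one unfolding mx by (auto simp: band_def)
        then have "weight k * norm ((if 2 ^ m0 < norm (F k x) then F k x else 0)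
          - band (2 ^ max m0 (w * (t - 1))) (2 ^ (w * (t + 2))) (F k) x) \<le> weight k * (if t = 0 then 0 else 2 ^ (w * (t - 1)))"
          using weight_pos[of k] by (intro mult_left_mono) auto
        moreover have "norm (g k x - h k x) = weight k * norm ((if 2 ^ m0 < norm (F k x) then F k x else 0)
          - band (2 ^ max m0 (w * (t - 1))) (2 ^ (w * (t + 2))) (F k) x)"
          unfolding g_def h_def scaleR_diff_right[symmetric] using weight_pos[of k] by simp
        ultimately show ?thesis by simp
      qed
      have "sgn_sum U (4 ^ L) g x - sgn_sum U (4 ^ L) h x = sgn_sum U (4 ^ L) (\<lambda>k x. g k x - h k x) x"
        by (simp add: sgn_sum_def scaleR_diff_right sum_subtractf)
      also have "norm \<dots> \<le> (\<Sum>k<4 ^ L. weight k * (if t = 0 then 0 else 2 ^ (w * (t - 1))))"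
        by (intro norm_sgn_sum_le diff)
      also have "\<dots> = (\<Sum>k<4 ^ L. weight k) * (if t = 0 then 0 else 2 ^ (w * (t - 1)))"
        by (rule sum_distrib_right[symmetric])
      also have "\<dots> \<le> 2 ^ Suc L * (if t = 0 then 0 else 2 ^ (w * (t - 1)))"
        by (intro mult_right_mono sum_weight_le) auto
      also have "\<dots> \<le> 2 ^ i"
      proof (cases t)
        case (Suc t')
        \<comment> \<open>One whole window of distance, with \<open>w \<ge> L + 1\<close>, absorbs
          the total weight \<open>2 ^ Suc L\<close>.\<close>
        have "Suc L + w * t' \<le> i" using i w Suc by simp
        then have "(2::real) ^ (Suc L + w * t') \<le> 2 ^ i" by (intro power_increasing) auto
        then show ?thesis using Suc by (simp add: power_add)
      qed simp
      finally have "norm (sgn_sum U (4 ^ L) g x) \<le> 2 ^ i + norm (sgn_sum U (4 ^ L) h x)"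
        using norm_triangle_ineq2[of "sgn_sum U (4 ^ L) g x" "sgn_sum U (4 ^ L) h x"] by linarith
      then show ?thesis using x by auto
    qed
  qed (intro sets.Un S sets.finite_UN Hi finite_lessThan)
  also have "\<dots> \<le> lev M (sgn_sum U (4 ^ L) h) i + measure M (\<Union>k<4 ^ L. Hi k)"
    unfolding lev_def by (intro measure_Un_le S sets.finite_UN Hi finite_lessThan)
  also have "measure M (\<Union>k<4 ^ L. Hi k) \<le> (\<Sum>k<4 ^ L. lev M (F k) (w * (t + 2)))"
    unfolding lev_def Hi_def[symmetric] by (intro measure_UNION_le Hi finite_lessThan)
  finally show ?thesis by simp
qed

text \<open>Up to constants, Hoelder over \<open>w\<close> levels gives
  \<open>w powr (1 - a)\<close> and Khintchine gives \<open>(w * Y) powr a\<close>, as the squared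
  weights add up to at most \<open>Suc L \<le> w\<close>; together the growth is linear in
  \<open>w\<close>. Finally \<open>a \<le> 1\<close> splits \<open>Y powr a\<close> into the
  \<open>y m\<close>.\<close>

lemma window_middle:
  fixes F :: "nat \<Rightarrow> 'a \<Rightarrow> 'k::euclidean_space" and L l u w i0 :: nat
  assumes [measurable]: "\<And>k. F k \<in> borel_measurable M" and w: "Suc L \<le> w" and lu: "l \<le> u"
    and a: "0 < a" "a \<le> 1" and y: "\<And>j. 0 \<le> y j"
    and lev: "\<And>k j. k < 4 ^ L \<Longrightarrow> 4 ^ j * lev M (F k) j \<le> y j powr (1 / a)"
  defines "h \<equiv> \<lambda>k x. weight k *\<^sub>R band (2 ^ l) (2 ^ u) (F k) x"
  shows "(\<Sum>U\<in>Pow {..<4 ^ L}. \<Sum>i=i0..<i0 + w. (4 ^ i * lev M (sgn_sum U (4 ^ L) h) i) powr a)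
    \<le> 2 ^ 4 ^ L * (real w * (16 / 3 * khintchine_const a) powr a * (\<Sum>m=l..<u. y m))"
proof -
  define D where "D = khintchine_const a"
  define Y where "Y = (\<Sum>m=l..<u. y m powr (1 / a))"
  define I where "I U = (\<integral>x. (norm (sgn_sum U (4 ^ L) h x))\<^sup>2 \<partial>M)" for U
  have D: "1 \<le> D" unfolding D_def by (rule khintchine_const_ge_1)
  have Y: "0 \<le> Y" by (auto simp: Y_def intro!: sum_nonneg)
  have hm [measurable]: "h k \<in> borel_measurable M" for k unfolding h_def by measurable
  have hb: "norm (h k x) \<le> 2 ^ u" for k x
  proof -
    have "norm (h k x) = weight k * norm (band (2 ^ l) (2 ^ u) (F k) x)"
      using weight_pos[of k] by (simp add: h_def)
    also have "\<dots> \<le> 1 * 2 ^ u"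
      using weight_pos[of k] weight_le_1[of k] by (intro mult_mono) (auto simp: band_def)
    finally show ?thesis by simp
  qed
  have Sb: "norm (sgn_sum U (4 ^ L) h x) \<le> (\<Sum>k<(4::nat) ^ L. 2 ^ u)" for U x
    by (intro norm_sgn_sum_le hb)
  have int: "(\<Sum>k<4 ^ L. \<integral>x. (norm (h k x))\<^sup>2 \<partial>M) \<le> real w * (4 * Y)"
  proof -
    have "(\<Sum>k<4 ^ L. \<integral>x. (norm (h k x))\<^sup>2 \<partial>M) \<le> (\<Sum>k<4 ^ L. (weight k)\<^sup>2 * (4 * Y))"
    proof (intro sum_mono)
      fix k :: nat assume k: "k \<in> {..<4 ^ L}"
      have "(\<integral>x. (norm (h k x))\<^sup>2 \<partial>M) = (weight k)\<^sup>2 * (\<integral>x. (norm (band (2 ^ l) (2 ^ u) (F k) x))\<^sup>2 \<partial>M)"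
        by (simp add: h_def power_mult_distrib)
      also have "\<dots> \<le> (weight k)\<^sup>2 * (\<Sum>m=l..<u. 4 ^ Suc m * lev M (F k) m)"
        using lu by (intro mult_left_mono integral_band_sq_le) auto
      also have "\<dots> \<le> (weight k)\<^sup>2 * (\<Sum>m=l..<u. 4 * y m powr (1 / a))"
        using lev k by (intro mult_left_mono sum_mono) (auto simp: mult.assoc)
      finally show "(\<integral>x. (norm (h k x))\<^sup>2 \<partial>M) \<le> (weight k)\<^sup>2 * (4 * Y)"
        by (simp add: Y_def sum_distrib_left)
    qed
    also have "\<dots> = (\<Sum>k<4 ^ L. (weight k)\<^sup>2) * (4 * Y)" by (rule sum_distrib_right[symmetric])
    also have "\<dots> \<le> real w * (4 * Y)"
      using sum_weight_sq_le[of L] w Y by (intro mult_right_mono) auto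
    finally show ?thesis .
  qed
  have "(\<Sum>U\<in>Pow {..<4 ^ L}. \<Sum>i=i0..<i0 + w. (4 ^ i * lev M (sgn_sum U (4 ^ L) h) i) powr a)
    \<le> (\<Sum>U\<in>Pow {..<4 ^ L}. real (card {i0..<i0 + w}) powr (1 - a) * (4 / 3 * I U) powr a)"
    unfolding I_def using a Sb by (intro sum_mono sum_powr_four_lev_le[where R = "\<Sum>k<(4::nat) ^ L. 2 ^ u"]) auto
  also have "\<dots> = real w powr (1 - a) * (4 / 3) powr a * (\<Sum>U\<in>Pow {..<4 ^ L}. (0 + I U) powr a)"
    unfolding sum_distrib_left by (intro sum.cong refl) (subst powr_mult, auto simp: I_def)
  also have "\<dots> \<le> real w powr (1 - a) * (4 / 3) powr a * (2 ^ 4 ^ L * (0 + D * (\<Sum>k<4 ^ L. \<integral>x. (norm (h k x))\<^sup>2 \<partial>M)) powr a)"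
    unfolding I_def D_def using a hb
    by (intro mult_left_mono sgn_sum_integral_powr[where R = "\<lambda>_. 2 ^ u"]) auto
  also have "\<dots> \<le> real w powr (1 - a) * (4 / 3) powr a * (2 ^ 4 ^ L * (D * (real w * (4 * Y))) powr a)"
    using a D int by (intro mult_left_mono powr_mono2) (auto intro!: mult_nonneg_nonneg sum_nonneg)
  also have "\<dots> = 2 ^ 4 ^ L * ((real w powr (1 - a) * real w powr a) * ((4 / 3) powr a * (4 * D) powr a) * Y powr a)"
    using D Y by (simp add: powr_mult)
  also have "real w powr (1 - a) * real w powr a = real w" using w by (simp flip: powr_add)
  also have "(4 / 3) powr a * (4 * D) powr a = (16 / 3 * D) powr a"
    using D by (simp flip: powr_mult)
  also have "2 ^ 4 ^ L * (real w * (16 / 3 * D) powr a * Y powr a) \<le> 2 ^ 4 ^ L * (real w * (16 / 3 * D) powr a * (\<Sum>m=l..<u. y m))"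
  proof (intro mult_left_mono)
    have "Y powr a \<le> (\<Sum>m=l..<u. (y m powr (1 / a)) powr a)"
      unfolding Y_def using a by (intro sum_powr_le_add_powr) auto
    then show "Y powr a \<le> (\<Sum>m=l..<u. y m)" using a y by (simp add: powr_powr)
  qed auto
  finally show ?thesis by (simp add: D_def)
qed

text \<open>Every \<open>y m\<close> is met by at most three bands and at most once as an upper end,
  so the sum over all windows is a multiple of \<open>w * Z\<close>. The gain lies in
  \<open>Z\<close>, the mass of the profile above \<open>m0\<close>, which can be made
  small.\<close>

lemma sgn_sum_large_levels:
  fixes F :: "nat \<Rightarrow> 'a \<Rightarrow> 'k::euclidean_space" and L m0 w :: nat
  assumes Fm [measurable]: "\<And>k. F k \<in> borel_measurable M" and w: "L + 1 \<le> w" "m0 \<le> w"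
    and a: "0 < a" "a \<le> 1" and y: "\<And>j. 0 \<le> y j" and Z: "\<And>J. (\<Sum>m=m0..<J. y m) \<le> Z"
    and lev: "\<And>k j. k < 4 ^ L \<Longrightarrow> 4 ^ j * lev M (F k) j \<le> y j powr (1 / a)"
  defines "g \<equiv> \<lambda>k x. weight k *\<^sub>R (if 2 ^ m0 < norm (F k x) then F k x else 0)"
  shows "(\<Sum>i<I. \<Sum>U\<in>Pow {..<4 ^ L}. (4 ^ i * lev M (sgn_sum U (4 ^ L) g) (Suc i)) powr a)
    \<le> 2 ^ 4 ^ L * (real w * (3 * (16 / 3 * khintchine_const a) powr a + 1) * Z)"
proof -
  define E where "E = (16 / 3 * khintchine_const a) powr a"
  define u where "u t = w * (t + 2)" for t
  define l where "l t = max m0 (w * (t - 1))" for t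
  define h where "h t k x = weight k *\<^sub>R band (2 ^ l t) (2 ^ u t) (F k) x" for t k x
  define A where "A i = (\<Sum>U\<in>Pow {..<4 ^ L}. (4 ^ i * lev M (sgn_sum U (4 ^ L) g) (Suc i)) powr a)" for i
  have w0: "0 < w" using w by simp
  have lu: "l t \<le> u t" for t
  proof -
    have "w * 1 \<le> w * (t + 2)" "w * (t - 1) \<le> w * (t + 2)" by (intro mult_le_mono; simp)+
    then show ?thesis unfolding l_def u_def using w by simp
  qed
  \<comment> \<open>Since \<open>w \<ge> L + 1\<close>, the level \<open>u t\<close> is at least
    \<open>L\<close> above \<open>i\<close>, which compensates for the \<open>4 ^ L\<close>
    summands.\<close>
  have hi: "4 ^ i * (\<Sum>k<4 ^ L. lev M (F k) (u t)) \<le> y (u t) powr (1 / a)" if "i < w * t + w" for i t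
  proof -
    have iL: "i + L \<le> u t" using that w by (simp add: u_def)
    have "4 ^ i * (\<Sum>k<4 ^ L. lev M (F k) (u t)) \<le> 4 ^ i * (\<Sum>k<(4::nat) ^ L. y (u t) powr (1 / a) / 4 ^ u t)"
    proof (intro mult_left_mono sum_mono)
      fix k assume "k \<in> {..<(4::nat) ^ L}"
      then show "lev M (F k) (u t) \<le> y (u t) powr (1 / a) / 4 ^ u t"
        using lev[of k "u t"] by (simp add: field_simps)
    qed simp
    also have "\<dots> = 4 ^ (i + L) / 4 ^ u t * y (u t) powr (1 / a)" by (simp add: power_add)
    also have "\<dots> \<le> 1 * y (u t) powr (1 / a)"
      using power_increasing[OF iL, of "4::real"] by (intro mult_right_mono) auto
    finally show ?thesis by simp
  qed
  have window: "(\<Sum>i=w * t..<w * t + w. A i) \<le> 2 ^ 4 ^ L * (real w * E * (\<Sum>m=l t..<u t. y m) + real w * y (u t))" for t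
  proof -
    have "(\<Sum>i=w * t..<w * t + w. A i)
      \<le> (\<Sum>i=w * t..<w * t + w. \<Sum>U\<in>Pow {..<4 ^ L}. (4 ^ i * lev M (sgn_sum U (4 ^ L) (h t)) i) powr a + y (u t))"
      unfolding A_def
    proof (intro sum_mono)
      fix i U assume i: "i \<in> {w * t..<w * t + w}"
      have "4 ^ i * lev M (sgn_sum U (4 ^ L) g) (Suc i)
        \<le> 4 ^ i * (lev M (sgn_sum U (4 ^ L) (h t)) i + (\<Sum>k<4 ^ L. lev M (F k) (u t)))"
        using window_step[OF Fm w(1), of t i U m0] i
        by (intro mult_left_mono) (auto simp: g_def h_def[abs_def] l_def u_def)
      also have "\<dots> \<le> 4 ^ i * lev M (sgn_sum U (4 ^ L) (h t)) i + y (u t) powr (1 / a)"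
        using hi[of i t] i by (simp add: distrib_left)
      finally have "(4 ^ i * lev M (sgn_sum U (4 ^ L) g) (Suc i)) powr a
        \<le> (4 ^ i * lev M (sgn_sum U (4 ^ L) (h t)) i + y (u t) powr (1 / a)) powr a"
        using a by (intro powr_mono2) auto
      also have "\<dots> \<le> (4 ^ i * lev M (sgn_sum U (4 ^ L) (h t)) i) powr a + (y (u t) powr (1 / a)) powr a"
        using a by (intro powr_add_le_add_powr) auto
      also have "(y (u t) powr (1 / a)) powr a = y (u t)" using a y by (simp add: powr_powr)
      finally show "(4 ^ i * lev M (sgn_sum U (4 ^ L) g) (Suc i)) powr a
        \<le> (4 ^ i * lev M (sgn_sum U (4 ^ L) (h t)) i) powr a + y (u t)" .
    qed
    also have "\<dots> = (\<Sum>U\<in>Pow {..<4 ^ L}. \<Sum>i=w * t..<w * t + w. (4 ^ i * lev M (sgn_sum U (4 ^ L) (h t)) i) powr a)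
        + 2 ^ 4 ^ L * (real w * y (u t))"
      by (subst sum.swap) (simp add: sum.distrib card_Pow)
    also have "\<dots> \<le> 2 ^ 4 ^ L * (real w * E * (\<Sum>m=l t..<u t. y m)) + 2 ^ 4 ^ L * (real w * y (u t))"
      unfolding h_def[abs_def] E_def using w a y lev lu
      by (intro add_right_mono window_middle) auto
    finally show ?thesis by (simp add: distrib_left)
  qed
  have "(\<Sum>i<I. A i) \<le> (\<Sum>i<I * w. A i)"
    using w0 by (intro sum_mono2) (auto simp: A_def intro!: sum_nonneg)
  also have "\<dots> = (\<Sum>t<I. \<Sum>i=w * t..<w * t + w. A i)"
    using sum.nat_group[of A w I] by (simp add: mult.commute)
  also have "\<dots> \<le> (\<Sum>t<I. 2 ^ 4 ^ L * (real w * E * (\<Sum>m=l t..<u t. y m) + real w * y (u t)))"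
    by (intro sum_mono window)
  also have "\<dots> = 2 ^ 4 ^ L * (real w * E * (\<Sum>t<I. \<Sum>m=l t..<u t. y m) + real w * (\<Sum>t<I. y (u t)))"
    by (simp only: sum_distrib_left[symmetric] sum.distrib)
  also have "\<dots> \<le> 2 ^ 4 ^ L * (real w * E * (3 * Z) + real w * Z)"
    unfolding l_def u_def using w w0 y Z
    by (intro mult_left_mono add_mono sum_windows_le sum_multiples_le[of w m0]) (auto simp: E_def)
  finally show ?thesis by (simp add: A_def E_def algebra_simps)
qed

end

context lorentz_basis
begin

text \<open>Each vector is cut at the fixed height \<open>2 ^ m0\<close>. The bounded parts
  contribute order \<open>L powr \<gamma>\<close> with \<open>\<gamma> < 1\<close> and the large
  parts a small multiple of \<open>L\<close>, whereas the lower estimate demands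
  \<open>L * c\<close>.\<close>

lemma contradiction_p_eq_2:
  assumes p2: "p = 2" and q2: "q < 2"
  shows False
proof -
  define a where "a = q/p"
  have a: "0 < a" "a < 1" "a \<le> 1" "q = 2 * a" using p2 q2 q_pos by (auto simp: a_def)
  \<comment> \<open>The midpoint of \<open>1\<close> and \<open>1 / a\<close>: the moment is above
    the second, yet \<open>b * a < 1\<close> keeps the bounded part sublinear in
    \<open>L\<close>.\<close>
  define b where "b = (1 + 1 / a) / 2"
  define \<gamma> where "\<gamma> = b * a"
  have b: "1 < b" using a by (simp add: b_def field_simps)
  have \<gamma>: "\<gamma> < 1" using a by (simp add: \<gamma>_def b_def field_simps)
  define K where "K = max 1 Kl"
  have K: "1 \<le> K" "Kl \<le> K" by (auto simp: K_def)
  define D where "D = 3 * (16 / 3 * khintchine_const a) powr a + 1"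
  have D: "1 \<le> D" by (simp add: D_def)
  define c where "c = 1 - (4::real) powr (- a)"
  have c: "0 < c" using a by (simp add: c_def powr_less_one)
  \<comment> \<open>This makes \<open>K * 4 powr q * D * (2 * \<eta>)\<close> equal to
    \<open>c / 4\<close>, a quarter of the lower bound per unit of \<open>L\<close>.\<close>
  define \<eta> where "\<eta> = c / (8 * K * 4 powr q * D)"
  have \<eta>: "0 < \<eta>" using c K D by (simp add: \<eta>_def)
  obtain r x where r: "strict_mono (r :: nat \<Rightarrow> nat)" and x: "\<And>i. 0 \<le> x i" "summable x"
    and conv: "\<And>d. 0 < d \<Longrightarrow> \<exists>k0. \<forall>k\<ge>k0. \<forall>J. (\<Sum>i<J. \<bar>level_term (r k) i - x i\<bar>) \<le> d"
    by (rule level_term_l1_convergence) (use p2 q2 in auto)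
  obtain m0 where m0: "\<And>J. (\<Sum>m=m0..<J. x m) \<le> \<eta>"
    using summable_tail_le[OF x(2,1) \<eta>] by blast
  define Cb where "Cb = (khintchine_const b * 4 ^ m0) powr \<gamma> / (1 - 4 powr (a * (1 - b)))"
  have main: "real L * c \<le> K * (2 + 2 powr q + 4 powr q * (Cb * real (Suc L) powr \<gamma> + real (L + 2) * D * (2 * \<eta>)))"
    if L: "m0 \<le> L" for L
  proof -
    define n :: nat where "n = 4 ^ L"
    have n: "0 < n" by (simp add: n_def)
    obtain k0 where k0: "\<And>k J. k0 \<le> k \<Longrightarrow> (\<Sum>i<J. \<bar>level_term (r k) i - x i\<bar>) \<le> \<eta> / n"
      using conv[of "\<eta> / n"] \<eta> n by auto
    define \<kappa> where "\<kappa> k = r (k0 + k)" for k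
    have inj: "inj_on \<kappa> {..<n}"
      using strict_mono_eq[OF r] by (auto simp: inj_on_def \<kappa>_def)
    define e where "e j = (\<Sum>k<n. \<bar>level_term (\<kappa> k) j - x j\<bar>)" for j
    define y where "y j = x j + e j" for j
    have e0: "0 \<le> e j" for j by (auto simp: e_def intro!: sum_nonneg)
    have y0: "0 \<le> y j" for j using e0 x by (simp add: y_def)
    have Z: "(\<Sum>m=m0..<J. y m) \<le> 2 * \<eta>" for J
    proof -
      have "(\<Sum>m=m0..<J. e m) \<le> (\<Sum>m<J. e m)" using e0 by (intro sum_mono2) auto
      also have "\<dots> = (\<Sum>k<n. \<Sum>j<J. \<bar>level_term (\<kappa> k) j - x j\<bar>)" unfolding e_def by (rule sum.swap)
      also have "\<dots> \<le> (\<Sum>k<n. \<eta> / n)" unfolding \<kappa>_def by (intro sum_mono k0) auto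
      also have "\<dots> = \<eta>" using n by simp
      finally show ?thesis using m0[of J] by (simp add: y_def sum.distrib)
    qed
    define F where "F k = f (\<kappa> k)" for k
    have Fm [measurable]: "F k \<in> borel_measurable M" for k by (simp add: F_def)
    have levF: "4 ^ j * lev M (F k) j \<le> y j powr (1 / a)" if "k < 4 ^ L" for k j
    proof -
      have "\<bar>level_term (\<kappa> k) j - x j\<bar> \<le> e j"
        unfolding e_def using that by (intro member_le_sum) (auto simp: n_def)
      then have "level_term (\<kappa> k) j \<le> y j" by (simp add: y_def)
      then have "level_term (\<kappa> k) j powr (1 / a) \<le> y j powr (1 / a)" using a(1) by (intro powr_mono2) auto
      moreover have "level_term (\<kappa> k) j powr (1 / a) = 4 ^ j * lev M (F k) j"
        using a p2 scaled_lev_powr[of j "\<kappa> k", symmetric]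
        by (simp add: powr_powr a_def[symmetric] F_def four_power_eq)
      ultimately show ?thesis by simp
    qed
    define g where "g k x = weight k *\<^sub>R F k x" for k x
    define gb where "gb k x = weight k *\<^sub>R band 0 (2 ^ m0) (F k) x" for k x
    define gl where "gl k x = weight k *\<^sub>R (if 2 ^ m0 < norm (F k x) then F k x else 0)" for k x
    have [measurable]: "g k \<in> borel_measurable M" "gb k \<in> borel_measurable M" "gl k \<in> borel_measurable M" for k
      unfolding g_def gb_def gl_def by measurable
    have split: "sgn_sum U n g x = sgn_sum U n gb x + sgn_sum U n gl x" for U x
    proof -
      have "g k x = gb k x + gl k x" for k by (auto simp: g_def gb_def gl_def band_def)
      then show ?thesis by (simp add: sgn_sum_def scaleR_add_right sum.distrib)
    qed
    have pw: "(2 ^ i) powr q = ((4 ^ i) powr a :: real)" for i :: nat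
      using a by (simp add: four_power_eq powr_powr flip: powr_numeral)
    define A where "A i = (\<Sum>U\<in>Pow {..<n}. (2 ^ i) powr q * lev M (sgn_sum U n g) i powr a)" for i
    define A1 where "A1 i = (\<Sum>U\<in>Pow {..<n}. (4 ^ i * lev M (sgn_sum U n gb) i) powr a)" for i
    define A2 where "A2 i = (\<Sum>U\<in>Pow {..<n}. (4 ^ i * lev M (sgn_sum U n gl) (Suc i)) powr a)" for i
    \<comment> \<open>One level is lost in splitting \<open>g\<close> into \<open>gb\<close> and
      \<open>gl\<close>, another in \<open>window_step\<close>; the shift by two costs
      \<open>4 powr q\<close>.\<close>
    have AA: "A (i + 2) \<le> 4 powr q * (A1 i + A2 i)" for i
    proof -
      have "A (i + 2) \<le> (\<Sum>U\<in>Pow {..<n}. 4 powr q * ((4 ^ i * lev M (sgn_sum U n gb) i) powr a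
          + (4 ^ i * lev M (sgn_sum U n gl) (Suc i)) powr a))"
        unfolding A_def
      proof (intro sum_mono)
        fix U
        have "lev M (sgn_sum U n g) (i + 2) \<le> lev M (sgn_sum U n gb) (Suc i) + lev M (sgn_sum U n gl) (Suc i)"
          using lev_Suc_add[of "sgn_sum U n gb" "sgn_sum U n gl" "sgn_sum U n g" "Suc i"] split by simp
        also have "lev M (sgn_sum U n gb) (Suc i) \<le> lev M (sgn_sum U n gb) i"
          by (intro lev_antimono) auto
        finally have "lev M (sgn_sum U n g) (i + 2) powr a
          \<le> (lev M (sgn_sum U n gb) i + lev M (sgn_sum U n gl) (Suc i)) powr a"
          using a by (intro powr_mono2) auto
        also have "\<dots> \<le> lev M (sgn_sum U n gb) i powr a + lev M (sgn_sum U n gl) (Suc i) powr a"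
          using a by (intro powr_add_le_add_powr) auto
        finally have "(2 ^ (i + 2)) powr q * lev M (sgn_sum U n g) (i + 2) powr a
          \<le> (2 ^ (i + 2)) powr q * (lev M (sgn_sum U n gb) i powr a + lev M (sgn_sum U n gl) (Suc i) powr a)"
          by (intro mult_left_mono) auto
        moreover have e: "(2 ^ (i + 2)) powr q = 4 powr q * ((4 ^ i) powr a :: real)"
          by (simp add: power_add powr_mult pw)
        ultimately show "(2 ^ (i + 2)) powr q * lev M (sgn_sum U n g) (i + 2) powr a
          \<le> 4 powr q * ((4 ^ i * lev M (sgn_sum U n gb) i) powr a + (4 ^ i * lev M (sgn_sum U n gl) (Suc i)) powr a)"
          unfolding e by (simp add: powr_mult distrib_left mult.assoc)
      qed
      then show ?thesis by (simp only: sum_distrib_left[symmetric] sum.distrib A1_def A2_def)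
    qed
    have Ale: "A i \<le> 2 ^ n * (2 ^ i) powr q" for i
    proof -
      have "A i \<le> (\<Sum>U\<in>Pow {..<n}. (2 ^ i) powr q * 1)"
        unfolding A_def using a by (intro sum_mono mult_left_mono powr_le1) auto
      then show ?thesis by (simp add: card_Pow)
    qed
    have A0: "0 \<le> A i" for i by (auto simp: A_def intro!: sum_nonneg)
    have S1: "(\<Sum>i<I. A1 i) \<le> 2 ^ n * (Cb * real (Suc L) powr \<gamma>)" for I
    proof -
      have "(\<Sum>i<I. A1 i) \<le> 2 ^ n * ((khintchine_const b * (real (Suc L) * 4 ^ m0)) powr (b * a) / (1 - 4 powr (a * (1 - b))))"
        unfolding A1_def
      proof (rule sgn_sum_bounded_levels[where R = "\<lambda>k. weight k * 2 ^ m0"])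
        show "norm (gb k x) \<le> weight k * 2 ^ m0" for k x
          using weight_pos[of k] by (auto simp: gb_def band_def)
        have "(\<Sum>k<n. (weight k * 2 ^ m0)\<^sup>2) = (\<Sum>k<n. (weight k)\<^sup>2) * 4 ^ m0"
          by (simp add: power_mult_distrib four_power_eq sum_distrib_right)
        also have "\<dots> \<le> real (Suc L) * 4 ^ m0"
          unfolding n_def by (intro mult_right_mono sum_weight_sq_le) auto
        finally show "(\<Sum>k<n. (weight k * 2 ^ m0)\<^sup>2) \<le> real (Suc L) * 4 ^ m0" .
      qed (use a b in auto)
      also have "(khintchine_const b * (real (Suc L) * 4 ^ m0)) powr (b * a)
        = (khintchine_const b * 4 ^ m0) powr \<gamma> * real (Suc L) powr \<gamma>"
        using khintchine_const_ge_1[of b] unfolding \<gamma>_def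
        by (subst powr_mult[symmetric]) (auto simp: ac_simps)
      finally show ?thesis by (simp add: Cb_def)
    qed
    \<comment> \<open>The windows have length \<open>L + 2\<close>, which exceeds both
      \<open>L + 1\<close> and \<open>m0\<close>.\<close>
    have S2: "(\<Sum>i<I. A2 i) \<le> 2 ^ n * (real (L + 2) * D * (2 * \<eta>))" for I
      unfolding A2_def D_def n_def gl_def[abs_def]
      by (rule sgn_sum_large_levels[OF Fm _ _ a(1,3) y0 Z levF]) (use L in auto)
    define B where "B = 1 + 2 powr q + 4 powr q * (Cb * real (Suc L) powr \<gamma> + real (L + 2) * D * (2 * \<eta>))"
    have "(\<Sum>U\<in>Pow {..<n}. level_sum p q M (sgn_sum U n (\<lambda>k x. weight k *\<^sub>R f (\<kappa> k) x)) I) \<le> 2 ^ n * B" for I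
    proof -
      have "(\<Sum>U\<in>Pow {..<n}. level_sum p q M (sgn_sum U n (\<lambda>k x. weight k *\<^sub>R f (\<kappa> k) x)) I) = (\<Sum>i<I. A i)"
        unfolding level_sum_def A_def a_def g_def[abs_def] F_def by (rule sum.swap)
      also have "\<dots> \<le> (\<Sum>i<Suc (Suc I). A i)" using A0 by (intro sum_mono2) auto
      also have "\<dots> = A 0 + A 1 + (\<Sum>i<I. A (i + 2))"
        by (simp only: sum.lessThan_Suc_shift add_2_eq_Suc' One_nat_def add.assoc)
      also have "\<dots> \<le> 2 ^ n * (2 ^ 0) powr q + 2 ^ n * (2 ^ 1) powr q + (\<Sum>i<I. 4 powr q * (A1 i + A2 i))"
        by (intro add_mono sum_mono Ale AA)
      also have "(\<Sum>i<I. 4 powr q * (A1 i + A2 i)) = 4 powr q * ((\<Sum>i<I. A1 i) + (\<Sum>i<I. A2 i))"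
        by (simp only: sum_distrib_left[symmetric] sum.distrib)
      also have "\<dots> \<le> 4 powr q * (2 ^ n * (Cb * real (Suc L) powr \<gamma>) + 2 ^ n * (real (L + 2) * D * (2 * \<eta>)))"
        by (intro mult_left_mono add_mono S1 S2) auto
      finally show ?thesis by (simp add: B_def algebra_simps)
    qed
    then have "(\<Sum>k<n. weight k powr q * (real (Suc k) powr (q/p) - real k powr (q/p))) \<le> Kl * (1 + B)"
      using weight_pos by (intro lower_average[OF inj]) (auto simp: less_imp_le intro: weight_antimono)
    moreover have "real L * c \<le> (\<Sum>k<n. weight k powr q * (real (Suc k) powr (q/p) - real k powr (q/p)))"
      using sum_weight_powr_ge[OF a(1), of L] a(4) unfolding c_def n_def a_def[symmetric] by simp
    moreover have "Kl * (1 + B) \<le> K * (1 + B)"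
    proof -
      have "4 powr (a * (1 - b)) < (1::real)" using a(1) b by (auto simp: mult_pos_neg powr_less_one)
      then have "0 \<le> Cb" unfolding Cb_def by (intro divide_nonneg_nonneg) auto
      then have "0 \<le> B" using D \<eta> by (simp add: B_def)
      then show ?thesis using K by (intro mult_right_mono) auto
    qed
    ultimately have "real L * c \<le> K * (1 + B)" by linarith
    moreover have "1 + B = 2 + 2 powr q + 4 powr q * (Cb * real (Suc L) powr \<gamma> + real (L + 2) * D * (2 * \<eta>))"
      by (simp add: B_def)
    ultimately show ?thesis by (simp only:)
  qed
  define Q where "Q = 4 * (K * (2 + 2 powr q)) + 7 * c"
  have "((\<lambda>N. K * 4 powr q * Cb * real N powr (\<gamma> - 1)) \<longlongrightarrow> K * 4 powr q * Cb * 0) sequentially"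
    using \<gamma> by (intro tendsto_mult tendsto_const tendsto_neg_powr filterlim_real_sequentially) auto
  then have "eventually (\<lambda>N. K * 4 powr q * Cb * real N powr (\<gamma> - 1) < c / 4) sequentially"
    using c by (intro order_tendstoD) auto
  moreover obtain N0 :: nat where N0: "Q / c < real N0" using reals_Archimedean2 by blast
  ultimately have "eventually (\<lambda>N. K * 4 powr q * Cb * real N powr (\<gamma> - 1) < c / 4 \<and> max N0 (Suc m0) \<le> N) sequentially"
    by (intro eventually_conj eventually_ge_at_top)
  then obtain N where N: "K * 4 powr q * Cb * real N powr (\<gamma> - 1) < c / 4" "N0 \<le> N" "Suc m0 \<le> N"
    by (auto simp: eventually_sequentially)
  then obtain L where L: "N = Suc L" by (cases N) auto
  have "K * 4 powr q * Cb * real N powr \<gamma> = K * 4 powr q * Cb * real N powr (\<gamma> - 1) * real N"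
    using L by (simp add: powr_diff)
  also have "\<dots> \<le> c / 4 * real N" using N by (intro mult_right_mono) auto
  finally have 1: "K * 4 powr q * Cb * real N powr \<gamma> \<le> c / 4 * real N" .
  have "K * 4 powr q * (real (L + 2) * D * (2 * \<eta>)) = c / 4 * real (L + 2)"
    using K D by (simp add: \<eta>_def)
  moreover have "c / 4 * real (L + 2) = c / 4 * real N + c / 4"
    using L by (simp add: field_simps)
  ultimately have 2: "K * 4 powr q * (real (L + 2) * D * (2 * \<eta>)) = c / 4 * real N + c / 4"
    by (rule trans)
  have "Q / c < real N" using N0 N by simp
  then have 3: "Q < c * real N" using c by (simp add: field_simps)
  have 4: "real L * c \<le> K * (2 + 2 powr q) + (K * 4 powr q * Cb * real N powr \<gamma>
      + K * 4 powr q * (real (L + 2) * D * (2 * \<eta>)))"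
    using main[of L] N L by (simp add: algebra_simps)
  have 5: "real L * c = c * real N - c" using L by (simp add: algebra_simps)
  have 6: "c / 4 * real N = c * real N / 4" by simp
  have 7: "0 < K * (2 + 2 powr q)" using K by (intro mult_pos_pos add_pos_pos) auto
  have False if "4 * P + 7 * c < u" "u - c \<le> P + (A + R)" "A \<le> u / 4" "R = u / 4 + c / 4" "0 < P"
    for P u A R :: real
    using that c by linarith
  from this[OF 3[unfolded Q_def] 4[unfolded 5] 1[unfolded 6] 2[unfolded 6] 7] show False .
qed

section \<open>Combination of the cases and transfer to the unit interval\<close>

lemma contradiction:
  assumes "p \<noteq> q" "p < 2 \<or> q \<le> 1"
  shows False
proof (cases "p < 2")
  case True
  then show ?thesis
    using assms contradiction_p_less_q contradiction_q_less_p by (cases "p < q") auto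
next
  case False
  then show ?thesis
    using assms contradiction_p_eq_2 contradiction_p_greater_2 by (cases "p = 2") auto
qed

end

text \<open>The two sort constraints on the scalars are shared by \<open>real\<close> and
  \<open>complex\<close>, so one argument covers both fields.\<close>

lemma no_lorentz_iso_embedding:
  fixes T :: "(nat \<Rightarrow> 'k::{real_normed_field, euclidean_space}) \<Rightarrow> 'a \<Rightarrow> 'k"
  assumes "prob_space M" "0 < p" "0 < q" "p \<noteq> q" "p < 2 \<or> q \<le> 1"
  shows "\<not> lorentz_iso_embedding p q M T"
proof
  assume "lorentz_iso_embedding p q M T"
  then obtain Ku Kl and f :: "nat \<Rightarrow> 'a \<Rightarrow> 'k" where "lorentz_basis M p q Ku Kl f"
    using lorentz_iso_embedding_imp_basis assms(1-3) by blast
  then show False using lorentz_basis.contradiction assms(4,5) by blast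
qed

lemma prob_space_unit_interval: "prob_space (lebesgue_on {0<..<1::real})"
  by (intro prob_spaceI) (simp add: space_restrict_space emeasure_restrict_space)

theorem theorem1p1:
  fixes p q :: real
  assumes "0 < p" and "0 < q" and "p \<noteq> q"
    and "p < 2 \<or> q \<le> 1"
  shows "\<not> (\<exists>T :: (nat \<Rightarrow> real) \<Rightarrow> real \<Rightarrow> real.
               lorentz_iso_embedding p q (lebesgue_on {0<..<1}) T) \<and>
         \<not> (\<exists>T :: (nat \<Rightarrow> complex) \<Rightarrow> real \<Rightarrow> complex.
               lorentz_iso_embedding p q (lebesgue_on {0<..<1}) T)"
  using no_lorentz_iso_embedding[OF prob_space_unit_interval assms, where 'k = real]
    no_lorentz_iso_embedding[OF prob_space_unit_interval assms, where 'k = complex] by blast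

end
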